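(* Let $\mathbb{F}$ be any subfield of $\mathbb{C}$ with $\mathbb{F}\cap(0,\infty)$ closed under positive square roots, and let $\star\in\{n,00,\mathcal H\}$ (where $n\ge1$ is an integer). Put $\star'=n$ if $\star=n$ and $\star'=\infty$ otherwise. Define a binary operation $\boxdot$ on $LPM^{\mathbb{F}}_\star$ as follows: for $A=L\mathbb{D}_{\boldsymbol\epsilon}L^*$ and $A'=L'\mathbb{D}_{\boldsymbol\epsilon'}(L')^*$ in $LPM_\star^{\mathbb{F}}$, with $L,L'\in\mathbf{L}^{\mathbb{F}}_\star$ and $\boldsymbol\epsilon,\boldsymbol\epsilon'\in\{\pm1\}^{\star'}$, $$A\boxdot A':=(L\circledcirc L')\cdot(\mathbb{D}_{\boldsymbol\epsilon}\mathbb{D}_{\boldsymbol\epsilon'})\cdot(L\circledcirc L')^*\in LPM^{\mathbb{F}}_\star(\boldsymbol\epsilon\circ\boldsymbol\epsilon'),\qquad(L\mathbb{D}_{\boldsymbol\epsilon}L^* )_\boxdot^{-1}:=L_\circledcirc^{-1}\,\mathbb{D}_{\boldsymbol\epsilon}\,(L_\circledcirc^{-1})^*.$$ (1) This structure (with identity $\mathrm{Id}_{\star'}$) makes $LPM^{\mathbb{F}}_\star$ into an abelian group that is isomorphic to the direct product $PD^{\mathbb{F}}_\star\times S_2^{\star'}$. On the subgroup $PD^{\mathbb{F}}_\star=LPM^{\mathbb{F}}_\star(\mathbf 1_{\star'})$ we have $\boxdot\equiv\circledast$. (2) This group is equipped with a family of bi-invariant metrics that extend the metric on the subgroup $PD_\star^{\mathbb{F}}$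 and the discrete metric on $S_2^{\star'}$: $$d_p(L\mathbb{D}_{\boldsymbol\epsilon}L^*,K\mathbb{D}_{\boldsymbol\epsilon'}K^* ):=\big\|\big(d_{\mathbf{L}_\star}(L,K),\,1-\delta_{\boldsymbol\epsilon,\boldsymbol\epsilon'}\big)\big\|_p,\qquad p\in[1,\infty].$$ (3) If $\star=\star'=n$, then one can similarly equip $TPM^{\mathbb{F}}_n$ with a parallel structure. If moreover $\mathbb{F}=\mathbb{R}$ or $\mathbb{C}$, the cones $LPM_n^{\mathbb{F}}$ and $TPM_n^{\mathbb{F}}$ are abelian complete separable metric Lie groups and Riemannian manifolds with bi-invariant metric (and sectional curvature zero). Moreover, the reversal map $A\mapsto(P_nAP_n)^*$ is an isometric isomorphism of Lie groups $LPM_n^{\mathbb{F}}\to TPM_n^{\mathbb{F}}$. (4) The nontrivial torsion elements of $LPM^{\mathbb{F}}_\star$ are precisely the matrices $\mathbb{D}_{\boldsymbol\epsilon}$ for all $\boldsymbol\epsilon\in\{\pm1\}^{\star'}\setminus\{\mathbf 1_{\star'}\}$.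
   Context: $*$ is conjugate transpose. For a finite or infinite sign sequence $\delta$, $\mathbb{D}_\delta=\mathrm{diag}(\delta_1,\delta_1\delta_2,\delta_2\delta_3,\dots)$. $\circ$ is the coordinatewise product of sign sequences, $\mathbf 1$ the all-ones sequence, $S_2=\{\pm1\}$ and $S_2^{\star'}=\{\pm1\}^{\star'}$ under $\circ$; $\delta_{\boldsymbol\epsilon,\boldsymbol\epsilon'}$ is the Kronecker delta and $\|\cdot\|_p$ the $\ell^p$ norm on $\mathbb{R}^2$. $\lfloor L\rfloor$, $\mathbb{D}(L)$: strictly lower triangular and diagonal parts; $L\circledcirc K=\lfloor L\rfloor+\lfloor K\rfloor+\mathbb{D}(L)\mathbb{D}(K)$, $L_\circledcirc^{-1}=-\lfloor L\rfloor+\mathbb{D}(L)^{-1}$. $\mathbf{L}_n^{\mathbb{F}}$: lower triangular $n\times n$ matrices over $\mathbb{F}$ with diagonal in $\mathbb{F}\cap(0,\infty)$. $\mathbf{L}_{00}^{\mathbb{F}}$: semi-infinite lower triangular matrices over $\mathbb{F}$ with diagonal in $\mathbb{F}\cap(0,\infty)$, all but finitely many diagonal entries $1$, and all but finitely many below-diagonal entries $0$. $\mathbf{L}_{\mathcal H}^{\mathbb{F}}$: semi-infinite lower triangular matrices over $\mathbb{F}$ with diagonal in $\mathbb{F}\cap(0,\infty)$, $\sum_j(\log l_{jj})^2<\infty$ and $\sum_{i>j}|l_{ij}|^2<\infty$. $d_{\mathbf{L}_\star}(L,K)=\big(\sum_{i>j}|l_{ij}-k_{ij}|^2+\sum_j(\log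 l_{jj}-\log k_{jj})^2\big)^{1/2}$. $LPM_n^{\mathbb{F}}(\epsilon)$ (resp. $TPM_n^{\mathbb{F}}(\epsilon)$): Hermitian matrices in $\mathbb{F}^{n\times n}$ whose leading (resp. trailing) principal $k\times k$ minor is nonzero of sign $\epsilon_k$, $1\le k\le n$. $LPM_{00}^{\mathbb{F}}(\boldsymbol\epsilon)$: semi-infinite matrices $\begin{pmatrix}A&0\\0&\mathrm{diag}(\epsilon_m\epsilon_{m+1},\epsilon_{m+1}\epsilon_{m+2},\dots)\end{pmatrix}$ with $m\ge1$, $A\in LPM_m^{\mathbb{F}}((\epsilon_1,\dots,\epsilon_m))$. $LPM_{\mathcal H}^{\mathbb{F}}(\boldsymbol\epsilon)$: semi-infinite matrices with entries in $\mathbb{F}$ of the form $L\mathbb{D}_{\boldsymbol\epsilon}L^*$ with $L\in\mathbf{L}_{\mathcal H}^{\mathbb{F}}$. $LPM_\star^{\mathbb{F}}$ (and $TPM_n^{\mathbb{F}}$) is the disjoint union over all sign sequences in $\{\pm1\}^{\star'}$. Every element of $LPM_\star^{\mathbb{F}}(\boldsymbol\epsilon)$ is uniquely $L\mathbb{D}_{\boldsymbol\epsilon}L^*$ with $L\in\mathbf{L}_\star^{\mathbb{F}}$. On $LPM_\star^{\mathbb{F}}(\boldsymbol\epsilon)$: $(L\mathbb{D}_{\boldsymbol\epsilon}L^* )\circledast(K\mathbb{D}_{\boldsymbol\epsilon}K^* )=(L\circledcirc K)\mathbb{D}_{\boldsymbol\epsilon}(L\circledcirc K)^*$, and the metric on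 $PD_\star^{\mathbb{F}}$ is $d(LL^*,KK^* )=d_{\mathbf{L}_\star}(L,K)$. $P_n$ is the anti-diagonal permutation matrix. The parallel structure on $TPM_n^{\mathbb{F}}$: every element of $TPM_n^{\mathbb{F}}(\epsilon)$ is uniquely $L^*P_n\mathbb{D}_\epsilon P_nL$ with $L\in\mathbf{L}_n^{\mathbb{F}}$; the product of the elements with data $(L,\epsilon)$, $(L',\epsilon')$ is $(L\circledcirc L')^*P_n\mathbb{D}_\epsilon\mathbb{D}_{\epsilon'}P_n(L\circledcirc L')$, and $d_p$ is given by the same formula in $(L,\epsilon),(K,\epsilon')$. For $\mathbb{F}=\mathbb{R},\mathbb{C}$ the Riemannian metric on each component is transported from $\widetilde g_L(X,Y)=\mathrm{Re}\sum_{i>j}\overline{x_{ij}}y_{ij}+\sum_jx_{jj}y_{jj}l_{jj}^{-2}$ on $\mathbf{L}_n^{\mathbb{F}}$. *)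

theory Defs
  imports
    "HOL-Analysis.Analysis"
    "HOL-Algebra.Product_Groups"
    "HOL-Library.Function_Algebras"
    "Jordan_Normal_Form.Determinant"
begin

section \<open>Smooth calculus, Lie groups and Riemannian metrics on open subsets of vector spaces\<close>

text \<open>Functions into a real vector space form a real vector space (the additive structure comes
  from \<^theory>\<open>HOL-Library.Function_Algebras\<close>).  Matrices below have type
  \<^typ>\<open>nat \<Rightarrow> nat \<Rightarrow> complex\<close>, with the product topology; on a finite-dimensional
  subspace this is the Euclidean topology.\<close>

instantiation "fun" :: (type, real_vector) real_vector
begin

definition "r *\<^sub>R f = (\<lambda>x. r *\<^sub>R f x)"

instance
  by standard (auto simp: scaleR_fun_def fun_eq_iff scaleR_right_distrib scaleR_left_distrib)

end

definition has_dirderiv ::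
    "('v::{real_vector,topological_space} \<Rightarrow> 'w::{real_vector,t2_space}) \<Rightarrow> 'v \<Rightarrow> 'v \<Rightarrow> 'w \<Rightarrow> bool"
  where "has_dirderiv f v x d \<longleftrightarrow>
    ((\<lambda>t::real. inverse t *\<^sub>R (f (x + t *\<^sub>R v) - f x)) \<longlongrightarrow> d) (at 0)"

definition dirderiv ::
    "('v::{real_vector,topological_space} \<Rightarrow> 'w::{real_vector,t2_space}) \<Rightarrow> 'v \<Rightarrow> 'v \<Rightarrow> 'w"
  where "dirderiv f v x = (THE d. has_dirderiv f v x d)"

text \<open>\<open>Ck_on k E U f\<close>: all iterated derivatives of order at most \<open>k\<close> of \<open>f\<close> in directions from \<open>E\<close>
  exist and are continuous on \<open>U\<close>.  For a finite-dimensional subspace \<open>E\<close> and \<open>U\<close> relatively open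
  in \<open>E\<close> this is the usual class \<open>C\<^sup>k\<close>.\<close>

primrec Ck_on ::
    "nat \<Rightarrow> 'v set \<Rightarrow> 'v set \<Rightarrow>
     ('v::{real_vector,topological_space} \<Rightarrow> 'w::{real_vector,t2_space}) \<Rightarrow> bool"
  where
    "Ck_on 0 E U f \<longleftrightarrow> continuous_on U f"
  | "Ck_on (Suc k) E U f \<longleftrightarrow> continuous_on U f \<and>
       (\<forall>v\<in>E. (\<forall>x\<in>U. \<exists>d. has_dirderiv f v x d) \<and> Ck_on k E U (dirderiv f v))"

definition smooth_on ::
    "'v set \<Rightarrow> 'v set \<Rightarrow>
     ('v::{real_vector,topological_space} \<Rightarrow> 'w::{real_vector,t2_space}) \<Rightarrow> bool"
  where "smooth_on E U f \<longleftrightarrow> (\<forall>k. Ck_on k E U f)"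

text \<open>An open subset \<open>U\<close> of a finite-dimensional real vector space \<open>E\<close>, regarded as a manifold with
  its standard smooth structure; every tangent space is identified with \<open>E\<close>.\<close>

definition open_submanifold :: "'v::{real_vector,topological_space} set \<Rightarrow> 'v set \<Rightarrow> bool"
  where "open_submanifold E U \<longleftrightarrow>
    (\<exists>B. finite B \<and> E = span B) \<and> openin (top_of_set E) U"

definition lie_group :: "'v::{real_vector,t2_space} set \<Rightarrow> 'v monoid \<Rightarrow> bool"
  where "lie_group E G \<longleftrightarrow>
    group G \<and> open_submanifold E (carrier G) \<and>
    smooth_on (E \<times> E) (carrier G \<times> carrier G) (\<lambda>(x, y). x \<otimes>\<^bsub>G\<^esub> y) \<and>
    smooth_on E (carrier G) (\<lambda>x. inv\<^bsub>G\<^esub> x)"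

definition lie_group_iso ::
    "'v::{real_vector,t2_space} set \<Rightarrow> 'v monoid \<Rightarrow> 'w::{real_vector,t2_space} set \<Rightarrow> 'w monoid \<Rightarrow>
     ('v \<Rightarrow> 'w) \<Rightarrow> bool"
  where "lie_group_iso E G E' H \<phi> \<longleftrightarrow>
    \<phi> \<in> iso G H \<and> smooth_on E (carrier G) \<phi> \<and>
    smooth_on E' (carrier H) (inv_into (carrier G) \<phi>)"

definition inner_product_on :: "'v::real_vector set \<Rightarrow> ('v \<Rightarrow> 'v \<Rightarrow> real) \<Rightarrow> bool"
  where "inner_product_on E b \<longleftrightarrow>
    (\<forall>u\<in>E. \<forall>v\<in>E. \<forall>w\<in>E. \<forall>r. b (r *\<^sub>R u + v) w = r * b u w + b v w) \<and>
    (\<forall>u\<in>E. \<forall>v\<in>E. b u v = b v u) \<and>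
    (\<forall>u\<in>E. u \<noteq> 0 \<longrightarrow> 0 < b u u)"

definition riemannian_manifold ::
    "'v::{real_vector,t2_space} set \<Rightarrow> 'v set \<Rightarrow> ('v \<Rightarrow> 'v \<Rightarrow> 'v \<Rightarrow> real) \<Rightarrow> bool"
  where "riemannian_manifold E U g \<longleftrightarrow>
    open_submanifold E U \<and>
    (\<forall>x\<in>U. inner_product_on E (g x)) \<and>
    (\<forall>v\<in>E. \<forall>w\<in>E. smooth_on E U (\<lambda>x. g x v w))"

definition bi_invariant_riemannian ::
    "'v::{real_vector,t2_space} set \<Rightarrow> 'v monoid \<Rightarrow> ('v \<Rightarrow> 'v \<Rightarrow> 'v \<Rightarrow> real) \<Rightarrow> bool"
  where "bi_invariant_riemannian E G g \<longleftrightarrow>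
    (\<forall>a\<in>carrier G. \<forall>b\<in>carrier G. \<forall>v\<in>E. \<forall>w\<in>E.
      g (b \<otimes>\<^bsub>G\<^esub> a) (dirderiv (\<lambda>x. b \<otimes>\<^bsub>G\<^esub> x) v a) (dirderiv (\<lambda>x. b \<otimes>\<^bsub>G\<^esub> x) w a) = g a v w \<and>
      g (a \<otimes>\<^bsub>G\<^esub> b) (dirderiv (\<lambda>x. x \<otimes>\<^bsub>G\<^esub> b) v a) (dirderiv (\<lambda>x. x \<otimes>\<^bsub>G\<^esub> b) w a) = g a v w)"

definition riemannian_isometry_on ::
    "'v::{real_vector,t2_space} set \<Rightarrow> 'v set \<Rightarrow> ('v \<Rightarrow> 'v \<Rightarrow> 'v \<Rightarrow> real) \<Rightarrow>
     ('w::{real_vector,t2_space} \<Rightarrow> 'w \<Rightarrow> 'w \<Rightarrow> real) \<Rightarrow> ('v \<Rightarrow> 'w) \<Rightarrow> bool"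
  where "riemannian_isometry_on E U g h \<phi> \<longleftrightarrow>
    (\<forall>x\<in>U. \<forall>v\<in>E. \<forall>w\<in>E. h (\<phi> x) (dirderiv \<phi> v x) (dirderiv \<phi> w x) = g x v w)"

text \<open>The Levi-Civita connection in the linear coordinates of \<open>E\<close>: for constant vector fields
  \<open>v\<close>, \<open>w\<close> the value \<open>\<nabla>\<^sub>v w\<close> at \<open>x\<close> is determined by the Koszul formula (all Lie brackets of constant
  fields vanish).\<close>

definition christoffel ::
    "'v::{real_vector,t2_space} set \<Rightarrow> ('v \<Rightarrow> 'v \<Rightarrow> 'v \<Rightarrow> real) \<Rightarrow> 'v \<Rightarrow> 'v \<Rightarrow> 'v \<Rightarrow> 'v"
  where "christoffel E g x v w = (THE u. u \<in> E \<and>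
    (\<forall>z\<in>E. 2 * g x u z =
      dirderiv (\<lambda>y. g y w z) v x + dirderiv (\<lambda>y. g y v z) w x - dirderiv (\<lambda>y. g y v w) z x))"

text \<open>\<open>riemann_curvature E g x u v w\<close> is \<open>R(u, v) w\<close> at \<open>x\<close>, with
  \<open>R(u, v) = \<nabla>\<^sub>u \<nabla>\<^sub>v - \<nabla>\<^sub>v \<nabla>\<^sub>u - \<nabla>\<close>\<open>\<^sub>[\<^sub>u\<^sub>,\<^sub>v\<^sub>]\<close>, again for constant fields.\<close>

definition riemann_curvature ::
    "'v::{real_vector,t2_space} set \<Rightarrow> ('v \<Rightarrow> 'v \<Rightarrow> 'v \<Rightarrow> real) \<Rightarrow> 'v \<Rightarrow> 'v \<Rightarrow> 'v \<Rightarrow> 'v \<Rightarrow> 'v"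
  where "riemann_curvature E g x u v w =
    dirderiv (\<lambda>y. christoffel E g y v w) u x - dirderiv (\<lambda>y. christoffel E g y u w) v x +
    christoffel E g x u (christoffel E g x v w) - christoffel E g x v (christoffel E g x u w)"

definition sectional_curvature ::
    "'v::{real_vector,t2_space} set \<Rightarrow> ('v \<Rightarrow> 'v \<Rightarrow> 'v \<Rightarrow> real) \<Rightarrow> 'v \<Rightarrow> 'v \<Rightarrow> 'v \<Rightarrow> real"
  where "sectional_curvature E g x u v =
    g x (riemann_curvature E g x u v v) u / (g x u u * g x v v - (g x u v)\<^sup>2)"

definition sectional_curvature_zero ::
    "'v::{real_vector,t2_space} set \<Rightarrow> 'v set \<Rightarrow> ('v \<Rightarrow> 'v \<Rightarrow> 'v \<Rightarrow> real) \<Rightarrow> bool"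
  where "sectional_curvature_zero E U g \<longleftrightarrow>
    (\<forall>x\<in>U. \<forall>u\<in>E. \<forall>v\<in>E. u \<noteq> v \<and> independent {u, v} \<longrightarrow> sectional_curvature E g x u v = 0)"


section \<open>Groups with bi-invariant metrics\<close>

definition bi_invariant_metric :: "('a, 'b) monoid_scheme \<Rightarrow> ('a \<Rightarrow> 'a \<Rightarrow> real) \<Rightarrow> bool"
  where "bi_invariant_metric G d \<longleftrightarrow>
    Metric_space (carrier G) d \<and>
    (\<forall>a\<in>carrier G. \<forall>b\<in>carrier G. \<forall>c\<in>carrier G.
      d (c \<otimes>\<^bsub>G\<^esub> a) (c \<otimes>\<^bsub>G\<^esub> b) = d a b \<and> d (a \<otimes>\<^bsub>G\<^esub> c) (b \<otimes>\<^bsub>G\<^esub> c) = d a b)"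

definition complete_separable_metric_lie_group ::
    "'v::{real_vector,t2_space} set \<Rightarrow> 'v monoid \<Rightarrow> ('v \<Rightarrow> 'v \<Rightarrow> real) \<Rightarrow> bool"
  where "complete_separable_metric_lie_group E G d \<longleftrightarrow>
    lie_group E G \<and> bi_invariant_metric G d \<and>
    Metric_space.mtopology (carrier G) d = top_of_set (carrier G) \<and>
    Metric_space.mcomplete (carrier G) d \<and>
    separable_space (Metric_space.mtopology (carrier G) d)"

definition torsion_elements :: "('a, 'b) monoid_scheme \<Rightarrow> 'a set"
  where "torsion_elements G = {a \<in> carrier G. \<exists>m::nat. 0 < m \<and> a [^]\<^bsub>G\<^esub> m = \<one>\<^bsub>G\<^esub>}"

definition lp_norm2 :: "ereal \<Rightarrow> real \<Rightarrow> real \<Rightarrow> real"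
  where "lp_norm2 p x y =
    (if p = \<infinity> then max \<bar>x\<bar> \<bar>y\<bar>
     else (\<bar>x\<bar> powr real_of_ereal p + \<bar>y\<bar> powr real_of_ereal p) powr (1 / real_of_ereal p))"


section \<open>Finite and semi-infinite matrices\<close>

text \<open>Rows and columns are numbered from \<open>0\<close>.  The shapes \<open>Fin n\<close>, \<open>Finitary\<close>, \<open>Hilbert\<close> stand for
  \<open>n\<close>, \<open>00\<close>, \<open>\<H>\<close>.  An \<open>n \<times> n\<close> matrix is encoded as a function that vanishes unless both indices are
  below \<open>n\<close>.\<close>

datatype shape = Fin nat | Finitary | Hilbert

fun idx :: "shape \<Rightarrow> nat set"
  where
    "idx (Fin n) = {..<n}"
  | "idx Finitary = UNIV"
  | "idx Hilbert = UNIV"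

type_synonym cmat = "nat \<Rightarrow> nat \<Rightarrow> complex"

text \<open>In every product used below each sum over \<open>k\<close> has only finitely many nonzero terms.\<close>

definition mmul :: "cmat \<Rightarrow> cmat \<Rightarrow> cmat"  (infixl \<open>\<star>\<close> 70)
  where "A \<star> B = (\<lambda>i j. \<Sum>\<^sub>\<infinity>k. A i k * B k j)"

definition ctrans :: "cmat \<Rightarrow> cmat"
  where "ctrans A = (\<lambda>i j. cnj (A j i))"

definition idmat :: "shape \<Rightarrow> cmat"
  where "idmat s = (\<lambda>i j. if i = j \<and> i \<in> idx s then 1 else 0)"

definition antidiag :: "nat \<Rightarrow> cmat"
  where "antidiag n = (\<lambda>i j. if i < n \<and> j < n \<and> i + j + 1 = n then 1 else 0)"

definition is_subfield :: "complex set \<Rightarrow> bool"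
  where "is_subfield F \<longleftrightarrow> 0 \<in> F \<and> 1 \<in> F \<and>
    (\<forall>x\<in>F. \<forall>y\<in>F. x - y \<in> F \<and> x * y \<in> F) \<and> (\<forall>x\<in>F. inverse x \<in> F)"

text \<open>Sign sequences, as extensional functions on the index set, with the coordinatewise product.\<close>

definition S2 :: "real monoid"
  where "S2 = \<lparr>carrier = {1, -1}, monoid.mult = (*), one = 1\<rparr>"

definition sign_group :: "shape \<Rightarrow> (nat \<Rightarrow> real) monoid"
  where "sign_group s = product_group (idx s) (\<lambda>_. S2)"

abbreviation signs :: "shape \<Rightarrow> (nat \<Rightarrow> real) set"
  where "signs s \<equiv> carrier (sign_group s)"

definition sign_diag :: "shape \<Rightarrow> (nat \<Rightarrow> real) \<Rightarrow> cmat"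
  where "sign_diag s \<epsilon> = (\<lambda>i j.
    if i = j \<and> i \<in> idx s
    then complex_of_real (if i = 0 then \<epsilon> 0 else \<epsilon> (i - 1) * \<epsilon> i) else 0)"


section \<open>Lower triangular matrices\<close>

definition lower_tri :: "shape \<Rightarrow> complex set \<Rightarrow> cmat set"
  where "lower_tri s F = {L.
    (\<forall>i j. L i j \<in> F) \<and>
    (\<forall>i j. i \<notin> idx s \<or> j \<notin> idx s \<or> i < j \<longrightarrow> L i j = 0) \<and>
    (\<forall>j\<in>idx s. L j j \<in> \<real> \<and> 0 < Re (L j j))}"

fun LT :: "shape \<Rightarrow> complex set \<Rightarrow> cmat set"
  where
    "LT (Fin n) F = lower_tri (Fin n) F"
  | "LT Finitary F = {L \<in> lower_tri Finitary F.
       finite {j. L j j \<noteq> 1} \<and> finite {(i, j). j < i \<and> L i j \<noteq> 0}}"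
  | "LT Hilbert F = {L \<in> lower_tri Hilbert F.
       (\<lambda>j. (ln (Re (L j j)))\<^sup>2) summable_on UNIV \<and>
       (\<lambda>(i, j). (cmod (L i j))\<^sup>2) summable_on {(i, j). j < i}}"

definition LT_mult :: "cmat \<Rightarrow> cmat \<Rightarrow> cmat"
  where "LT_mult L K = (\<lambda>i j.
    if j < i then L i j + K i j else if i = j then L i i * K i i else 0)"

definition LT_inv :: "cmat \<Rightarrow> cmat"
  where "LT_inv L = (\<lambda>i j.
    if j < i then - L i j else if i = j then inverse (L i i) else 0)"

definition LT_dist :: "shape \<Rightarrow> cmat \<Rightarrow> cmat \<Rightarrow> real"
  where "LT_dist s L K = sqrt (
    (\<Sum>\<^sub>\<infinity>(i, j)\<in>{(i, j). i \<in> idx s \<and> j < i}. (cmod (L i j - K i j))\<^sup>2) +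
    (\<Sum>\<^sub>\<infinity>j\<in>idx s. (ln (Re (L j j)) - ln (Re (K j j)))\<^sup>2))"

definition LT_riem :: "nat \<Rightarrow> cmat \<Rightarrow> cmat \<Rightarrow> cmat \<Rightarrow> real"
  where "LT_riem n L X Y =
    Re (\<Sum>i<n. \<Sum>j<i. cnj (X i j) * Y i j) +
    (\<Sum>j<n. Re (X j j) * Re (Y j j) / (Re (L j j))\<^sup>2)"


section \<open>The cones LPM\<close>

definition herm :: "nat \<Rightarrow> complex set \<Rightarrow> cmat set"
  where "herm n F = {A.
    (\<forall>i j. A i j \<in> F) \<and> (\<forall>i j. i \<ge> n \<or> j \<ge> n \<longrightarrow> A i j = 0) \<and> ctrans A = A}"

definition leading_minor :: "nat \<Rightarrow> cmat \<Rightarrow> complex"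
  where "leading_minor k A = Determinant.det (Matrix.mat k k (\<lambda>(i, j). A i j))"

definition trailing_minor :: "nat \<Rightarrow> nat \<Rightarrow> cmat \<Rightarrow> complex"
  where "trailing_minor n k A =
    Determinant.det (Matrix.mat k k (\<lambda>(i, j). A (n - k + i) (n - k + j)))"

text \<open>The minors of a Hermitian matrix are real, so the complex \<^const>\<open>sgn\<close> is the real sign; being
  equal to \<open>\<plusminus>1\<close> it forces the minor to be nonzero.\<close>

definition LPMn :: "nat \<Rightarrow> complex set \<Rightarrow> (nat \<Rightarrow> real) \<Rightarrow> cmat set"
  where "LPMn n F \<epsilon> =
    {A \<in> herm n F. \<forall>k\<in>{1..n}. sgn (leading_minor k A) = complex_of_real (\<epsilon> (k - 1))}"

definition TPM :: "nat \<Rightarrow> complex set \<Rightarrow> (nat \<Rightarrow> real) \<Rightarrow> cmat set"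
  where "TPM n F \<epsilon> =
    {A \<in> herm n F. \<forall>k\<in>{1..n}. sgn (trailing_minor n k A) = complex_of_real (\<epsilon> (k - 1))}"

definition ldl :: "shape \<Rightarrow> cmat \<Rightarrow> (nat \<Rightarrow> real) \<Rightarrow> cmat"
  where "ldl s L \<epsilon> = L \<star> sign_diag s \<epsilon> \<star> ctrans L"

fun LPM :: "shape \<Rightarrow> complex set \<Rightarrow> (nat \<Rightarrow> real) \<Rightarrow> cmat set"
  where
    "LPM (Fin n) F \<epsilon> = LPMn n F \<epsilon>"
  | "LPM Finitary F \<epsilon> =
       {B. \<exists>m\<ge>1. \<exists>A\<in>LPMn m F \<epsilon>.
          B = (\<lambda>i j. if i < m \<and> j < m then A i j
                     else if i = j then complex_of_real (\<epsilon> (i - 1) * \<epsilon> i) else 0)}"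
  | "LPM Hilbert F \<epsilon> =
       {B. (\<forall>i j. B i j \<in> F) \<and> (\<exists>L\<in>LT Hilbert F. B = ldl Hilbert L \<epsilon>)}"

definition LPM_all :: "shape \<Rightarrow> complex set \<Rightarrow> cmat set"
  where "LPM_all s F = (\<Union>\<epsilon>\<in>signs s. LPM s F \<epsilon>)"

abbreviation PD :: "shape \<Rightarrow> complex set \<Rightarrow> cmat set"
  where "PD s F \<equiv> LPM s F \<one>\<^bsub>sign_group s\<^esub>"

definition ldl_factor :: "shape \<Rightarrow> complex set \<Rightarrow> (nat \<Rightarrow> real) \<Rightarrow> cmat \<Rightarrow> cmat"
  where "ldl_factor s F \<epsilon> A = (THE L. L \<in> LT s F \<and> A = ldl s L \<epsilon>)"

definition lpm_sign :: "shape \<Rightarrow> complex set \<Rightarrow> cmat \<Rightarrow> nat \<Rightarrow> real"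
  where "lpm_sign s F A = (THE \<epsilon>. \<epsilon> \<in> signs s \<and> A \<in> LPM s F \<epsilon>)"

definition lpm_chol :: "shape \<Rightarrow> complex set \<Rightarrow> cmat \<Rightarrow> cmat"
  where "lpm_chol s F A = ldl_factor s F (lpm_sign s F A) A"

text \<open>The product \<open>\<circledast>\<close> on the cone with sign sequence \<open>\<epsilon>\<close>, and the metric on the positive cone.\<close>

definition lpm_cast :: "shape \<Rightarrow> complex set \<Rightarrow> (nat \<Rightarrow> real) \<Rightarrow> cmat \<Rightarrow> cmat \<Rightarrow> cmat"
  where "lpm_cast s F \<epsilon> A B = ldl s (LT_mult (ldl_factor s F \<epsilon> A) (ldl_factor s F \<epsilon> B)) \<epsilon>"

definition PD_group :: "shape \<Rightarrow> complex set \<Rightarrow> cmat monoid"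
  where "PD_group s F =
    \<lparr>carrier = PD s F, monoid.mult = lpm_cast s F \<one>\<^bsub>sign_group s\<^esub>, one = idmat s\<rparr>"

definition pd_chol :: "shape \<Rightarrow> complex set \<Rightarrow> cmat \<Rightarrow> cmat"
  where "pd_chol s F A = (THE L. L \<in> LT s F \<and> A = L \<star> ctrans L)"

definition pd_dist :: "shape \<Rightarrow> complex set \<Rightarrow> cmat \<Rightarrow> cmat \<Rightarrow> real"
  where "pd_dist s F A B = LT_dist s (pd_chol s F A) (pd_chol s F B)"

definition lpm_box :: "shape \<Rightarrow> complex set \<Rightarrow> cmat \<Rightarrow> cmat \<Rightarrow> cmat"
  where "lpm_box s F A B =
    (let L = LT_mult (lpm_chol s F A) (lpm_chol s F B)
     in L \<star> (sign_diag s (lpm_sign s F A) \<star> sign_diag s (lpm_sign s F B)) \<star> ctrans L)"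

definition LPM_group :: "shape \<Rightarrow> complex set \<Rightarrow> cmat monoid"
  where "LPM_group s F =
    \<lparr>carrier = LPM_all s F, monoid.mult = lpm_box s F, one = idmat s\<rparr>"

definition lpm_dist :: "shape \<Rightarrow> complex set \<Rightarrow> ereal \<Rightarrow> cmat \<Rightarrow> cmat \<Rightarrow> real"
  where "lpm_dist s F p A B =
    lp_norm2 p (LT_dist s (lpm_chol s F A) (lpm_chol s F B))
      (1 - (if lpm_sign s F A = lpm_sign s F B then 1 else 0))"

text \<open>The transport of \<^const>\<open>LT_riem\<close> along \<open>L \<mapsto> ldl (Fin n) L \<epsilon>\<close>, that is, its pullback along the
  inverse \<^const>\<open>lpm_chol\<close>.\<close>

definition lpm_riem :: "nat \<Rightarrow> complex set \<Rightarrow> cmat \<Rightarrow> cmat \<Rightarrow> cmat \<Rightarrow> real"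
  where "lpm_riem n F A X Y =
    LT_riem n (lpm_chol (Fin n) F A)
      (dirderiv (lpm_chol (Fin n) F) X A) (dirderiv (lpm_chol (Fin n) F) Y A)"


section \<open>The cones TPM\<close>

definition TPM_all :: "nat \<Rightarrow> complex set \<Rightarrow> cmat set"
  where "TPM_all n F = (\<Union>\<epsilon>\<in>signs (Fin n). TPM n F \<epsilon>)"

definition tldl :: "nat \<Rightarrow> cmat \<Rightarrow> (nat \<Rightarrow> real) \<Rightarrow> cmat"
  where "tldl n L \<epsilon> =
    ctrans L \<star> antidiag n \<star> sign_diag (Fin n) \<epsilon> \<star> antidiag n \<star> L"

definition tpm_sign :: "nat \<Rightarrow> complex set \<Rightarrow> cmat \<Rightarrow> nat \<Rightarrow> real"
  where "tpm_sign n F A = (THE \<epsilon>. \<epsilon> \<in> signs (Fin n) \<and> A \<in> TPM n F \<epsilon>)"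

definition tpm_chol :: "nat \<Rightarrow> complex set \<Rightarrow> cmat \<Rightarrow> cmat"
  where "tpm_chol n F A = (THE L. L \<in> LT (Fin n) F \<and> A = tldl n L (tpm_sign n F A))"

definition tpm_box :: "nat \<Rightarrow> complex set \<Rightarrow> cmat \<Rightarrow> cmat \<Rightarrow> cmat"
  where "tpm_box n F A B =
    (let L = LT_mult (tpm_chol n F A) (tpm_chol n F B)
     in ctrans L \<star> antidiag n \<star>
        (sign_diag (Fin n) (tpm_sign n F A) \<star> sign_diag (Fin n) (tpm_sign n F B)) \<star>
        antidiag n \<star> L)"

definition TPM_group :: "nat \<Rightarrow> complex set \<Rightarrow> cmat monoid"
  where "TPM_group n F =
    \<lparr>carrier = TPM_all n F, monoid.mult = tpm_box n F, one = idmat (Fin n)\<rparr>"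

definition tpm_dist :: "nat \<Rightarrow> complex set \<Rightarrow> ereal \<Rightarrow> cmat \<Rightarrow> cmat \<Rightarrow> real"
  where "tpm_dist n F p A B =
    lp_norm2 p (LT_dist (Fin n) (tpm_chol n F A) (tpm_chol n F B))
      (1 - (if tpm_sign n F A = tpm_sign n F B then 1 else 0))"

definition tpm_riem :: "nat \<Rightarrow> complex set \<Rightarrow> cmat \<Rightarrow> cmat \<Rightarrow> cmat \<Rightarrow> real"
  where "tpm_riem n F A X Y =
    LT_riem n (tpm_chol n F A)
      (dirderiv (tpm_chol n F) X A) (dirderiv (tpm_chol n F) Y A)"

definition reversal :: "nat \<Rightarrow> cmat \<Rightarrow> cmat"
  where "reversal n A = ctrans (antidiag n \<star> A \<star> antidiag n)"

end

theory Submission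
  imports Defs
begin

text \<open>The map \<open>(L, \<epsilon>) \<mapsto> L D\<^sub>\<epsilon> L\<^sup>*\<close> is a bijection onto the cone, so the group structure is that of
  triangular matrices times signs.  Taking logarithms on the diagonal turns the triangular group into
  a vector space with its \<open>\<ell>\<^sup>2\<close> metric; this gives the bi-invariant metrics, torsion-freeness of the
  positive part and, over \<open>\<real>\<close> and \<open>\<complex>\<close>, a global chart \<open>\<phi>\<close> on each component in which the
  Riemannian metric is constant.  Flatness follows since the curvature is expressed by third
  derivatives of \<open>\<phi>\<close>, which are symmetric.  The trailing cones are the images of the leading ones
  under reversal, with \<open>L\<close> replaced by \<open>P L\<^sup>* P\<close>.\<close>

section \<open>Elementary functions\<close>

text \<open>A factor exists because the pivots of Gaussian elimination are quotients of consecutive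
  leading minors: prescribing the signs of the minors prescribes the pivot signs
  \<open>\<epsilon> (k - 1) * \<epsilon> k\<close>, which form the diagonal of
  \<open>sign_diag\<close>, and makes every square root one of a positive number. Comparing columns
  one after the other gives uniqueness, also for semi-infinite matrices.

  The main obstacle is in the differential geometry. The product topology on matrices comes from no
  norm, so calculus is done for a single class of scalar functions, and the symmetry of second
  derivatives is an induction over the rules that generate the class. In the chart
  \<open>\<phi>\<close> the metric is \<open><D\<phi> v, D\<phi> w>\<close> for a constant inner
  product, and the Koszul formula collapses to \<open>D\<phi> (\<Gamma> v w) = D2\<phi> v w\<close>.
  Solving it requires \<open>D\<phi>\<close> to be a bijection from the Hermitian matrices onto the
  triangular ones with real diagonal: \<open>lift\<close> provides surjectivity,
  \<open>D\<phi>_inj\<close> injectivity.\<close>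

definition curve_in :: "'v::{real_vector,t2_space} set \<Rightarrow> (real \<Rightarrow> 'v) \<Rightarrow> 'v \<Rightarrow> 'v \<Rightarrow> bool"
  where "curve_in U c x v \<longleftrightarrow> c 0 = x \<and> (\<forall>\<^sub>F t in at 0. c t \<in> U) \<and> (c \<longlongrightarrow> x) (at 0) \<and>
    ((\<lambda>t. inverse t *\<^sub>R (c t - x)) \<longlongrightarrow> v) (at 0)"

text \<open>The convergence clause has to be demanded, because the type classes provide a topology
  and a vector space structure without any compatibility between them.\<close>

definition line_open :: "'v::{real_vector,t2_space} set \<Rightarrow> 'v set \<Rightarrow> bool"
  where "line_open E U \<longleftrightarrow> (\<forall>x\<in>U. \<forall>v\<in>E. ((\<lambda>t. x + t *\<^sub>R v) \<longlongrightarrow> x) (at 0) \<and>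
    (\<forall>\<^sub>F t in at 0. x + t *\<^sub>R v \<in> U))"

text \<open>A class of functions that contains the entries of the triangular factors and is closed under
  differentiation.  Derivatives are taken along arbitrary curves, which makes the chain rule
  available although the ambient matrix space carries no norm.\<close>

inductive elementary :: "'v::{real_vector,t2_space} set \<Rightarrow> ('v \<Rightarrow> complex) \<Rightarrow> bool"
  for U where
  locally_const: "(\<And>x. x \<in> U \<Longrightarrow> \<exists>W. open W \<and> x \<in> W \<and> (\<forall>y\<in>W \<inter> U. f y = f x)) \<Longrightarrow> elementary U f"
| cont_linear: "linear l \<Longrightarrow> continuous_on UNIV l \<Longrightarrow> elementary U l"
| add: "elementary U f \<Longrightarrow> elementary U g \<Longrightarrow> elementary U (\<lambda>x. f x + g x)"
| mult: "elementary U f \<Longrightarrow> elementary U g \<Longrightarrow> elementary U (\<lambda>x. f x * g x)"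
| inverse: "elementary U f \<Longrightarrow> (\<And>x. x \<in> U \<Longrightarrow> f x \<noteq> 0) \<Longrightarrow> elementary U (\<lambda>x. inverse (f x))"
| cnj: "elementary U f \<Longrightarrow> elementary U (\<lambda>x. cnj (f x))"
| sqrt: "elementary U f \<Longrightarrow> (\<And>x. x \<in> U \<Longrightarrow> 0 < Re (f x)) \<Longrightarrow>
    elementary U (\<lambda>x. complex_of_real (sqrt (Re (f x))))"
| ln: "elementary U f \<Longrightarrow> (\<And>x. x \<in> U \<Longrightarrow> 0 < Re (f x)) \<Longrightarrow>
    elementary U (\<lambda>x. complex_of_real (ln (Re (f x))))"
| cong: "elementary U f \<Longrightarrow> (\<And>x. x \<in> U \<Longrightarrow> g x = f x) \<Longrightarrow> elementary U g"

declare elementary.intros [rule del]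

lemma elementary_const: "elementary U (\<lambda>x. a)"
  by (rule locally_const) auto

lemma elementary_sum: "(\<And>i. i \<in> I \<Longrightarrow> elementary U (f i)) \<Longrightarrow> elementary U (\<lambda>x. \<Sum>i\<in>I. f i x)"
  by (induction I rule: infinite_finite_induct)
    (auto intro: elementary_const elementary.add)

lemma elementary_uminus: "elementary U f \<Longrightarrow> elementary U (\<lambda>x. - f x)"
  using elementary.mult[OF elementary_const[of U "-1"], of f] by simp

lemma elementary_diff: "elementary U f \<Longrightarrow> elementary U g \<Longrightarrow> elementary U (\<lambda>x. f x - g x)"
  using elementary.add[OF _ elementary_uminus, of U f g] by simp

lemma elementary_Re: "elementary U f \<Longrightarrow> elementary U (\<lambda>x. complex_of_real (Re (f x)))"
proof -
  assume f: "elementary U f"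
  have "elementary U (\<lambda>x. (1/2) * (f x + cnj (f x)))"
    by (intro elementary.mult elementary_const elementary.add elementary.cnj f)
  then show ?thesis by (rule elementary.cong) (simp add: complex_eq_iff)
qed

lemma elementary_Im: "elementary U f \<Longrightarrow> elementary U (\<lambda>x. complex_of_real (Im (f x)))"
proof -
  assume f: "elementary U f"
  have "elementary U (\<lambda>x. complex_of_real (Re (- \<i> * f x)))"
    by (intro elementary_Re elementary.mult elementary_const f)
  then show ?thesis by (rule elementary.cong) (simp add: complex_eq_iff)
qed

text \<open>Serves two purposes: with the projections of a product it yields smoothness of the
  multiplication in both variables jointly, and with \<open>reversal\<close> it moves the leading
  factor to the trailing cone.\<close>

lemma elementary_linear_comp:
  assumes "elementary U f" "linear l" "continuous_on UNIV l" "l ` U' \<subseteq> U"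
  shows "elementary U' (\<lambda>x. f (l x))"
  using assms(1)
proof induction
  case (locally_const f)
  show ?case
  proof (rule elementary.locally_const)
    fix x assume "x \<in> U'"
    then obtain W where W: "open W" "l x \<in> W" "\<forall>y\<in>W \<inter> U. f y = f (l x)"
      using locally_const assms(4) by blast
    show "\<exists>W. open W \<and> x \<in> W \<and> (\<forall>y\<in>W \<inter> U'. f (l y) = f (l x))"
      using W assms(3,4) by (intro exI[of _ "l -` W"]) (auto intro: open_vimage)
  qed
next
  case (cont_linear k)
  show ?case
    by (rule elementary.cont_linear)
      (use linear_compose[OF assms(2) cont_linear(1)] continuous_on_compose2[OF cont_linear(2) assms(3)]
        in \<open>auto simp: o_def\<close>)
next
  case (cong f g)
  then show ?case using assms(4) by (auto intro: elementary.cong)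
qed (use assms(4) in \<open>auto intro!: elementary.intros(3-8)\<close>)

lemma elementary_continuous: "elementary U f \<Longrightarrow> continuous_on U f"
proof (induction rule: elementary.induct)
  case (locally_const f)
  show ?case unfolding continuous_on_eq_continuous_within continuous_within
  proof
    fix x assume "x \<in> U"
    then obtain W where W: "open W" "x \<in> W" "\<forall>y\<in>W \<inter> U. f y = f x"
      using locally_const by blast
    have "\<forall>\<^sub>F y in at x within U. f y = f x"
      using W unfolding eventually_at_topological by blast
    then show "(f \<longlongrightarrow> f x) (at x within U)" by (rule tendsto_eventually)
  qed
next
  case (cont_linear l)
  then show ?case using continuous_on_subset by blast
next
  case (cong f g)
  then show ?case by (simp cong: continuous_on_cong)
next
  case (ln f)
  then show ?case by (intro continuous_intros) (auto simp: less_imp_neq[symmetric])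
qed (auto intro!: continuous_intros)

section \<open>Derivatives along curves\<close>

lemma has_vector_derivative_at_0_iff:
  fixes F :: "real \<Rightarrow> 'a::real_normed_vector"
  shows "(F has_vector_derivative d) (at 0) \<longleftrightarrow> ((\<lambda>t. inverse t *\<^sub>R (F t - F 0)) \<longlongrightarrow> d) (at 0)"
proof -
  have "\<forall>\<^sub>F t in at 0. norm (F (0 + t) - F 0 - t *\<^sub>R d) / norm t = norm (inverse t *\<^sub>R (F t - F 0) - d)"
  proof (rule eventually_at_topological[THEN iffD2], intro exI[of _ UNIV] conjI ballI impI)
    fix t :: real assume t: "t \<noteq> 0"
    have "inverse t *\<^sub>R (F t - F 0) - d = inverse t *\<^sub>R (F (0 + t) - F 0 - t *\<^sub>R d)"
      using t by (simp add: scaleR_diff_right)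
    then show "norm (F (0 + t) - F 0 - t *\<^sub>R d) / norm t = norm (inverse t *\<^sub>R (F t - F 0) - d)"
      by (simp add: divide_inverse mult.commute)
  qed auto
  then have "((\<lambda>h. norm (F (0 + h) - F 0 - h *\<^sub>R d) / norm h) \<longlongrightarrow> 0) (at 0) \<longleftrightarrow>
      ((\<lambda>t. norm (inverse t *\<^sub>R (F t - F 0) - d)) \<longlongrightarrow> 0) (at 0)"
    by (rule filterlim_cong[OF refl refl])
  then show ?thesis
    unfolding has_vector_derivative_def has_derivative_at
    by (simp add: bounded_linear_scaleR_left tendsto_norm_zero_iff Lim_null[symmetric])
qed

text \<open>The codomain is normed here although the domain is not. Matrix-valued maps are therefore
  differentiated entry by entry later on.\<close>

lemma has_dirderiv_iff_vector:
  fixes f :: "'v::{real_vector,t2_space} \<Rightarrow> 'a::real_normed_vector"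
  shows "has_dirderiv f v x d \<longleftrightarrow> ((\<lambda>t. f (x + t *\<^sub>R v)) has_vector_derivative d) (at 0)"
  unfolding has_dirderiv_def has_vector_derivative_at_0_iff by simp

lemma has_dirderiv_unique: "has_dirderiv f v x d \<Longrightarrow> has_dirderiv f v x d' \<Longrightarrow> d = d'"
  unfolding has_dirderiv_def by (rule tendsto_unique[OF trivial_limit_at])

lemma dirderiv_eqI: "has_dirderiv f v x d \<Longrightarrow> dirderiv f v x = d"
  unfolding dirderiv_def using has_dirderiv_unique by blast

lemma curve_in_line:
  "line_open E U \<Longrightarrow> x \<in> U \<Longrightarrow> v \<in> E \<Longrightarrow> curve_in U (\<lambda>t. x + t *\<^sub>R v) x v"
  unfolding line_open_def curve_in_def
  by (auto intro!: tendsto_eventually eventually_at_topological[THEN iffD2] exI[of _ UNIV])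

lemma has_vector_derivative_inverse_0:
  fixes F :: "real \<Rightarrow> complex"
  assumes "(F has_vector_derivative d) (at 0)" "F 0 \<noteq> 0"
  shows "((\<lambda>t. inverse (F t)) has_vector_derivative - (inverse (F 0) * d * inverse (F 0))) (at 0)"
proof -
  have "(F has_derivative (\<lambda>h. h *\<^sub>R d)) (at 0)"
    using assms(1) by (simp add: has_vector_derivative_def)
  from Deriv.has_derivative_inverse[OF assms(2) this] show ?thesis
    by (simp add: has_vector_derivative_def)
qed

lemma has_vector_derivative_Re_0:
  fixes F :: "real \<Rightarrow> complex"
  assumes "(F has_vector_derivative d) (at 0)"
  shows "((\<lambda>t. Re (F t)) has_real_derivative Re d) (at 0)"
  using assms
  by (simp add: has_vector_derivative_complex_iff has_real_derivative_iff_has_vector_derivative)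

lemma has_vector_derivative_sqrt_0:
  fixes F :: "real \<Rightarrow> complex"
  assumes "(F has_vector_derivative d) (at 0)" "0 < Re (F 0)"
  shows "((\<lambda>t. complex_of_real (sqrt (Re (F t)))) has_vector_derivative
    complex_of_real (Re d) * inverse (2 * complex_of_real (sqrt (Re (F 0))))) (at 0)"
proof -
  have "((\<lambda>t. sqrt (Re (F t))) has_real_derivative inverse (sqrt (Re (F 0))) / 2 * Re d) (at 0)"
    by (rule DERIV_chain2[OF DERIV_real_sqrt[OF assms(2)] has_vector_derivative_Re_0[OF assms(1)]])
  note 1 = has_vector_derivative_of_real[OF this, where ?'a = complex]
  have 2: "complex_of_real (inverse (sqrt (Re (F 0))) / 2 * Re d) =
      complex_of_real (Re d) * inverse (2 * complex_of_real (sqrt (Re (F 0))))"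
    by (simp only: divide_inverse of_real_mult of_real_inverse inverse_mult_distrib of_real_numeral
        mult_ac)
  show ?thesis using 1 unfolding 2 .
qed
lemma has_vector_derivative_ln_0:
  fixes F :: "real \<Rightarrow> complex"
  assumes "(F has_vector_derivative d) (at 0)" "0 < Re (F 0)"
  shows "((\<lambda>t. complex_of_real (ln (Re (F t)))) has_vector_derivative
    complex_of_real (Re d) * inverse (complex_of_real (Re (F 0)))) (at 0)"
proof -
  have "((\<lambda>t. ln (Re (F t))) has_real_derivative inverse (Re (F 0)) * Re d) (at 0)"
    by (rule DERIV_chain2[OF DERIV_ln[OF assms(2)] has_vector_derivative_Re_0[OF assms(1)]])
  note 1 = has_vector_derivative_of_real[OF this, where ?'a = complex]
  have 2: "complex_of_real (inverse (Re (F 0)) * Re d) =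
      complex_of_real (Re d) * inverse (complex_of_real (Re (F 0)))"
    by simp
  show ?thesis using 1 unfolding 2 .
qed

text \<open>The three properties must be proved together. That the derivative is elementary allows
  iteration; linearity in the direction allows expansion over unit matrices; and correctness along
  every curve, not just along lines, is the chain rule needed for curves that are straight only in
  logarithmic coordinates.\<close>

lemma elementary_derivative:
  assumes "elementary U f"
  shows "\<exists>f'. (\<forall>v. elementary U (f' v)) \<and> (\<forall>x\<in>U. linear (\<lambda>v. f' v x)) \<and>
    (\<forall>x\<in>U. \<forall>c v. curve_in U c x v \<longrightarrow> ((\<lambda>t. f (c t)) has_vector_derivative f' v x) (at 0))"
  using assms
proof induction
  case (locally_const f)
  show ?case
  proof (rule exI[of _ "\<lambda>v x. 0"], intro conjI ballI allI impI)
    fix x c v assume x: "x \<in> U" and c: "curve_in U c x v"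
    obtain W where W: "open W" "x \<in> W" "\<forall>y\<in>W \<inter> U. f y = f x"
      using locally_const x by blast
    have "\<forall>\<^sub>F t in at 0. c t \<in> W"
      using c W(1,2) unfolding curve_in_def by (auto elim: topological_tendstoD)
    then have "\<forall>\<^sub>F t in at 0. c t \<in> W \<inter> U"
      using c unfolding curve_in_def by (auto intro: eventually_conj)
    then have "\<forall>\<^sub>F t in at 0. inverse t *\<^sub>R (f (c t) - f (c 0)) = 0"
      by eventually_elim (use W c in \<open>auto simp: curve_in_def\<close>)
    then show "((\<lambda>t. f (c t)) has_vector_derivative 0) (at 0)"
      unfolding has_vector_derivative_at_0_iff by (rule tendsto_eventually)
  qed (auto intro: elementary_const linear_zero)
next
  case (cont_linear l)
  show ?case
  proof (rule exI[of _ "\<lambda>v x. l v"], intro conjI ballI allI impI)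
    fix x c v assume x: "x \<in> U" and c: "curve_in U c x v"
    have "((\<lambda>t. l (inverse t *\<^sub>R (c t - x))) \<longlongrightarrow> l v) (at 0)"
      by (rule continuous_on_tendsto_compose[OF cont_linear(2)])
        (use c in \<open>auto simp: curve_in_def\<close>)
    then show "((\<lambda>t. l (c t)) has_vector_derivative l v) (at 0)"
      unfolding has_vector_derivative_at_0_iff using c cont_linear(1)
      by (simp add: linear_cmul linear_diff curve_in_def)
  qed (use cont_linear in \<open>auto intro: elementary_const\<close>)
next
  case (add f g)
  then obtain f' g' where f': "\<And>v. elementary U (f' v)" "\<And>x. x \<in> U \<Longrightarrow> linear (\<lambda>v. f' v x)"
      "\<And>x c v. x \<in> U \<Longrightarrow> curve_in U c x v \<Longrightarrow> ((\<lambda>t. f (c t)) has_vector_derivative f' v x) (at 0)"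
    and g': "\<And>v. elementary U (g' v)" "\<And>x. x \<in> U \<Longrightarrow> linear (\<lambda>v. g' v x)"
      "\<And>x c v. x \<in> U \<Longrightarrow> curve_in U c x v \<Longrightarrow> ((\<lambda>t. g (c t)) has_vector_derivative g' v x) (at 0)"
    by metis
  show ?case
    by (rule exI[of _ "\<lambda>v x. f' v x + g' v x"])
      (auto intro!: elementary.add f' g' linear_compose_add has_vector_derivative_add)
next
  case (mult f g)
  then obtain f' g' where f': "\<And>v. elementary U (f' v)" "\<And>x. x \<in> U \<Longrightarrow> linear (\<lambda>v. f' v x)"
      "\<And>x c v. x \<in> U \<Longrightarrow> curve_in U c x v \<Longrightarrow> ((\<lambda>t. f (c t)) has_vector_derivative f' v x) (at 0)"
    and g': "\<And>v. elementary U (g' v)" "\<And>x. x \<in> U \<Longrightarrow> linear (\<lambda>v. g' v x)"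
      "\<And>x c v. x \<in> U \<Longrightarrow> curve_in U c x v \<Longrightarrow> ((\<lambda>t. g (c t)) has_vector_derivative g' v x) (at 0)"
    by metis
  show ?case
  proof (rule exI[of _ "\<lambda>v x. f x * g' v x + f' v x * g x"], intro conjI ballI allI impI)
    fix x assume "x \<in> U"
    then show "linear (\<lambda>v. f x * g' v x + f' v x * g x)"
      using f'(2)[of x] g'(2)[of x] by (auto simp: linear_iff algebra_simps)
  next
    fix x c v assume x: "x \<in> U" and c: "curve_in U c x v"
    have [simp]: "c 0 = x" using c by (simp add: curve_in_def)
    show "((\<lambda>t. f (c t) * g (c t)) has_vector_derivative f x * g' v x + f' v x * g x) (at 0)"
      using has_vector_derivative_mult[OF f'(3)[OF x c] g'(3)[OF x c]] by simp
  qed (auto intro!: elementary.add elementary.mult f' g' mult.hyps)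
next
  case (inverse f)
  then obtain f' where f': "\<And>v. elementary U (f' v)" "\<And>x. x \<in> U \<Longrightarrow> linear (\<lambda>v. f' v x)"
      "\<And>x c v. x \<in> U \<Longrightarrow> curve_in U c x v \<Longrightarrow> ((\<lambda>t. f (c t)) has_vector_derivative f' v x) (at 0)"
    by metis
  show ?case
  proof (rule exI[of _ "\<lambda>v x. - (inverse (f x) * f' v x * inverse (f x))"], intro conjI ballI allI impI)
    fix x assume "x \<in> U"
    then show "linear (\<lambda>v. - (inverse (f x) * f' v x * inverse (f x)))"
      using f'(2)[of x] by (auto simp: linear_iff algebra_simps)
  next
    fix x c v assume x: "x \<in> U" and c: "curve_in U c x v"
    have [simp]: "c 0 = x" using c by (simp add: curve_in_def)
    show "((\<lambda>t. inverse (f (c t))) has_vector_derivative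
        - (inverse (f x) * f' v x * inverse (f x))) (at 0)"
      using has_vector_derivative_inverse_0[OF f'(3)[OF x c]] inverse(2)[OF x] by simp
  qed (auto intro!: elementary_uminus elementary.mult elementary.inverse f' inverse.hyps)
next
  case (cnj f)
  then obtain f' where f': "\<And>v. elementary U (f' v)" "\<And>x. x \<in> U \<Longrightarrow> linear (\<lambda>v. f' v x)"
      "\<And>x c v. x \<in> U \<Longrightarrow> curve_in U c x v \<Longrightarrow> ((\<lambda>t. f (c t)) has_vector_derivative f' v x) (at 0)"
    by metis
  show ?case
  proof (rule exI[of _ "\<lambda>v x. cnj (f' v x)"], intro conjI ballI allI impI)
    fix x assume "x \<in> U"
    then show "linear (\<lambda>v. cnj (f' v x))"
      using f'(2)[of x] by (auto simp: linear_iff)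
  next
    fix x c v assume x: "x \<in> U" and c: "curve_in U c x v"
    show "((\<lambda>t. cnj (f (c t))) has_vector_derivative cnj (f' v x)) (at 0)"
      using f'(3)[OF x c] by (rule has_vector_derivative_cnj)
  qed (auto intro!: elementary.cnj f')
next
  case (sqrt f)
  then obtain f' where f': "\<And>v. elementary U (f' v)" "\<And>x. x \<in> U \<Longrightarrow> linear (\<lambda>v. f' v x)"
      "\<And>x c v. x \<in> U \<Longrightarrow> curve_in U c x v \<Longrightarrow> ((\<lambda>t. f (c t)) has_vector_derivative f' v x) (at 0)"
    by metis
  show ?case
  proof (rule exI[of _ "\<lambda>v x. complex_of_real (Re (f' v x)) * inverse (2 * complex_of_real (sqrt (Re
      (f x))))"],
      intro conjI ballI allI impI)
    fix x assume "x \<in> U"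
    then show "linear (\<lambda>v. complex_of_real (Re (f' v x)) * inverse (2 * complex_of_real (sqrt (Re (f
        x)))))"
      using f'(2)[of x] by (auto simp: linear_iff scaleR_conv_of_real algebra_simps)
  next
    fix x c v assume x: "x \<in> U" and c: "curve_in U c x v"
    have [simp]: "c 0 = x" using c by (simp add: curve_in_def)
    show "((\<lambda>t. complex_of_real (sqrt (Re (f (c t))))) has_vector_derivative
        complex_of_real (Re (f' v x)) * inverse (2 * complex_of_real (sqrt (Re (f x))))) (at 0)"
      using has_vector_derivative_sqrt_0[OF f'(3)[OF x c]] sqrt(2)[OF x] by simp
  next
    fix v show "elementary U (\<lambda>x. complex_of_real (Re (f' v x)) * inverse (2 * complex_of_real (sqrt
        (Re (f x)))))"
      by (intro elementary.mult elementary.inverse elementary.sqrt elementary_const elementary_Re f'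
          sqrt.hyps)
        (use sqrt.hyps(2) in \<open>fastforce+\<close>)
  qed
next
  case (ln f)
  then obtain f' where f': "\<And>v. elementary U (f' v)" "\<And>x. x \<in> U \<Longrightarrow> linear (\<lambda>v. f' v x)"
      "\<And>x c v. x \<in> U \<Longrightarrow> curve_in U c x v \<Longrightarrow> ((\<lambda>t. f (c t)) has_vector_derivative f' v x) (at 0)"
    by metis
  show ?case
  proof (rule exI[of _ "\<lambda>v x. complex_of_real (Re (f' v x)) * inverse (complex_of_real (Re (f x)))"],
      intro conjI ballI allI impI)
    fix x assume "x \<in> U"
    then show "linear (\<lambda>v. complex_of_real (Re (f' v x)) * inverse (complex_of_real (Re (f x))))"
      using f'(2)[of x] by (auto simp: linear_iff scaleR_conv_of_real algebra_simps)
  next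
    fix x c v assume x: "x \<in> U" and c: "curve_in U c x v"
    have [simp]: "c 0 = x" using c by (simp add: curve_in_def)
    show "((\<lambda>t. complex_of_real (ln (Re (f (c t))))) has_vector_derivative
        complex_of_real (Re (f' v x)) * inverse (complex_of_real (Re (f x)))) (at 0)"
      using has_vector_derivative_ln_0[OF f'(3)[OF x c]] ln(2)[OF x] by simp
  next
    fix v show "elementary U (\<lambda>x. complex_of_real (Re (f' v x)) * inverse (complex_of_real (Re (f x))))"
      by (intro elementary.mult elementary.inverse elementary_Re f' ln.hyps)
        (use ln.hyps(2) in \<open>fastforce+\<close>)
  qed
next
  case (cong f g)
  then obtain f' where f': "\<And>v. elementary U (f' v)" "\<And>x. x \<in> U \<Longrightarrow> linear (\<lambda>v. f' v x)"
      "\<And>x c v. x \<in> U \<Longrightarrow> curve_in U c x v \<Longrightarrow> ((\<lambda>t. f (c t)) has_vector_derivative f' v x) (at 0)"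
    by metis
  show ?case
  proof (rule exI[of _ f'], intro conjI ballI allI impI f')
    fix x c v assume x: "x \<in> U" and c: "curve_in U c x v"
    have 1: "\<forall>\<^sub>F t in at 0. inverse t *\<^sub>R (f (c t) - f (c 0)) = inverse t *\<^sub>R (g (c t) - g (c 0))"
    proof -
      have "\<forall>\<^sub>F t in at 0. c t \<in> U" using c by (auto simp: curve_in_def)
      then show ?thesis by eventually_elim (use x c cong(2) in \<open>auto simp: curve_in_def\<close>)
    qed
    show "((\<lambda>t. g (c t)) has_vector_derivative f' v x) (at 0)"
      using f'(3)[OF x c] tendsto_cong[OF 1] unfolding has_vector_derivative_at_0_iff by simp
  qed
qed


text \<open>Only velocities \<open>v\<close> of curves in \<open>U\<close> determine \<open>eder U f v x\<close>; the choice made for the other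
  directions is linear in \<open>v\<close>, so derivatives can still be expanded over matrix units outside the
  tangent space.\<close>

definition eder :: "'v::{real_vector,t2_space} set \<Rightarrow> ('v \<Rightarrow> complex) \<Rightarrow> 'v \<Rightarrow> 'v \<Rightarrow> complex"
  where "eder U f = (SOME f'. (\<forall>v. elementary U (f' v)) \<and> (\<forall>x\<in>U. linear (\<lambda>v. f' v x)) \<and>
    (\<forall>x\<in>U. \<forall>c v. curve_in U c x v \<longrightarrow> ((\<lambda>t. f (c t)) has_vector_derivative f' v x) (at 0)))"

lemma
  assumes "elementary U f"
  shows elementary_eder: "elementary U (eder U f v)"
    and linear_eder: "x \<in> U \<Longrightarrow> linear (\<lambda>v. eder U f v x)"
    and eder_curve: "x \<in> U \<Longrightarrow> curve_in U c x v \<Longrightarrow>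
      ((\<lambda>t. f (c t)) has_vector_derivative eder U f v x) (at 0)"
  using someI_ex[OF elementary_derivative[OF assms]] unfolding eder_def[symmetric] by auto

section \<open>Rules for directional derivatives of elementary functions\<close>

lemma has_dirderiv_cong:
  assumes "line_open E U" "x \<in> U" "v \<in> E" "\<And>y. y \<in> U \<Longrightarrow> f y = g y"
  shows "has_dirderiv f v x d \<longleftrightarrow> has_dirderiv g v x d"
proof -
  have "\<forall>\<^sub>F t in at 0. x + t *\<^sub>R v \<in> U" using assms by (auto simp: line_open_def)
  then have "\<forall>\<^sub>F t in at 0. inverse t *\<^sub>R (f (x + t *\<^sub>R v) - f x) = inverse t *\<^sub>R (g (x + t *\<^sub>R v) - g x)"
    by eventually_elim (use assms in auto)
  then show ?thesis unfolding has_dirderiv_def by (rule tendsto_cong)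
qed

lemma dirderiv_cong:
  assumes "line_open E U" "x \<in> U" "v \<in> E" "\<And>y. y \<in> U \<Longrightarrow> f y = g y"
  shows "dirderiv f v x = dirderiv g v x"
proof -
  have "has_dirderiv f v x = has_dirderiv g v x"
    using assms by (intro ext has_dirderiv_cong[where E=E and U=U]) auto
  then show ?thesis unfolding dirderiv_def by simp
qed

lemma has_dirderiv_eder:
  assumes "line_open E U" "x \<in> U" "v \<in> E" "elementary U f"
  shows "has_dirderiv f v x (eder U f v x)"
  unfolding has_dirderiv_iff_vector
  by (rule eder_curve[OF assms(4,2) curve_in_line[OF assms(1-3)]])

lemma dirderiv_eder:
  assumes "line_open E U" "x \<in> U" "v \<in> E" "elementary U f"
  shows "dirderiv f v x = eder U f v x"
  by (rule dirderiv_eqI[OF has_dirderiv_eder[OF assms]])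

lemma eder_eqI:
  assumes "line_open E U" "x \<in> U" "v \<in> E" "elementary U f"
    "((\<lambda>t. f (x + t *\<^sub>R v)) has_vector_derivative d) (at 0)"
  shows "eder U f v x = d"
  using has_dirderiv_unique[OF has_dirderiv_eder[OF assms(1-4)]] assms(5)
  unfolding has_dirderiv_iff_vector by blast

lemma eder_line:
  assumes "line_open E U" "x \<in> U" "v \<in> E" "elementary U f"
  shows "((\<lambda>t. f (x + t *\<^sub>R v)) has_vector_derivative eder U f v x) (at 0)"
  using has_dirderiv_eder[OF assms] unfolding has_dirderiv_iff_vector .

lemma eder_cong:
  assumes "line_open E U" "x \<in> U" "v \<in> E" "elementary U f" "\<And>y. y \<in> U \<Longrightarrow> g y = f y"
  shows "eder U g v x = eder U f v x"
  using dirderiv_cong[OF assms(1-3), of g f] assms elementary.cong[OF assms(4), of g]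
  by (simp add: dirderiv_eder[of E])

lemma eder_locally_const:
  assumes "line_open E U" "x \<in> U" "v \<in> E" "\<And>x. x \<in> U \<Longrightarrow> \<exists>W. open W \<and> x \<in> W \<and> (\<forall>y\<in>W \<inter> U. f y = f x)"
  shows "eder U f v x = 0"
proof (rule eder_eqI[OF assms(1-3)])
  show "elementary U f" using assms(4) by (rule elementary.locally_const)
  obtain W where W: "open W" "x \<in> W" "\<forall>y\<in>W \<inter> U. f y = f x"
    using assms by blast
  have "\<forall>\<^sub>F t in at 0. x + t *\<^sub>R v \<in> W" "\<forall>\<^sub>F t in at 0. x + t *\<^sub>R v \<in> U"
    using assms(1-3) W(1,2) topological_tendstoD unfolding line_open_def by blast+
  then have "\<forall>\<^sub>F t in at 0. x + t *\<^sub>R v \<in> W \<inter> U"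
    by eventually_elim simp
  then have "\<forall>\<^sub>F t in at 0. inverse t *\<^sub>R (f (x + t *\<^sub>R v) - f (x + 0 *\<^sub>R v)) = 0"
    by eventually_elim (use W in auto)
  then show "((\<lambda>t. f (x + t *\<^sub>R v)) has_vector_derivative 0) (at 0)"
    unfolding has_vector_derivative_at_0_iff by (rule tendsto_eventually)
qed

lemma eder_const:
  assumes "line_open E U" "x \<in> U" "v \<in> E"
  shows "eder U (\<lambda>x. a) v x = 0"
  by (rule eder_locally_const[OF assms]) (auto intro: exI[of _ UNIV])

lemma eder_cont_linear:
  assumes "line_open E U" "x \<in> U" "v \<in> E" "linear l" "continuous_on UNIV l"
  shows "eder U l v x = l v"
  by (rule eder_eqI[OF assms(1-3) elementary.cont_linear[OF assms(4,5)]])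
    (auto simp: linear_add[OF assms(4)] linear_cmul[OF assms(4)] intro!: derivative_eq_intros)

lemma eder_add:
  assumes "line_open E U" "x \<in> U" "v \<in> E" "elementary U f" "elementary U g"
  shows "eder U (\<lambda>x. f x + g x) v x = eder U f v x + eder U g v x"
  using assms by (auto intro!: eder_eqI[OF assms(1-3)] elementary.add has_vector_derivative_add
      eder_line)

lemma eder_mult:
  assumes "line_open E U" "x \<in> U" "v \<in> E" "elementary U f" "elementary U g"
  shows "eder U (\<lambda>x. f x * g x) v x = f x * eder U g v x + eder U f v x * g x"
  using assms has_vector_derivative_mult[OF eder_line[OF assms(1-4)] eder_line[OF assms(1-3,5)]]
  by (auto intro!: eder_eqI[OF assms(1-3)] elementary.mult)

lemma eder_cmult:
  assumes "line_open E U" "x \<in> U" "v \<in> E" "elementary U f"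
  shows "eder U (\<lambda>x. a * f x) v x = a * eder U f v x"
  using eder_mult[OF assms(1-3) elementary_const assms(4), of a] eder_const[OF assms(1-3), of a] by simp

lemma eder_inverse:
  assumes "line_open E U" "x \<in> U" "v \<in> E" "elementary U f" "\<And>x. x \<in> U \<Longrightarrow> f x \<noteq> 0"
  shows "eder U (\<lambda>x. inverse (f x)) v x = - (inverse (f x) * eder U f v x * inverse (f x))"
  using assms has_vector_derivative_inverse_0[OF eder_line[OF assms(1-4)]]
  by (auto intro!: eder_eqI[OF assms(1-3)] elementary.inverse)

lemma eder_cnj:
  assumes "line_open E U" "x \<in> U" "v \<in> E" "elementary U f"
  shows "eder U (\<lambda>x. cnj (f x)) v x = cnj (eder U f v x)"
  using assms by (auto intro!: eder_eqI[OF assms(1-3)] elementary.cnj has_vector_derivative_cnj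
      eder_line)

lemma eder_Re:
  assumes "line_open E U" "x \<in> U" "v \<in> E" "elementary U f"
  shows "eder U (\<lambda>x. complex_of_real (Re (f x))) v x = complex_of_real (Re (eder U f v x))"
  using assms has_vector_derivative_Re_0[OF eder_line[OF assms(1-4)]]
  by (auto intro!: eder_eqI[OF assms(1-3)] elementary_Re has_vector_derivative_of_real)

lemma eder_sqrt:
  assumes "line_open E U" "x \<in> U" "v \<in> E" "elementary U f" "\<And>x. x \<in> U \<Longrightarrow> 0 < Re (f x)"
  shows "eder U (\<lambda>x. complex_of_real (sqrt (Re (f x)))) v x =
    complex_of_real (Re (eder U f v x)) * inverse (2 * complex_of_real (sqrt (Re (f x))))"
  using assms has_vector_derivative_sqrt_0[OF eder_line[OF assms(1-4)]]
  by (intro eder_eqI[OF assms(1-3)] elementary.sqrt) auto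

lemma eder_ln:
  assumes "line_open E U" "x \<in> U" "v \<in> E" "elementary U f" "\<And>x. x \<in> U \<Longrightarrow> 0 < Re (f x)"
  shows "eder U (\<lambda>x. complex_of_real (ln (Re (f x)))) v x =
    complex_of_real (Re (eder U f v x)) * inverse (complex_of_real (Re (f x)))"
  using assms has_vector_derivative_ln_0[OF eder_line[OF assms(1-4)]]
  by (intro eder_eqI[OF assms(1-3)] elementary.ln) auto

lemma eder_sum:
  assumes "line_open E U" "x \<in> U" "v \<in> E" "\<And>i. i \<in> I \<Longrightarrow> elementary U (f i)"
  shows "eder U (\<lambda>x. \<Sum>i\<in>I. f i x) v x = (\<Sum>i\<in>I. eder U (f i) v x)"
  using assms(4)
proof (induction I rule: infinite_finite_induct)
  case (insert i I)
  have "eder U (\<lambda>x. f i x + (\<Sum>i\<in>I. f i x)) v x = eder U (f i) v x + eder U (\<lambda>x. \<Sum>i\<in>I. f i x) v x"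
    using insert by (intro eder_add[OF assms(1-3)] elementary_sum) auto
  then show ?case using insert by simp
qed (simp_all add: eder_const[OF assms(1-3)])

text \<open>Schwarz's theorem by induction on the construction of \<open>f\<close>. For each rule
  the second derivative is written out explicitly; apart from second derivatives of the
  constituents, which the induction hypothesis covers, the formula is symmetric in \<open>u\<close>
  and \<open>v\<close>.\<close>

lemma eder_symmetric:
  assumes "elementary U f" "line_open E U" "x \<in> U" "u \<in> E" "v \<in> E"
  shows "eder U (eder U f u) v x = eder U (eder U f v) u x"
  using assms
proof (induction arbitrary: u v x)
  case (locally_const f)
  have "eder U (eder U f u) v x = 0" if "u \<in> E" "v \<in> E" for u v
  proof -
    have "eder U (eder U f u) v x = eder U (\<lambda>x. 0) v x"
      using locally_const that by (intro eder_cong[where E=E]) (auto intro: elementary_const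
          eder_locally_const)
    also have "\<dots> = 0" using locally_const that by (intro eder_locally_const[where E=E]) auto
    finally show ?thesis .
  qed
  then show ?case using locally_const by simp
next
  case (cont_linear l)
  have "eder U (eder U l u) v x = 0" if "u \<in> E" "v \<in> E" for u v
  proof -
    have "eder U (eder U l u) v x = eder U (\<lambda>x. l u) v x"
      using cont_linear that by (intro eder_cong[where E=E]) (auto intro: elementary_const
          eder_cont_linear)
    also have "\<dots> = 0" using cont_linear that by (intro eder_locally_const[where E=E]) auto
    finally show ?thesis .
  qed
  then show ?case using cont_linear by simp
next
  case (add f g)
  have "eder U (eder U (\<lambda>x. f x + g x) u) v x = eder U (eder U f u) v x + eder U (eder U g u) v x"
    if "u \<in> E" "v \<in> E" for u v
  proof -
    have "eder U (eder U (\<lambda>x. f x + g x) u) v x = eder U (\<lambda>x. eder U f u x + eder U g u x) v x"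
      using add that by (intro eder_cong[where E=E]) (auto intro: elementary_eder elementary.add
          eder_add)
    also have "\<dots> = eder U (eder U f u) v x + eder U (eder U g u) v x"
      using add that by (intro eder_add[where E=E]) (auto intro: elementary_eder)
    finally show ?thesis .
  qed
  then show ?case using add by simp
next
  case (mult f g)
  have "eder U (eder U (\<lambda>x. f x * g x) u) v x = f x * eder U (eder U g u) v x +
      eder U f v x * eder U g u x +
      (eder U f u x * eder U g v x + eder U (eder U f u) v x * g x)"
    if "u \<in> E" "v \<in> E" for u v
  proof -
    have "eder U (eder U (\<lambda>x. f x * g x) u) v x = eder U (\<lambda>x. f x * eder U g u x +
        eder U f u x * g x) v x"
      using mult that by (intro eder_cong[where E=E]) (auto intro: elementary_eder elementary.add
          elementary.mult eder_mult
        elementary.add[OF elementary.mult[OF mult.hyps(1) elementary_eder[OF mult.hyps(2)]]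
          elementary.mult[OF elementary_eder[OF mult.hyps(1)] mult.hyps(2)]])
    also have "\<dots> = eder U (\<lambda>x. f x * eder U g u x) v x + eder U (\<lambda>x. eder U f u x * g x) v x"
      using mult that by (intro eder_add[where E=E]) (auto intro: elementary_eder elementary.mult)
    also have "\<dots> = f x * eder U (eder U g u) v x + eder U f v x * eder U g u x +
      (eder U f u x * eder U g v x + eder U (eder U f u) v x * g x)"
      using mult that by (subst (1 2) eder_mult[where E=E]) (auto intro: elementary_eder)
    finally show ?thesis .
  qed
  then show ?case using mult by (simp add: algebra_simps)
next
  case (inverse f)
  have "eder U (eder U (\<lambda>x. inverse (f x)) u) v x =
     - inverse (f x) * (eder U (eder U f u) v x * inverse (f x) -
        2 * inverse (f x) * inverse (f x) * eder U f u x * eder U f v x)"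
    if "u \<in> E" "v \<in> E" for u v
  proof -
    let ?h = "\<lambda>x. inverse (f x)"
    have h: "elementary U ?h" using inverse by (intro elementary.inverse) auto
    have "eder U (eder U ?h u) v x = eder U (\<lambda>x. (-1 * eder U f u x) * (?h x * ?h x)) v x"
    proof (rule eder_cong[OF inverse(4,5) that(2)])
      show "elementary U (\<lambda>x. (-1 * eder U f u x) * (?h x * ?h x))"
        by (intro elementary.mult elementary_const elementary_eder inverse.hyps(1) h)
    qed (use eder_inverse[OF inverse(4) _ that(1) inverse.hyps] in simp)
    also have "\<dots> = (-1 * eder U f u x) * eder U (\<lambda>x. ?h x * ?h x) v x +
        eder U (\<lambda>x. -1 * eder U f u x) v x * (?h x * ?h x)"
      by (rule eder_mult[OF inverse(4,5) that(2)])
        (intro elementary.mult elementary_const elementary_eder inverse.hyps(1) h)+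
    also have "eder U (\<lambda>x. ?h x * ?h x) v x = ?h x * eder U ?h v x + eder U ?h v x * ?h x"
      by (rule eder_mult[OF inverse(4,5) that(2) h h])
    also have "eder U (\<lambda>x. -1 * eder U f u x) v x = -1 * eder U (eder U f u) v x"
      by (rule eder_cmult[OF inverse(4,5) that(2) elementary_eder[OF inverse.hyps(1)]])
    also have "eder U ?h v x = - (?h x * eder U f v x * ?h x)"
      using inverse that by (subst eder_inverse[where E=E]) auto
    finally show ?thesis by (simp add: algebra_simps)
  qed
  from this[OF inverse(6,7)] this[OF inverse(7,6)] inverse.IH[OF inverse(4-7)]
  show ?case by (simp only: mult_ac)
next
  case (cnj f)
  have "eder U (eder U (\<lambda>x. cnj (f x)) u) v x = cnj (eder U (eder U f u) v x)"
    if "u \<in> E" "v \<in> E" for u v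
  proof -
    have "eder U (eder U (\<lambda>x. cnj (f x)) u) v x = eder U (\<lambda>x. cnj (eder U f u x)) v x"
      using cnj that by (intro eder_cong[where E=E]) (auto intro: elementary_eder elementary.cnj
          eder_cnj)
    also have "\<dots> = cnj (eder U (eder U f u) v x)"
      using cnj that by (intro eder_cnj[where E=E]) (auto intro: elementary_eder)
    finally show ?thesis .
  qed
  then show ?case using cnj by simp
next
  case (sqrt f)
  let ?s = "\<lambda>x. complex_of_real (sqrt (Re (f x)))"
  have pos: "?s x \<noteq> 0" if "x \<in> U" for x using sqrt(2)[OF that] by simp
  have s: "elementary U ?s" using sqrt by (intro elementary.sqrt) auto
  have "eder U (eder U ?s u) v x = complex_of_real (Re (eder U (eder U f u) v x)) * (inverse 2 *
      inverse (?s x))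
     - complex_of_real (Re (eder U f u x)) * complex_of_real (Re (eder U f v x)) *
        (inverse 2 * inverse 2 * inverse (?s x) * inverse (?s x) * inverse (?s x))"
    if "u \<in> E" "v \<in> E" for u v
  proof -
    let ?R = "\<lambda>x. complex_of_real (Re (eder U f u x))"
    have R: "elementary U ?R" by (rule elementary_Re[OF elementary_eder[OF sqrt.hyps(1)]])
    have R': "elementary U (\<lambda>x. inverse 2 * ?R x)" by (rule elementary.mult[OF elementary_const R])
    have S: "elementary U (\<lambda>x. inverse (?s x))" by (rule elementary.inverse[OF s pos])
    have "eder U (eder U ?s u) v x = eder U (\<lambda>x. (inverse 2 * ?R x) * inverse (?s x)) v x"
      by (rule eder_cong[OF sqrt(4,5) that(2)])
        (rule elementary.mult[OF R' S], use eder_sqrt[OF sqrt(4) _ that(1) sqrt.hyps] in simp)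
    also have "\<dots> = (inverse 2 * ?R x) * eder U (\<lambda>x. inverse (?s x)) v x +
        eder U (\<lambda>x. inverse 2 * ?R x) v x * inverse (?s x)"
      by (rule eder_mult[OF sqrt(4,5) that(2) R' S])
    also have "eder U (\<lambda>x. inverse (?s x)) v x = - (inverse (?s x) * eder U ?s v x * inverse (?s x))"
      by (rule eder_inverse[OF sqrt(4,5) that(2) s pos])
    also have "eder U (\<lambda>x. inverse 2 * ?R x) v x = inverse 2 * eder U ?R v x"
      by (rule eder_cmult[OF sqrt(4,5) that(2) R])
    also have "eder U ?R v x = complex_of_real (Re (eder U (eder U f u) v x))"
      by (rule eder_Re[OF sqrt(4,5) that(2) elementary_eder[OF sqrt.hyps(1)]])
    also have "eder U ?s v x = complex_of_real (Re (eder U f v x)) * (inverse 2 * inverse (?s x))"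
      using eder_sqrt[OF sqrt(4,5) that(2) sqrt.hyps] by simp
    finally show ?thesis by (simp add: algebra_simps)
  qed
  from this[OF sqrt(6,7)] this[OF sqrt(7,6)] sqrt.IH[OF sqrt(4-7)]
  show ?case by (simp only: mult_ac)
next
  case (ln f)
  let ?r = "\<lambda>x. complex_of_real (Re (f x))"
  have pos: "?r x \<noteq> 0" if "x \<in> U" for x using ln(2)[OF that] by simp
  have r: "elementary U ?r" using ln by (intro elementary_Re) auto
  have "eder U (eder U (\<lambda>x. complex_of_real (ln (Re (f x)))) u) v x =
      complex_of_real (Re (eder U (eder U f u) v x)) * inverse (?r x)
     - complex_of_real (Re (eder U f u x)) * complex_of_real (Re (eder U f v x)) *
        (inverse (?r x) * inverse (?r x))"
    if "u \<in> E" "v \<in> E" for u v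
  proof -
    let ?R = "\<lambda>x. complex_of_real (Re (eder U f u x))"
    have R: "elementary U ?R" "elementary U (\<lambda>x. inverse (?r x))"
      using ln.hyps(1) r pos by (auto intro!: elementary.inverse elementary_Re elementary_eder)
    have "eder U (eder U (\<lambda>x. complex_of_real (ln (Re (f x)))) u) v x =
        eder U (\<lambda>x. ?R x * inverse (?r x)) v x"
      by (rule eder_cong[OF ln(4,5) that(2)])
        (rule elementary.mult[OF R], use eder_ln[OF ln(4) _ that(1) ln.hyps] in simp)
    also have "\<dots> = ?R x * eder U (\<lambda>x. inverse (?r x)) v x + eder U ?R v x * inverse (?r x)"
      by (rule eder_mult[OF ln(4,5) that(2) R])
    also have "eder U (\<lambda>x. inverse (?r x)) v x = - (inverse (?r x) * eder U ?r v x * inverse (?r x))"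
      by (rule eder_inverse[OF ln(4,5) that(2) r pos])
    also have "eder U ?R v x = complex_of_real (Re (eder U (eder U f u) v x))"
      by (rule eder_Re[OF ln(4,5) that(2) elementary_eder[OF ln.hyps(1)]])
    also have "eder U ?r v x = complex_of_real (Re (eder U f v x))"
      by (rule eder_Re[OF ln(4,5) that(2) ln.hyps(1)])
    finally show ?thesis by (simp add: algebra_simps)
  qed
  from this[OF ln(6,7)] this[OF ln(7,6)] ln.IH[OF ln(4-7)]
  show ?case by (simp only: mult_ac)
next
  case (cong f g)
  have "eder U (eder U g u) v x = eder U (eder U f u) v x" if "u \<in> E" "v \<in> E" for u v
    using cong that by (intro eder_cong[where E=E]) (auto intro: elementary_eder eder_cong)
  then show ?case using cong by simp
qed

section \<open>Matrix-valued and real-valued maps\<close>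

lemma tendsto_fun_iff:
  fixes f :: "'a \<Rightarrow> 'i \<Rightarrow> 'b::topological_space"
  shows "(f \<longlongrightarrow> l) F \<longleftrightarrow> (\<forall>i. ((\<lambda>x. f x i) \<longlongrightarrow> l i) F)"
  using limitin_componentwise[of "\<lambda>_. euclidean :: 'b topology" UNIV f l F]
  by (simp add: euclidean_product_topology)

lemma tendsto_matrix_iff:
  fixes f :: "'a \<Rightarrow> 'i \<Rightarrow> 'j \<Rightarrow> 'b::topological_space"
  shows "(f \<longlongrightarrow> l) F \<longleftrightarrow> (\<forall>i j. ((\<lambda>x. f x i j) \<longlongrightarrow> l i j) F)"
  by (simp add: tendsto_fun_iff)

lemma has_dirderiv_matrix_iff:
  fixes f :: "'v::{real_vector,t2_space} \<Rightarrow> nat \<Rightarrow> nat \<Rightarrow> complex"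
  shows "has_dirderiv f v x d \<longleftrightarrow> (\<forall>i j. has_dirderiv (\<lambda>x. f x i j) v x (d i j))"
  unfolding has_dirderiv_def tendsto_matrix_iff by (simp add: scaleR_fun_def)

lemma has_dirderiv_matrix:
  fixes f :: "'v::{real_vector,t2_space} \<Rightarrow> nat \<Rightarrow> nat \<Rightarrow> complex"
  assumes "line_open E U" "x \<in> U" "v \<in> E" "\<And>i j. elementary U (\<lambda>x. f x i j)"
  shows "has_dirderiv f v x (\<lambda>i j. eder U (\<lambda>x. f x i j) v x)"
  unfolding has_dirderiv_matrix_iff using has_dirderiv_eder[OF assms] by blast

lemma dirderiv_matrix:
  fixes f :: "'v::{real_vector,t2_space} \<Rightarrow> nat \<Rightarrow> nat \<Rightarrow> complex"
  assumes "line_open E U" "x \<in> U" "v \<in> E" "\<And>i j. elementary U (\<lambda>x. f x i j)"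
  shows "dirderiv f v x = (\<lambda>i j. eder U (\<lambda>x. f x i j) v x)"
  by (rule dirderiv_eqI[OF has_dirderiv_matrix[OF assms]])

text \<open>The order \<open>k\<close> is an induction variable with \<open>f\<close> arbitrary:
  differentiating leaves the entries elementary, so the hypothesis reproduces itself.\<close>

lemma smooth_on_matrix:
  fixes f :: "'v::{real_vector,t2_space} \<Rightarrow> nat \<Rightarrow> nat \<Rightarrow> complex"
  assumes "line_open E U" "\<And>i j. elementary U (\<lambda>x. f x i j)"
  shows "smooth_on E U f"
  unfolding smooth_on_def
proof
  fix k
  have cont: "continuous_on U f" if "\<And>i j. elementary U (\<lambda>x. f x i j)"
    for f :: "'v \<Rightarrow> nat \<Rightarrow> nat \<Rightarrow> complex"
    using that elementary_continuous by (intro continuous_on_coordinatewise_then_product) auto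
  show "Ck_on k E U f" using assms(2)
  proof (induction k arbitrary: f)
    case (Suc k)
    have "elementary U (\<lambda>x. dirderiv f v x i j)" if "v \<in> E" for v i j
      by (rule elementary.cong[OF elementary_eder[OF Suc.prems]])
        (simp add: dirderiv_matrix[OF assms(1) _ that Suc.prems])
    then have "\<forall>v\<in>E. Ck_on k E U (dirderiv f v)" by (intro ballI Suc.IH)
    moreover have "continuous_on U f" by (rule cont) (rule Suc.prems)
    moreover have "\<exists>d. has_dirderiv f v x d" if "v \<in> E" "x \<in> U" for v x
      by (rule exI, rule has_dirderiv_matrix[OF assms(1) that(2,1) Suc.prems])
    ultimately show ?case by simp
  qed (use cont in auto)
qed

text \<open>Elementary functions are complex-valued, whereas metric coefficients are real. The
  imaginary part of the difference quotients is constantly 0, so nothing is lost in passing to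
  complex values.\<close>

lemma has_dirderiv_of_real_iff:
  fixes f :: "'v::{real_vector,t2_space} \<Rightarrow> real"
  shows "has_dirderiv (\<lambda>x. complex_of_real (f x)) v x d \<longleftrightarrow> d \<in> \<real> \<and> has_dirderiv f v x (Re d)"
proof
  assume d: "has_dirderiv (\<lambda>x. complex_of_real (f x)) v x d"
  have "has_dirderiv f v x (Re d)"
    using tendsto_Re[OF d[unfolded has_dirderiv_def]] by (simp add: has_dirderiv_def)
  moreover have "((\<lambda>t. 0) \<longlongrightarrow> Im d) (at (0::real))"
    using tendsto_Im[OF d[unfolded has_dirderiv_def]] by simp
  then have "Im d = 0" by (simp add: tendsto_const_iff)
  ultimately show "d \<in> \<real> \<and> has_dirderiv f v x (Re d)" by (simp add: complex_is_Real_iff)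
next
  assume "d \<in> \<real> \<and> has_dirderiv f v x (Re d)"
  then show "has_dirderiv (\<lambda>x. complex_of_real (f x)) v x d"
    using tendsto_of_real[of "\<lambda>t. inverse t *\<^sub>R (f (x + t *\<^sub>R v) - f x)" "Re d" "at 0", where 'a=complex]
    by (simp add: has_dirderiv_def scaleR_conv_of_real of_real_Re)
qed

lemma dirderiv_real:
  fixes f :: "'v::{real_vector,t2_space} \<Rightarrow> real"
  assumes "line_open E U" "x \<in> U" "v \<in> E" "elementary U (\<lambda>x. complex_of_real (f x))"
  shows "has_dirderiv f v x (dirderiv f v x)"
    "complex_of_real (dirderiv f v x) = eder U (\<lambda>x. complex_of_real (f x)) v x"
proof -
  have *: "eder U (\<lambda>x. complex_of_real (f x)) v x \<in> \<real>"
      "has_dirderiv f v x (Re (eder U (\<lambda>x. complex_of_real (f x)) v x))"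
    using has_dirderiv_eder[OF assms] by (auto simp: has_dirderiv_of_real_iff)
  then show "has_dirderiv f v x (dirderiv f v x)"
    "complex_of_real (dirderiv f v x) = eder U (\<lambda>x. complex_of_real (f x)) v x"
    by (auto simp: dirderiv_eqI of_real_Re)
qed

lemma smooth_on_real:
  fixes f :: "'v::{real_vector,t2_space} \<Rightarrow> real"
  assumes "line_open E U" "elementary U (\<lambda>x. complex_of_real (f x))"
  shows "smooth_on E U f"
  unfolding smooth_on_def
proof
  fix k
  have cont: "continuous_on U f" if "elementary U (\<lambda>x. complex_of_real (f x))" for f :: "'v \<Rightarrow> real"
    using continuous_on_Re[OF elementary_continuous[OF that]] by simp
  show "Ck_on k E U f" using assms(2)
  proof (induction k arbitrary: f)
    case (Suc k)
    have "elementary U (\<lambda>x. complex_of_real (dirderiv f v x))" if "v \<in> E" for v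
      by (rule elementary.cong[OF elementary_eder[OF Suc.prems]])
        (simp add: dirderiv_real[OF assms(1) _ that Suc.prems])
    then have "\<forall>v\<in>E. Ck_on k E U (dirderiv f v)" by (intro ballI Suc.IH)
    moreover have "continuous_on U f" by (rule cont) (rule Suc.prems)
    moreover have "\<exists>d. has_dirderiv f v x d" if "v \<in> E" "x \<in> U" for v x
      by (rule exI, rule dirderiv_real(1)[OF assms(1) that(2,1) Suc.prems])
    ultimately show ?case by simp
  qed (use cont in auto)
qed

text \<open>In the product topology both limits required of a curve may be checked
  entrywise.\<close>

lemma curve_in_matrix:
  fixes c :: "real \<Rightarrow> nat \<Rightarrow> nat \<Rightarrow> complex"
  assumes "c 0 = x" "\<forall>\<^sub>F t in at 0. c t \<in> U"
    "\<And>i j. ((\<lambda>t. c t i j) has_vector_derivative d i j) (at 0)"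
  shows "curve_in U c x d"
proof -
  have "((\<lambda>t. c t i j) \<longlongrightarrow> x i j) (at 0)" for i j
    using has_vector_derivative_continuous[OF assms(3)[of i j]] assms(1)
    by (simp add: continuous_within)
  moreover have "((\<lambda>t. inverse t *\<^sub>R (c t i j - x i j)) \<longlongrightarrow> d i j) (at 0)" for i j
    using assms(3)[of i j] assms(1) by (auto simp: has_vector_derivative_at_0_iff)
  ultimately show ?thesis
    unfolding curve_in_def using assms(1,2) by (simp add: tendsto_matrix_iff scaleR_fun_def)
qed

section \<open>Scalars and signs\<close>

text \<open>\<open>F\<close> need not be closed under conjugation, but Hermitian matrices over \<open>F\<close> and their
  triangular factors have their entries in \<open>conj_core F\<close>.\<close>

definition conj_field :: "complex set \<Rightarrow> bool"
  where "conj_field K \<longleftrightarrow> is_subfield K \<and> (\<forall>z\<in>K. cnj z \<in> K) \<and>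
    (\<forall>x::real. 0 < x \<and> complex_of_real x \<in> K \<longrightarrow> complex_of_real (sqrt x) \<in> K)"

definition conj_core :: "complex set \<Rightarrow> complex set"
  where "conj_core F = {z \<in> F. cnj z \<in> F}"

lemma conj_field_conj_core:
  assumes "is_subfield F"
    and "\<forall>x::real. 0 < x \<and> complex_of_real x \<in> F \<longrightarrow> complex_of_real (sqrt x) \<in> F"
  shows "conj_field (conj_core F)"
  using assms unfolding conj_field_def conj_core_def is_subfield_def by auto

lemma conj_field_UNIV: "conj_field UNIV"
  by (auto simp: conj_field_def is_subfield_def)

lemma conj_core_eq: "conj_field F \<Longrightarrow> conj_core F = F"
  by (auto simp: conj_field_def conj_core_def)

context
  fixes K assumes K: "conj_field K"
begin

lemma field_0: "0 \<in> K" and field_1: "1 \<in> K" and field_diff: "x \<in> K \<Longrightarrow> y \<in> K \<Longrightarrow> x - y \<in> K"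
  and field_mult: "x \<in> K \<Longrightarrow> y \<in> K \<Longrightarrow> x * y \<in> K" and field_inverse: "x \<in> K \<Longrightarrow> inverse x \<in> K"
  and field_cnj: "x \<in> K \<Longrightarrow> cnj x \<in> K"
  and field_sqrt: "0 < r \<Longrightarrow> complex_of_real r \<in> K \<Longrightarrow> complex_of_real (sqrt r) \<in> K"
  using K by (auto simp: conj_field_def is_subfield_def)

lemma field_uminus: "x \<in> K \<Longrightarrow> - x \<in> K"
  using field_diff[OF field_0] by fastforce

lemma field_add: "x \<in> K \<Longrightarrow> y \<in> K \<Longrightarrow> x + y \<in> K"
  using field_diff[OF _ field_uminus, of x y] by simp

lemma field_divide: "x \<in> K \<Longrightarrow> y \<in> K \<Longrightarrow> x / y \<in> K"
  by (simp add: divide_inverse field_mult field_inverse)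

lemma field_sum: "(\<And>i. i \<in> I \<Longrightarrow> f i \<in> K) \<Longrightarrow> sum f I \<in> K"
  by (induction I rule: infinite_finite_induct) (auto intro: field_add field_0)

lemmas field_closed = field_0 field_1 field_diff field_mult field_inverse field_cnj field_uminus
  field_add field_divide field_sum

end

lemma idx_downward: "i \<in> idx s \<Longrightarrow> k \<le> i \<Longrightarrow> k \<in> idx s"
  by (cases s) auto

lemma signs_eq: "signs s = (\<Pi>\<^sub>E i\<in>idx s. {1, -1})"
  by (simp add: sign_group_def S2_def)

lemma signs_cases: "\<epsilon> \<in> signs s \<Longrightarrow> i \<in> idx s \<Longrightarrow> \<epsilon> i = 1 \<or> \<epsilon> i = -1"
  unfolding signs_eq by (auto dest: PiE_mem)

lemma sign_mult: "\<epsilon> \<otimes>\<^bsub>sign_group s\<^esub> \<epsilon>' = (\<lambda>i\<in>idx s. \<epsilon> i * \<epsilon>' i)"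
  by (simp add: sign_group_def S2_def)

lemma sign_one: "\<one>\<^bsub>sign_group s\<^esub> = (\<lambda>i\<in>idx s. 1)"
  by (simp add: sign_group_def S2_def)

lemma sign_one_signs: "\<one>\<^bsub>sign_group s\<^esub> \<in> signs s"
  unfolding sign_one signs_eq by auto

lemma sign_square: "\<epsilon> \<in> signs s \<Longrightarrow> \<epsilon> \<otimes>\<^bsub>sign_group s\<^esub> \<epsilon> = \<one>\<^bsub>sign_group s\<^esub>"
  unfolding sign_mult sign_one by (auto simp: fun_eq_iff dest: signs_cases)

lemma comm_group_sign: "comm_group (sign_group s)"
proof -
  have S2: "group S2"
    by (rule groupI) (auto simp: S2_def)
  then have g: "group (sign_group s)"
    unfolding sign_group_def by (intro product_group) auto
  show ?thesis
    by (rule group.group_comm_groupI[OF g]) (auto simp: sign_mult mult.commute)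
qed

text \<open>The sign of the quotient of two consecutive leading minors, with the empty minor counted
  as 1. Unlike \<open>sign_diag\<close> it is real-valued and carries no index set.\<close>

definition pivot_sign :: "(nat \<Rightarrow> real) \<Rightarrow> nat \<Rightarrow> real"
  where "pivot_sign \<epsilon> k = (if k = 0 then \<epsilon> 0 else \<epsilon> (k - 1) * \<epsilon> k)"

lemma sign_diag_diag: "k \<in> idx s \<Longrightarrow> sign_diag s \<epsilon> k k = complex_of_real (pivot_sign \<epsilon> k)"
  by (simp add: sign_diag_def pivot_sign_def)

lemma sign_diag_off: "i \<noteq> j \<Longrightarrow> sign_diag s \<epsilon> i j = 0"
  by (simp add: sign_diag_def)

lemma sign_diag_outside: "i \<notin> idx s \<or> j \<notin> idx s \<Longrightarrow> sign_diag s \<epsilon> i j = 0"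
  by (auto simp: sign_diag_def)

lemma pivot_sign_cases:
  "\<epsilon> \<in> signs s \<Longrightarrow> k \<in> idx s \<Longrightarrow> pivot_sign \<epsilon> k = 1 \<or> pivot_sign \<epsilon> k = -1"
  using signs_cases[of \<epsilon> s k] signs_cases[of \<epsilon> s "k - 1"] idx_downward[of k s "k - 1"]
  by (auto simp: pivot_sign_def)

lemma cnj_sign_diag: "cnj (sign_diag s \<epsilon> i j) = sign_diag s \<epsilon> i j"
  by (simp add: sign_diag_def)

text \<open>Cancelling the sign already known recovers the next one, so the pivot signs determine
  the sequence inside the index set; outside it both sequences are \<open>undefined\<close>.\<close>

lemma signs_eqI:
  assumes "\<epsilon> \<in> signs s" "\<epsilon>' \<in> signs s" "\<And>k. k \<in> idx s \<Longrightarrow> pivot_sign \<epsilon> k = pivot_sign \<epsilon>' k"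
  shows "\<epsilon> = \<epsilon>'"
proof
  fix i
  have "\<epsilon> i = \<epsilon>' i" if "i \<in> idx s" for i
    using that
  proof (induction i)
    case 0
    then show ?case using assms(3)[of 0] by (simp add: pivot_sign_def)
  next
    case (Suc i)
    then have i: "i \<in> idx s" using idx_downward by fastforce
    have "\<epsilon> i * \<epsilon> (Suc i) = \<epsilon>' i * \<epsilon>' (Suc i)" using assms(3)[OF Suc.prems]
        by (simp add: pivot_sign_def)
    moreover have "\<epsilon> i \<noteq> 0" using signs_cases[OF assms(1) i] by auto
    ultimately show ?case using Suc.IH[OF i] by simp
  qed
  then show "\<epsilon> i = \<epsilon>' i"
    using assms(1,2) unfolding signs_eq by (cases "i \<in> idx s") (simp, metis PiE_arb)
qed

lemma pivot_sign_one: "k \<in> idx s \<Longrightarrow> pivot_sign (\<one>\<^bsub>sign_group s\<^esub>) k = 1"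
  using idx_downward[of k s "k - 1"] idx_downward[of k s 0] by (auto simp: pivot_sign_def sign_one)

lemma sign_diag_one: "sign_diag s (\<one>\<^bsub>sign_group s\<^esub>) = idmat s"
  using pivot_sign_one[of _ s]
  by (auto simp: fun_eq_iff idmat_def sign_diag_diag sign_diag_off sign_diag_outside)

section \<open>Products with sign matrices\<close>

lemma mmul_finite:
  assumes "finite S" "\<And>k. k \<notin> S \<Longrightarrow> A i k * B k j = 0"
  shows "(A \<star> B) i j = (\<Sum>k\<in>S. A i k * B k j)"
proof -
  have "(A \<star> B) i j = (\<Sum>\<^sub>\<infinity>k\<in>S. A i k * B k j)"
    unfolding mmul_def by (rule infsum_cong_neutral) (use assms(2) in auto)
  then show ?thesis by (simp add: assms(1))
qed

lemma mmul_sign_diag: "(A \<star> sign_diag s \<epsilon>) i j = A i j * sign_diag s \<epsilon> j j"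
  by (subst mmul_finite[of "{j}"]) (auto simp: sign_diag_off)

text \<open>Pivot signs are products of entries of the sequence, hence multiplicative. This is what
  turns the product of two sign matrices inside \<open>\<boxdot>\<close> into the group law of the
  sign sequences.\<close>

lemma sign_diag_mult:
  assumes "\<epsilon> \<in> signs s" "\<epsilon>' \<in> signs s"
  shows "sign_diag s \<epsilon> \<star> sign_diag s \<epsilon>' = sign_diag s (\<epsilon> \<otimes>\<^bsub>sign_group s\<^esub> \<epsilon>')"
proof (intro ext)
  fix i j
  show "(sign_diag s \<epsilon> \<star> sign_diag s \<epsilon>') i j = sign_diag s (\<epsilon> \<otimes>\<^bsub>sign_group s\<^esub> \<epsilon>') i j"
    unfolding mmul_sign_diag using idx_downward[of i s "i - 1"] idx_downward[of i s 0]
    by (auto simp: sign_diag_def sign_mult)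
qed

section \<open>The group of lower triangular matrices\<close>

lemma LT_lower: "L \<in> LT s F \<Longrightarrow> L \<in> lower_tri s F"
  by (cases s) auto

lemma LT_mono: "F \<subseteq> F' \<Longrightarrow> L \<in> LT s F \<Longrightarrow> L \<in> LT s F'"
  by (cases s) (auto simp: lower_tri_def)

lemma LT_subfield: "L \<in> LT s F \<Longrightarrow> (\<And>i j. L i j \<in> F') \<Longrightarrow> L \<in> LT s F'"
  by (cases s) (auto simp: lower_tri_def)

lemma LT_UNIV: "L \<in> LT s F \<Longrightarrow> L \<in> LT s UNIV"
  by (rule LT_mono[of F]) simp

lemma
  assumes "L \<in> LT s F"
  shows LT_field: "L i j \<in> F"
    and LT_upper: "i < j \<Longrightarrow> L i j = 0"
    and LT_outside: "i \<notin> idx s \<or> j \<notin> idx s \<Longrightarrow> L i j = 0"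
    and LT_diag: "j \<in> idx s \<Longrightarrow> L j j = complex_of_real (Re (L j j)) \<and> 0 < Re (L j j)"
  using LT_lower[OF assms] by (auto simp: lower_tri_def of_real_Re)

lemma LT_diag_nonzero: "L \<in> LT s F \<Longrightarrow> j \<in> idx s \<Longrightarrow> L j j \<noteq> 0"
  using LT_diag[of L s F j] by auto

lemma LT_diag_real: "L \<in> LT s F \<Longrightarrow> L j j = complex_of_real (Re (L j j))"
  using LT_diag[of L s F j] LT_outside[of L s F j j] by (cases "j \<in> idx s") auto

text \<open>Logarithmic coordinates. Composed with the triangular factor of a matrix, this is the
  chart \<open>\<phi>\<close>.\<close>

definition logL :: "cmat \<Rightarrow> cmat"
  where "logL L = (\<lambda>i j. if j < i then L i j else if i =
      j then complex_of_real (ln (Re (L i i))) else 0)"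

definition tri_idx :: "shape \<Rightarrow> (nat \<times> nat) set"
  where "tri_idx s = {(i, j). i \<in> idx s \<and> j \<le> i}"

lemma tri_idx_split:
  "tri_idx s = {(i, j). i \<in> idx s \<and> j < i} \<union> (\<lambda>j. (j, j)) ` idx s"
  "{(i, j). i \<in> idx s \<and> j < i} \<inter> (\<lambda>j. (j, j)) ` idx s = {}"
  by (auto simp: tri_idx_def)

lemma finite_tri_idx: "finite (tri_idx (Fin n))"
  by (rule finite_subset[of _ "{..<n} \<times> {..<n}"]) (auto simp: tri_idx_def)

text \<open>This single \<ell>\<open>\<^sup>2\<close> statement absorbs the difference between the
  three shapes; the metric part below no longer distinguishes them.\<close>

lemma summable_logL:
  assumes "L \<in> LT s F"
  shows "(\<lambda>(i, j). (cmod (logL L i j))\<^sup>2) summable_on tri_idx s"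
proof -
  have 1: "(\<lambda>(i, j). (cmod (logL L i j))\<^sup>2) summable_on {(i, j). i \<in> idx s \<and> j < i}"
  proof (cases s)
    case (Fin n)
    then show ?thesis using finite_subset[OF _ finite_tri_idx[of n]] tri_idx_split(1)[of s]
      by (intro summable_on_finite) auto
  next
    case Finitary
    have "(\<lambda>(i, j). (cmod (logL L i j))\<^sup>2) summable_on {(i, j). j < i \<and> L i j \<noteq> 0}"
      using assms Finitary by (intro summable_on_finite) auto
    then show ?thesis
      by (rule summable_on_cong_neutral[THEN iffD1, rotated -1]) (auto simp: Finitary logL_def)
  next
    case Hilbert
    have "(\<lambda>(i, j). (cmod (L i j))\<^sup>2) summable_on {(i, j). j < i}" using assms Hilbert by simp
    then have "(\<lambda>(i, j). (cmod (logL L i j))\<^sup>2) summable_on {(i, j). j < i}"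
      by (rule summable_on_cong[THEN iffD1, rotated]) (auto simp: logL_def)
    then show ?thesis by (simp add: Hilbert)
  qed
  have "(\<lambda>j. (ln (Re (L j j)))\<^sup>2) summable_on idx s"
  proof (cases s)
    case Finitary
    have "(\<lambda>j. (ln (Re (L j j)))\<^sup>2) summable_on {j. L j j \<noteq> 1}"
      using assms Finitary by (intro summable_on_finite) auto
    then show ?thesis
      by (rule summable_on_cong_neutral[THEN iffD1, rotated -1]) (auto simp: Finitary)
  qed (use assms in \<open>auto intro: summable_on_finite\<close>)
  then have 2: "(\<lambda>(i, j). (cmod (logL L i j))\<^sup>2) summable_on ((\<lambda>j. (j, j)) ` idx s)"
    by (subst summable_on_reindex) (auto simp: inj_on_def o_def logL_def)
  show ?thesis unfolding tri_idx_split(1) by (rule summable_on_Un_disjoint[OF 1 2 tri_idx_split(2)])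
qed

lemma logL_inj:
  assumes "L \<in> LT s F" "L' \<in> LT s F" "logL L = logL L'"
  shows "L = L'"
proof (intro ext)
  fix i j
  have *: "logL L i j = logL L' i j" using assms(3) by simp
  consider "j < i" | "i < j" | "i = j" "j \<in> idx s" | "i = j" "j \<notin> idx s" by force
  then show "L i j = L' i j"
  proof cases
    case 3
    then have "ln (Re (L j j)) = ln (Re (L' j j))" using * by (simp add: logL_def)
    then have "Re (L j j) = Re (L' j j)"
      using LT_diag[OF assms(1) 3(2)] LT_diag[OF assms(2) 3(2)] by simp
    then show ?thesis using 3 LT_diag_real[OF assms(1)] LT_diag_real[OF assms(2)] by metis
  qed (use * LT_upper[OF assms(1)] LT_upper[OF assms(2)] LT_outside[OF assms(1)] LT_outside[OF assms(2)]
      in \<open>auto simp: logL_def\<close>)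
qed

lemma logL_mult:
  assumes "L \<in> LT s F" "L' \<in> LT s F"
  shows "logL (LT_mult L L') i j = logL L i j + logL L' i j"
proof (cases "i = j")
  case True
  show ?thesis
  proof (cases "i \<in> idx s")
    case i: True
    obtain a b where "L i i = complex_of_real a" "0 < a" "L' i i = complex_of_real b" "0 < b"
      using LT_diag[OF assms(1) i] LT_diag[OF assms(2) i] by blast
    then show ?thesis using True by (simp add: logL_def LT_mult_def ln_mult_pos)
  next
    case False
    \<comment> \<open>Outside the index set the diagonal entries are 0, and the default value
      \<open>ln 0 = 0\<close> keeps the identity true.\<close>
    then show ?thesis using True LT_outside[OF assms(1)] LT_outside[OF assms(2)]
      by (simp add: logL_def LT_mult_def)
  qed
qed (auto simp: logL_def LT_mult_def)

lemma lower_tri_mult: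
  assumes K: "conj_field K" and "L \<in> lower_tri s K" "L' \<in> lower_tri s K"
  shows "LT_mult L L' \<in> lower_tri s K"
  using assms(2,3) field_closed[OF K] unfolding lower_tri_def LT_mult_def
  by (auto elim!: Reals_cases)

lemma lower_tri_inv:
  assumes K: "conj_field K" and "L \<in> lower_tri s K"
  shows "LT_inv L \<in> lower_tri s K"
  using assms(2) field_closed[OF K] unfolding lower_tri_def LT_inv_def
  by (auto elim!: Reals_cases)

lemma summable_on_square_add:
  fixes f g :: "'a \<Rightarrow> 'b::real_normed_vector"
  assumes "(\<lambda>x. (norm (f x))\<^sup>2) summable_on I" "(\<lambda>x. (norm (g x))\<^sup>2) summable_on I"
  shows "(\<lambda>x. (norm (f x + g x))\<^sup>2) summable_on I"
proof (rule summable_on_comparison_test)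
  show "(\<lambda>x. 2 * (norm (f x))\<^sup>2 + 2 * (norm (g x))\<^sup>2) summable_on I"
    by (intro summable_on_add summable_on_cmult_right assms)
  fix x
  have "(norm (f x + g x))\<^sup>2 \<le> (norm (f x) + norm (g x))\<^sup>2"
    by (intro power_mono norm_triangle_ineq) auto
  also have "\<dots> \<le> 2 * (norm (f x))\<^sup>2 + 2 * (norm (g x))\<^sup>2"
    using sum_squares_bound[of "norm (f x)" "norm (g x)"] by (simp add: power2_sum)
  finally show "(norm (f x + g x))\<^sup>2 \<le> 2 * (norm (f x))\<^sup>2 + 2 * (norm (g x))\<^sup>2" .
qed auto

lemma LT_mult_closed:
  assumes K: "conj_field K" and L: "L \<in> LT s K" and L': "L' \<in> LT s K"
  shows "LT_mult L L' \<in> LT s K"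
proof -
  note low = lower_tri_mult[OF K LT_lower[OF L] LT_lower[OF L']]
  show ?thesis
  proof (cases s)
    case (Fin n)
    then show ?thesis using low by simp
  next
    case Finitary
    have "{j. LT_mult L L' j j \<noteq> 1} \<subseteq> {j. L j j \<noteq> 1} \<union> {j. L' j j \<noteq> 1}"
      "{(i, j). j < i \<and> LT_mult L L' i j \<noteq> 0} \<subseteq> {(i, j). j < i \<and> L i j \<noteq> 0} \<union> {(i, j). j < i \<and>
          L' i j \<noteq> 0}"
      by (auto simp: LT_mult_def)
    moreover have "finite ({j. L j j \<noteq> 1} \<union> {j. L' j j \<noteq> 1})"
      "finite ({(i, j). j < i \<and> L i j \<noteq> 0} \<union> {(i, j). j < i \<and> L' i j \<noteq> 0})"
      using L L' Finitary by auto
    ultimately have "finite {j. LT_mult L L' j j \<noteq> 1}" "finite {(i, j). j < i \<and> LT_mult L L' i j \<noteq> 0}"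
      by (rule_tac [!] finite_subset) assumption+
    then show ?thesis using low Finitary by simp
  next
    case Hilbert
    \<comment> \<open>Both conditions of the Hilbert shape are square summability, of the logarithms
      on the diagonal and of the entries below it. Both families are added by the product.\<close>
    have 1: "(\<lambda>j. (norm (ln (Re (L j j)) + ln (Re (L' j j))))\<^sup>2) summable_on UNIV"
      using L L' Hilbert by (intro summable_on_square_add) auto
    have "complex_of_real (ln (Re (LT_mult L L' j j))) =
        complex_of_real (ln (Re (L j j)) + ln (Re (L' j j)))" for j
      using logL_mult[OF L L', of j j] by (simp add: logL_def)
    then have "ln (Re (LT_mult L L' j j)) = ln (Re (L j j)) + ln (Re (L' j j))" for j
      by (simp only: of_real_eq_iff)
    then have 1: "(\<lambda>j. (ln (Re (LT_mult L L' j j)))\<^sup>2) summable_on UNIV" using 1 by simp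
    have "(\<lambda>x. (norm ((case x of (i, j) \<Rightarrow> L i j) + (case x of (i, j) \<Rightarrow> L' i j)))\<^sup>2) summable_on {(i,
        j). j < i}"
      using L L' Hilbert by (intro summable_on_square_add) (auto simp: case_prod_unfold)
    then have "(\<lambda>(i, j). (cmod (LT_mult L L' i j))\<^sup>2) summable_on {(i, j). j < i}"
      by (rule summable_on_cong[THEN iffD1, rotated]) (auto simp: LT_mult_def)
    then show ?thesis using 1 low Hilbert by simp
  qed
qed

lemma LT_inv_closed:
  assumes K: "conj_field K" and L: "L \<in> LT s K"
  shows "LT_inv L \<in> LT s K"
proof -
  note low = lower_tri_inv[OF K LT_lower[OF L]]
  show ?thesis
  proof (cases s)
    case (Fin n)
    then show ?thesis using low by simp
  next
    case Finitary
    have "{j. LT_inv L j j \<noteq> 1} = {j. L j j \<noteq> 1}"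
      "{(i, j). j < i \<and> LT_inv L i j \<noteq> 0} = {(i, j). j < i \<and> L i j \<noteq> 0}"
      by (auto simp: LT_inv_def)
    then show ?thesis using low L Finitary by simp
  next
    case Hilbert
    have "ln (Re (LT_inv L j j)) = - ln (Re (L j j))" for j
    proof -
      obtain a where "L j j = complex_of_real a" "0 < a"
        using LT_diag[OF L, of j] Hilbert by auto
      moreover from this have "inverse (L j j) = complex_of_real (inverse a)" by simp
      ultimately show ?thesis unfolding LT_inv_def by (simp add: ln_inverse del: of_real_inverse)
    qed
    moreover have "(\<lambda>(i, j). (cmod (LT_inv L i j))\<^sup>2) summable_on {(i, j). j < i}"
      by (rule summable_on_cong[THEN iffD1, of _ "\<lambda>(i, j). (cmod (L i j))\<^sup>2"])
        (use L Hilbert in \<open>auto simp: LT_inv_def\<close>)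
    ultimately show ?thesis using low L Hilbert by simp
  qed
qed

lemma idmat_closed:
  assumes K: "conj_field K"
  shows "idmat s \<in> LT s K"
  by (cases s) (auto simp: lower_tri_def idmat_def field_closed[OF K] summable_on_0 case_prod_unfold
      intro!: summable_on_0)

definition LT_group :: "shape \<Rightarrow> complex set \<Rightarrow> cmat monoid"
  where "LT_group s K = \<lparr>carrier = LT s K, monoid.mult = LT_mult, one = idmat s\<rparr>"

lemma LT_mult_comm: "LT_mult L L' = LT_mult L' L"
  by (auto simp: LT_mult_def fun_eq_iff)

lemma LT_mult_one: "L \<in> LT s K \<Longrightarrow> LT_mult (idmat s) L = L"
  using LT_upper[of L s K] LT_outside[of L s K]
  by (auto simp: LT_mult_def fun_eq_iff idmat_def not_less_iff_gr_or_eq)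

lemma LT_mult_inv: "L \<in> LT s K \<Longrightarrow> LT_mult (LT_inv L) L = idmat s"
  using LT_diag_nonzero[of L s K] LT_outside[of L s K]
  by (auto simp: LT_mult_def LT_inv_def fun_eq_iff idmat_def)

lemma comm_group_LT:
  assumes "conj_field K"
  shows "comm_group (LT_group s K)"
proof (rule comm_groupI)
  fix L assume "L \<in> carrier (LT_group s K)"
  then show "\<exists>L'\<in>carrier (LT_group s K). L' \<otimes>\<^bsub>LT_group s K\<^esub> L = \<one>\<^bsub>LT_group s K\<^esub>"
    using LT_inv_closed[OF assms] LT_mult_inv by (intro bexI[of _ "LT_inv L"]) (auto simp: LT_group_def)
qed (use LT_mult_closed[OF assms] idmat_closed[OF assms] LT_mult_one LT_mult_comm
    in \<open>auto simp: LT_group_def LT_mult_def fun_eq_iff\<close>)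

section \<open>The distance on triangular matrices\<close>

definition l2norm :: "('a \<Rightarrow> complex) \<Rightarrow> 'a set \<Rightarrow> real"
  where "l2norm f I = sqrt (\<Sum>\<^sub>\<infinity>x\<in>I. (cmod (f x))\<^sup>2)"

text \<open>Minkowski's inequality for finite sets bounds every partial sum of the squares, and
  hence the infinite sum.\<close>

lemma l2norm_triangle:
  assumes f: "(\<lambda>x. (cmod (f x))\<^sup>2) summable_on I" and g: "(\<lambda>x. (cmod (g x))\<^sup>2) summable_on I"
  shows "l2norm (\<lambda>x. f x + g x) I \<le> l2norm f I + l2norm g I"
proof -
  have fin: "L2_set (\<lambda>x. cmod (h x)) S \<le> l2norm h I"
    if "finite S" "S \<subseteq> I" "(\<lambda>x. (cmod (h x))\<^sup>2) summable_on I" for h S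
    unfolding L2_set_def l2norm_def using that
    by (intro real_sqrt_le_mono finite_sum_le_infsum) auto
  have nn: "0 \<le> l2norm f I + l2norm g I"
    unfolding l2norm_def by (intro add_nonneg_nonneg) (auto intro!: infsum_nonneg)
  have "(\<Sum>\<^sub>\<infinity>x\<in>I. (cmod (f x + g x))\<^sup>2) \<le> (l2norm f I + l2norm g I)\<^sup>2"
  proof (rule infsum_le_finite_sums[OF summable_on_square_add[OF f g]])
    fix S assume S: "finite S" "S \<subseteq> I"
    have "L2_set (\<lambda>x. cmod (f x + g x)) S \<le> L2_set (\<lambda>x. cmod (f x) + cmod (g x)) S"
      by (intro L2_set_mono norm_triangle_ineq) auto
    also have "\<dots> \<le> L2_set (\<lambda>x. cmod (f x)) S + L2_set (\<lambda>x. cmod (g x)) S"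
      by (rule L2_set_triangle_ineq)
    also have "\<dots> \<le> l2norm f I + l2norm g I"
      by (intro add_mono fin S f g)
    finally have "sqrt (\<Sum>x\<in>S. (cmod (f x + g x))\<^sup>2) \<le> l2norm f I + l2norm g I"
      by (simp add: L2_set_def)
    then show "(\<Sum>x\<in>S. (cmod (f x + g x))\<^sup>2) \<le> (l2norm f I + l2norm g I)\<^sup>2"
      by (rule sqrt_le_D)
  qed
  then show ?thesis unfolding l2norm_def[of "\<lambda>x. f x + g x"] using nn real_le_lsqrt by blast
qed

lemma l2norm_eq_0:
  assumes "(\<lambda>x. (cmod (f x))\<^sup>2) summable_on I" "l2norm f I = 0" "x \<in> I"
  shows "f x = 0"
  using nonneg_infsum_le_0D[of "\<lambda>x. (cmod (f x))\<^sup>2" I x] assms by (simp add: l2norm_def)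

lemma summable_logL_diff:
  assumes "L \<in> LT s F" "L' \<in> LT s F"
  shows "(\<lambda>x. (cmod (case x of (i, j) \<Rightarrow> logL L i j - logL L' i j))\<^sup>2) summable_on tri_idx s"
  using summable_on_square_add[of "\<lambda>(i, j). logL L i j" "tri_idx s" "\<lambda>(i, j). - logL L' i j"]
    summable_logL[OF assms(1)] summable_logL[OF assms(2)] by (simp add: case_prod_unfold)

text \<open>The reason for \<open>logL\<close>: the triangle inequality and invariance under
  multiplication become the triangle inequality and translation invariance of an
  \<ell>\<open>\<^sup>2\<close> norm.\<close>

lemma LT_dist_l2norm:
  assumes "L \<in> LT s F" "L' \<in> LT s F"
  shows "LT_dist s L L' = l2norm (\<lambda>(i, j). logL L i j - logL L' i j) (tri_idx s)"
proof -
  let ?f = "\<lambda>x. (cmod (case x of (i, j) \<Rightarrow> logL L i j - logL L' i j))\<^sup>2"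
  note s = summable_logL_diff[OF assms]
  have "infsum ?f (tri_idx s) = infsum ?f {(i, j). i \<in> idx s \<and> j < i} + infsum ?f ((\<lambda>j. (j,
      j)) ` idx s)"
    unfolding tri_idx_split(1)
    by (rule infsum_Un_disjoint) (use s tri_idx_split[of s] in \<open>auto intro: summable_on_subset_banach\<close>)
  also have "infsum ?f {(i, j). i \<in> idx s \<and> j < i} =
      (\<Sum>\<^sub>\<infinity>(i, j)\<in>{(i, j). i \<in> idx s \<and> j < i}. (cmod (L i j - L' i j))\<^sup>2)"
    by (rule infsum_cong) (auto simp: logL_def)
  also have "infsum ?f ((\<lambda>j. (j, j)) ` idx s) = (\<Sum>\<^sub>\<infinity>j\<in>idx s. (ln (Re (L j j)) - ln (Re (L' j j)))\<^sup>2)"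
    by (subst infsum_reindex) (auto simp: inj_on_def o_def logL_def simp flip: of_real_diff)
  finally show ?thesis by (simp add: LT_dist_def l2norm_def)
qed

lemma LT_dist_nonneg: "0 \<le> LT_dist s L L'"
  unfolding LT_dist_def by (auto intro!: add_nonneg_nonneg infsum_nonneg)

lemma LT_dist_commute: "LT_dist s L L' = LT_dist s L' L"
  unfolding LT_dist_def by (simp add: norm_minus_commute power2_commute)

lemma LT_dist_zero:
  assumes "L \<in> LT s F" "L' \<in> LT s F"
  shows "LT_dist s L L' = 0 \<longleftrightarrow> L = L'"
proof
  assume "LT_dist s L L' = 0"
  then have *: "logL L i j = logL L' i j" if "(i, j) \<in> tri_idx s" for i j
    using l2norm_eq_0[OF summable_logL_diff[OF assms] _ that] LT_dist_l2norm[OF assms] by simp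
  have "logL L i j = logL L' i j" for i j
    using *[of i j] LT_outside[OF assms(1)] LT_outside[OF assms(2)]
    by (cases "(i, j) \<in> tri_idx s") (auto simp: logL_def tri_idx_def)
  then show "L = L'" by (intro logL_inj[OF assms]) auto
qed (simp add: LT_dist_def case_prod_unfold)

lemma LT_dist_triangle:
  assumes "L \<in> LT s F" "L' \<in> LT s F" "L'' \<in> LT s F"
  shows "LT_dist s L L'' \<le> LT_dist s L L' + LT_dist s L' L''"
  using l2norm_triangle[OF summable_logL_diff[OF assms(1,2)] summable_logL_diff[OF assms(2,3)]]
    LT_dist_l2norm[OF assms(1,2)] LT_dist_l2norm[OF assms(2,3)] LT_dist_l2norm[OF assms(1,3)]
  by (simp add: case_prod_unfold)

lemma LT_dist_mult:
  assumes K: "conj_field K" and L: "L \<in> LT s K" "L' \<in> LT s K" "M \<in> LT s K"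
  shows "LT_dist s (LT_mult M L) (LT_mult M L') = LT_dist s L L'"
  using LT_dist_l2norm[OF LT_mult_closed[OF K L(3,1)] LT_mult_closed[OF K L(3,2)]] LT_dist_l2norm[OF
      L(1,2)]
  by (simp add: logL_mult[OF L(3,1)] logL_mult[OF L(3,2)])

section \<open>Groups with a triangular chart\<close>

lemma powr_convex_nonneg:
  fixes r :: real
  assumes "1 \<le> r" "0 \<le> x" "0 \<le> y" "0 \<le> u" "u \<le> 1"
  shows "((1 - u) * x + u * y) powr r \<le> (1 - u) * x powr r + u * y powr r"
proof -
  \<comment> \<open>When one of the two points is 0, convexity amounts to this inequality for the
    weight of the other point.\<close>
  have le: "v powr r \<le> v" if "0 \<le> v" "v \<le> 1" for v :: real
    using powr_mono'[of 1 r v] that assms(1) by simp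
  consider "x = 0" | "y = 0" | "0 < x" "0 < y" using assms by linarith
  then show ?thesis
  proof cases
    case 1
    then show ?thesis using assms mult_right_mono[OF le[of u], of "y powr r"] by (simp add: powr_mult)
  next
    case 2
    then show ?thesis using assms mult_right_mono[OF le[of "1 - u"], of "x powr r"]
        by (simp add: powr_mult)
  next
    case 3
    then show ?thesis using convex_onD[OF powr_convex[OF assms(1)], of u x y] assms by simp
  qed
qed

text \<open>Rescale both vectors to norm 1 and apply convexity of \<open>x powr r\<close> in each
  coordinate to their convex combination. Adding the two coordinates bounds the combination by
  1.\<close>

lemma minkowski_2:
  fixes r :: real
  assumes r: "1 \<le> r" and nn: "0 \<le> a" "0 \<le> b" "0 \<le> c" "0 \<le> d"
  shows "((a + c) powr r + (b + d) powr r) powr (1 / r)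
    \<le> (a powr r + b powr r) powr (1 / r) + (c powr r + d powr r) powr (1 / r)"
proof -
  define s where "s = (a powr r + b powr r) powr (1 / r)"
  define t where "t = (c powr r + d powr r) powr (1 / r)"
  have sr: "s powr r = a powr r + b powr r" and tr: "t powr r = c powr r + d powr r"
    unfolding s_def t_def using r by (simp_all add: powr_powr)
  have st: "0 \<le> s" "0 \<le> t" by (simp_all add: s_def t_def)
  consider "s = 0" | "t = 0" | "0 < s" "0 < t" using st by linarith
  then show ?thesis
  proof cases
    case 1
    then have "a powr r + b powr r = 0" using sr by simp
    then have "a = 0" "b = 0" by (simp_all add: add_nonneg_eq_0_iff)
    then show ?thesis using r by simp
  next
    case 2
    then have "c powr r + d powr r = 0" using tr by simp
    then have "c = 0" "d = 0" by (simp_all add: add_nonneg_eq_0_iff)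
    then show ?thesis using r by simp
  next
    case 3
    \<comment> \<open>With the norms \<open>s\<close> and \<open>t\<close> as relative weights, the
      convex combination of the normalised vectors is the sum of the original vectors divided by
      \<open>s + t\<close>.\<close>
    define u where "u = t / (s + t)"
    have u: "0 \<le> u" "u \<le> 1" "1 - u = s / (s + t)" using 3 by (simp_all add: u_def field_simps)
    have conv: "((x + y) / (s + t)) powr r \<le> (1 - u) * (x / s) powr r + u * (y / t) powr r"
      if "0 \<le> x" "0 \<le> y" for x y
    proof -
      have "(x + y) / (s + t) = (1 - u) * (x / s) + u * (y / t)"
        unfolding u(3) unfolding u_def using 3 by (simp add: add_divide_distrib)
      then show ?thesis using powr_convex_nonneg[OF r _ _ u(1,2), of "x / s" "y / t"] that 3 by simp
    qed
    have "((a + c) powr r + (b + d) powr r) / (s + t) powr r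
        = ((a + c) / (s + t)) powr r + ((b + d) / (s + t)) powr r"
      using nn 3 by (simp add: powr_divide flip: add_divide_distrib)
    also have "\<dots> \<le> (1 - u) * ((a / s) powr r + (b / s) powr r) + u * ((c / t) powr r + (d / t) powr r)"
      using conv[of a c] conv[of b d] nn by (simp add: algebra_simps)
    also have "(a / s) powr r + (b / s) powr r = 1"
      using nn 3 sr[symmetric] by (simp add: powr_divide flip: add_divide_distrib)
    also have "(c / t) powr r + (d / t) powr r = 1"
      using nn 3 tr[symmetric] by (simp add: powr_divide flip: add_divide_distrib)
    finally have "(a + c) powr r + (b + d) powr r \<le> (s + t) powr r"
      using 3 by (simp add: divide_le_eq)
    then have "((a + c) powr r + (b + d) powr r) powr (1 / r) \<le> ((s + t) powr r) powr (1 / r)"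
      using r by (intro powr_mono2) auto
    then show ?thesis using r st by (simp add: powr_powr s_def t_def)
  qed
qed

context
  fixes p :: ereal assumes p: "1 \<le> p"
begin

lemma lp_exponent: "p \<noteq> \<infinity> \<Longrightarrow> 1 \<le> real_of_ereal p"
  using p by (cases p) auto

lemma lp_norm2_nonneg: "0 \<le> lp_norm2 p x y"
  by (auto simp: lp_norm2_def le_max_iff_disj)

lemma lp_norm2_left: "lp_norm2 p x 0 = \<bar>x\<bar>"
  using lp_exponent by (auto simp: lp_norm2_def powr_powr)

lemma lp_norm2_right: "lp_norm2 p 0 y = \<bar>y\<bar>"
  using lp_exponent by (auto simp: lp_norm2_def powr_powr)

lemma lp_norm2_mono:
  assumes "0 \<le> x" "x \<le> x'" "0 \<le> y" "y \<le> y'"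
  shows "lp_norm2 p x y \<le> lp_norm2 p x' y'"
proof (cases "p = \<infinity>")
  case False
  then show ?thesis using lp_exponent assms
    by (auto simp: lp_norm2_def intro!: powr_mono2 add_mono)
qed (use assms in \<open>auto simp: lp_norm2_def\<close>)

lemma lp_norm2_triangle:
  assumes "0 \<le> a" "0 \<le> b" "0 \<le> c" "0 \<le> d"
  shows "lp_norm2 p (a + c) (b + d) \<le> lp_norm2 p a b + lp_norm2 p c d"
proof (cases "p = \<infinity>")
  case False
  then show ?thesis using minkowski_2[OF lp_exponent assms] assms by (simp add: lp_norm2_def)
qed (use assms in \<open>auto simp: lp_norm2_def\<close>)

text \<open>Used to split a distance: value 0 forces both coordinates to vanish, and a value below 1
  forces the discrete coordinate to vanish, that is, the signs to agree.\<close>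

lemma lp_norm2_lower:
  assumes "0 \<le> x" "0 \<le> y"
  shows "x \<le> lp_norm2 p x y" "y \<le> lp_norm2 p x y"
  using lp_norm2_mono[of x x 0 y] lp_norm2_mono[of 0 x y y] assms
  by (simp_all add: lp_norm2_left lp_norm2_right)

end

text \<open>\<open>\<Psi>\<close> is the parametrisation by factor and signs, \<open>chol\<close>
  and \<open>sg\<close> are its inverse. The leading and the trailing cones are both instances, with
  \<open>K\<close> the conjugation-stable part of the field, so group theory and distances are
  treated once.\<close>

locale cone_chart =
  fixes s :: shape and K :: "complex set" and \<Psi> :: "cmat \<Rightarrow> (nat \<Rightarrow> real) \<Rightarrow> cmat"
    and G :: "cmat monoid" and chol :: "cmat \<Rightarrow> cmat" and sg :: "cmat \<Rightarrow> nat \<Rightarrow> real"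
  assumes K: "conj_field K"
    and carrier_eq: "carrier G = {\<Psi> L \<epsilon> |L \<epsilon>. L \<in> LT s K \<and> \<epsilon> \<in> signs s}"
    and chol_chart: "L \<in> LT s K \<Longrightarrow> \<epsilon> \<in> signs s \<Longrightarrow> chol (\<Psi> L \<epsilon>) = L"
    and sg_chart: "L \<in> LT s K \<Longrightarrow> \<epsilon> \<in> signs s \<Longrightarrow> sg (\<Psi> L \<epsilon>) = \<epsilon>"
    and mult_eq: "A \<in> carrier G \<Longrightarrow> B \<in> carrier G \<Longrightarrow>
      A \<otimes>\<^bsub>G\<^esub> B = \<Psi> (LT_mult (chol A) (chol B)) (sg A \<otimes>\<^bsub>sign_group s\<^esub> sg B)"
    and one_eq: "\<one>\<^bsub>G\<^esub> = \<Psi> (idmat s) \<one>\<^bsub>sign_group s\<^esub>"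
begin

sublocale S: comm_group "sign_group s" by (rule comm_group_sign)
sublocale T: comm_group "LT_group s K" by (rule comm_group_LT[OF K])

lemma chart_carrier: "L \<in> LT s K \<Longrightarrow> \<epsilon> \<in> signs s \<Longrightarrow> \<Psi> L \<epsilon> \<in> carrier G"
  unfolding carrier_eq by blast

lemma
  assumes "A \<in> carrier G"
  shows chol_LT: "chol A \<in> LT s K" and sg_signs: "sg A \<in> signs s"
    and chart_chol: "\<Psi> (chol A) (sg A) = A"
  using assms chol_chart sg_chart unfolding carrier_eq by auto

lemma chart_eqI:
  "A \<in> carrier G \<Longrightarrow> B \<in> carrier G \<Longrightarrow> chol A = chol B \<Longrightarrow> sg A = sg B \<Longrightarrow> A = B"
  using chart_chol by metis

lemma
  assumes "A \<in> carrier G" "B \<in> carrier G"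
  shows mult_closed: "A \<otimes>\<^bsub>G\<^esub> B \<in> carrier G"
    and chol_mult: "chol (A \<otimes>\<^bsub>G\<^esub> B) = LT_mult (chol A) (chol B)"
    and sg_mult: "sg (A \<otimes>\<^bsub>G\<^esub> B) = sg A \<otimes>\<^bsub>sign_group s\<^esub> sg B"
proof -
  have "LT_mult (chol A) (chol B) \<in> LT s K" "sg A \<otimes>\<^bsub>sign_group s\<^esub> sg B \<in> signs s"
    using assms by (auto intro!: LT_mult_closed[OF K] chol_LT S.m_closed sg_signs)
  then show "A \<otimes>\<^bsub>G\<^esub> B \<in> carrier G" "chol (A \<otimes>\<^bsub>G\<^esub> B) = LT_mult (chol A) (chol B)"
    "sg (A \<otimes>\<^bsub>G\<^esub> B) = sg A \<otimes>\<^bsub>sign_group s\<^esub> sg B"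
    unfolding mult_eq[OF assms] by (simp_all add: chart_carrier chol_chart sg_chart)
qed

lemma one_carrier: "\<one>\<^bsub>G\<^esub> \<in> carrier G"
  and chol_one: "chol (\<one>\<^bsub>G\<^esub>) = idmat s" and sg_one: "sg (\<one>\<^bsub>G\<^esub>) = \<one>\<^bsub>sign_group s\<^esub>"
  unfolding one_eq using idmat_closed[OF K] by (simp_all add: chart_carrier chol_chart sg_chart)

text \<open>By \<open>chart_eqI\<close> an equation in \<open>G\<close> may be tested on the factor
  and on the signs separately, where it is a law of one of the two known groups.\<close>

lemma comm_group_G: "comm_group G"
proof (rule comm_groupI)
  fix A B C assume A: "A \<in> carrier G" and B: "B \<in> carrier G" and C: "C \<in> carrier G"
  show "A \<otimes>\<^bsub>G\<^esub> B \<otimes>\<^bsub>G\<^esub> C = A \<otimes>\<^bsub>G\<^esub> (B \<otimes>\<^bsub>G\<^esub> C)"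
    by (rule chart_eqI) (use A B C T.m_assoc[of "chol A" "chol B" "chol C"] S.m_assoc[of "sg A" "sg
        B" "sg C"] in \<open>simp_all add: mult_closed chol_mult sg_mult LT_group_def chol_LT sg_signs\<close>)
next
  fix A B assume A: "A \<in> carrier G" and B: "B \<in> carrier G"
  show "A \<otimes>\<^bsub>G\<^esub> B = B \<otimes>\<^bsub>G\<^esub> A"
    by (rule chart_eqI) (use A B LT_mult_comm[of "chol A" "chol B"] S.m_comm[of "sg A" "sg B"]
        in \<open>simp_all add: mult_closed chol_mult sg_mult sg_signs\<close>)
next
  fix A assume A: "A \<in> carrier G"
  show "\<one>\<^bsub>G\<^esub> \<otimes>\<^bsub>G\<^esub> A = A"
    by (rule chart_eqI) (use A in \<open>simp_all add: mult_closed chol_mult sg_mult sg_signs one_carrier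
        chol_one sg_one chol_LT LT_mult_one[of _ s K]\<close>)
  \<comment> \<open>Each sign sequence is its own inverse, so the signs of the inverse are those of
    \<open>A\<close>.\<close>
  have "\<Psi> (LT_inv (chol A)) (sg A) \<otimes>\<^bsub>G\<^esub> A = \<one>\<^bsub>G\<^esub>"
    by (rule chart_eqI) (use A LT_inv_closed[OF K chol_LT[OF A]]
        in \<open>simp_all add: mult_closed chol_mult sg_mult sg_signs one_carrier chol_one sg_one chol_LT
        chart_carrier chol_chart sg_chart LT_mult_inv[of _ s K] sign_square\<close>)
  then show "\<exists>B\<in>carrier G. B \<otimes>\<^bsub>G\<^esub> A = \<one>\<^bsub>G\<^esub>"
    using A LT_inv_closed[OF K chol_LT[OF A]] sg_signs chart_carrier by blast
qed (auto simp: mult_closed one_carrier)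

sublocale G: comm_group G by (rule comm_group_G)

lemma inv_chart:
  assumes "L \<in> LT s K" "\<epsilon> \<in> signs s"
  shows "inv\<^bsub>G\<^esub> (\<Psi> L \<epsilon>) = \<Psi> (LT_inv L) \<epsilon>"
proof (rule G.inv_equality)
  show "\<Psi> (LT_inv L) \<epsilon> \<otimes>\<^bsub>G\<^esub> \<Psi> L \<epsilon> = \<one>\<^bsub>G\<^esub>"
    by (rule chart_eqI) (use assms LT_inv_closed[OF K assms(1)]
        in \<open>simp_all add: mult_closed chol_mult sg_mult one_carrier chol_one sg_one
        chart_carrier chol_chart sg_chart LT_mult_inv[of _ s K] sign_square\<close>)
qed (use assms LT_inv_closed[OF K assms(1)] chart_carrier in auto)

lemma mult_chart:
  assumes "L \<in> LT s K" "\<epsilon> \<in> signs s" "L' \<in> LT s K" "\<epsilon>' \<in> signs s"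
  shows "\<Psi> L \<epsilon> \<otimes>\<^bsub>G\<^esub> \<Psi> L' \<epsilon>' = \<Psi> (LT_mult L L') (\<epsilon> \<otimes>\<^bsub>sign_group s\<^esub> \<epsilon>')"
  using assms by (simp add: mult_eq chart_carrier chol_chart sg_chart)

abbreviation positive :: "cmat set"
  where "positive \<equiv> {\<Psi> L \<one>\<^bsub>sign_group s\<^esub> |L. L \<in> LT s K}"

lemma subgroup_positive: "subgroup positive G"
proof (rule G.subgroupI)
  show "positive \<noteq> {}" using idmat_closed[OF K] by blast
next
  fix A assume "A \<in> positive"
  then obtain L where L: "L \<in> LT s K" "A = \<Psi> L \<one>\<^bsub>sign_group s\<^esub>" by blast
  show "inv\<^bsub>G\<^esub> A \<in> positive"
    unfolding L(2) inv_chart[OF L(1) S.one_closed] using LT_inv_closed[OF K L(1)] by blast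
next
  fix A B assume "A \<in> positive" "B \<in> positive"
  then obtain L L' where L: "L \<in> LT s K" "A = \<Psi> L \<one>\<^bsub>sign_group s\<^esub>"
      "L' \<in> LT s K" "B = \<Psi> L' \<one>\<^bsub>sign_group s\<^esub>" by blast
  show "A \<otimes>\<^bsub>G\<^esub> B \<in> positive"
    unfolding L(2,4) mult_chart[OF L(1) S.one_closed L(3) S.one_closed] S.r_one[OF S.one_closed]
    using LT_mult_closed[OF K L(1,3)] by blast
qed (use chart_carrier S.one_closed in blast)

text \<open>\<open>H\<close> is abstract because it is instantiated in two ways: the leading
  positive cone is a group of its own whose product is \<open>lpm_cast\<close>, while the trailing
  one is a restriction of the big group.\<close>

lemma iso_positive:
  assumes H: "carrier H = positive" "\<And>A B. A \<in> positive \<Longrightarrow> B \<in> positive \<Longrightarrow> A \<otimes>\<^bsub>H\<^esub> B = A \<otimes>\<^bsub>G\<^esub> B"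
  shows "G \<cong> H \<times>\<times> sign_group s"
proof -
  let ?f = "\<lambda>A. (\<Psi> (chol A) \<one>\<^bsub>sign_group s\<^esub>, sg A)"
  have hom: "?f \<in> hom G (H \<times>\<times> sign_group s)"
  proof (rule homI)
    fix A assume "A \<in> carrier G"
    then show "?f A \<in> carrier (H \<times>\<times> sign_group s)"
      using chol_LT sg_signs by (auto simp: DirProd_def H(1))
  next
    fix A B assume A: "A \<in> carrier G" and B: "B \<in> carrier G"
    then have "\<Psi> (chol A) \<one>\<^bsub>sign_group s\<^esub> \<otimes>\<^bsub>H\<^esub> \<Psi> (chol B) \<one>\<^bsub>sign_group s\<^esub> =
        \<Psi> (LT_mult (chol A) (chol B)) \<one>\<^bsub>sign_group s\<^esub>"
      using chol_LT by (subst H(2)) (auto simp: mult_chart)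
    then show "?f (A \<otimes>\<^bsub>G\<^esub> B) = ?f A \<otimes>\<^bsub>H \<times>\<times> sign_group s\<^esub> ?f B"
      using A B by (simp add: DirProd_def chol_mult sg_mult)
  qed
  have "bij_betw ?f (carrier G) (carrier (H \<times>\<times> sign_group s))"
  proof (rule bij_betwI[where g = "\<lambda>(A, \<epsilon>). \<Psi> (chol A) \<epsilon>"])
    show "?f \<in> carrier G \<rightarrow> carrier (H \<times>\<times> sign_group s)"
      using hom by (simp add: hom_def)
  next
    show "(\<lambda>(A, \<epsilon>). \<Psi> (chol A) \<epsilon>) \<in> carrier (H \<times>\<times> sign_group s) \<rightarrow> carrier G"
      by (auto simp: DirProd_def H(1) chol_chart chart_carrier)
  next
    fix A assume "A \<in> carrier G"
    then show "(case ?f A of (A, \<epsilon>) \<Rightarrow> \<Psi> (chol A) \<epsilon>) = A"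
      using chol_LT by (simp add: chol_chart chart_chol)
  next
    fix y assume "y \<in> carrier (H \<times>\<times> sign_group s)"
    then obtain L \<epsilon> where "L \<in> LT s K" "\<epsilon> \<in> signs s" "y = (\<Psi> L \<one>\<^bsub>sign_group s\<^esub>, \<epsilon>)"
      by (auto simp: DirProd_def H(1))
    then show "?f (case y of (A, \<epsilon>) \<Rightarrow> \<Psi> (chol A) \<epsilon>) = y"
      by (simp add: chol_chart sg_chart)
  qed
  then have "?f \<in> iso G (H \<times>\<times> sign_group s)" using hom by (simp add: iso_def)
  then show ?thesis unfolding is_iso_def by blast
qed

definition cone_dist :: "ereal \<Rightarrow> cmat \<Rightarrow> cmat \<Rightarrow> real"
  where "cone_dist p A B = lp_norm2 p (LT_dist s (chol A) (chol B)) (1 - (if sg A =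
      sg B then 1 else 0))"

lemma bi_invariant_cone_dist:
  assumes p: "1 \<le> p"
  shows "bi_invariant_metric G (cone_dist p)"
  unfolding bi_invariant_metric_def
proof (intro conjI ballI)
  show "Metric_space (carrier G) (cone_dist p)"
  proof
    show "0 \<le> cone_dist p A B" for A B
      unfolding cone_dist_def by (rule lp_norm2_nonneg[OF p])
    show "cone_dist p A B = cone_dist p B A" for A B
      unfolding cone_dist_def by (simp add: LT_dist_commute eq_commute)
  next
    fix A B assume A: "A \<in> carrier G" and B: "B \<in> carrier G"
    show "cone_dist p A B = 0 \<longleftrightarrow> A = B"
    proof
      assume "cone_dist p A B = 0"
      then have "LT_dist s (chol A) (chol B) \<le> 0" "1 - (if sg A = sg B then 1 else 0) \<le> (0::real)"
        using lp_norm2_lower[OF p LT_dist_nonneg, of "1 - (if sg A =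
            sg B then 1 else 0)" s "chol A" "chol B"]
        by (auto simp: cone_dist_def split: if_splits)
      then have "LT_dist s (chol A) (chol B) = 0" "sg A = sg B"
        using LT_dist_nonneg[of s "chol A" "chol B"] by (auto split: if_splits)
      with A B show "A = B" by (metis LT_dist_zero chart_eqI chol_LT)
    next
      assume "A = B"
      then show "cone_dist p A B = 0" using chol_LT[OF A]
        by (simp add: cone_dist_def lp_norm2_left[OF p] LT_dist_zero[of _ s K])
    qed
  next
    fix A B C assume A: "A \<in> carrier G" and B: "B \<in> carrier G" and C: "C \<in> carrier G"
    let ?\<delta> = "\<lambda>A B. 1 - (if sg A = sg B then 1 else 0) :: real"
    \<comment> \<open>First both coordinates obey a triangle inequality, the second one being the
      discrete metric on signs, and the norm is monotone; then Minkowski's inequality separates the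
      two summands.\<close>
    have "cone_dist p A C \<le> lp_norm2 p (LT_dist s (chol A) (chol B) +
        LT_dist s (chol B) (chol C)) (?\<delta> A B + ?\<delta> B C)"
      unfolding cone_dist_def using A B C
      by (intro lp_norm2_mono[OF p] LT_dist_nonneg LT_dist_triangle[of _ s K] chol_LT) auto
    also have "\<dots> \<le> cone_dist p A B + cone_dist p B C"
      unfolding cone_dist_def by (intro lp_norm2_triangle[OF p] LT_dist_nonneg) auto
    finally show "cone_dist p A C \<le> cone_dist p A B + cone_dist p B C" .
  qed
next
  fix A B C assume A: "A \<in> carrier G" and B: "B \<in> carrier G" and C: "C \<in> carrier G"
  \<comment> \<open>Cancellation in the sign group is the invariance of the discrete part.\<close>
  have "sg C \<otimes>\<^bsub>sign_group s\<^esub> sg A = sg C \<otimes>\<^bsub>sign_group s\<^esub> sg B \<longleftrightarrow> sg A = sg B"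
    using A B C by (simp add: sg_signs)
  then show left: "cone_dist p (C \<otimes>\<^bsub>G\<^esub> A) (C \<otimes>\<^bsub>G\<^esub> B) = cone_dist p A B"
    using A B C by (simp add: cone_dist_def chol_mult sg_mult LT_dist_mult[OF K] chol_LT)
  show "cone_dist p (A \<otimes>\<^bsub>G\<^esub> C) (B \<otimes>\<^bsub>G\<^esub> C) = cone_dist p A B"
    using left A B C by (simp add: G.m_comm)
qed

lemma logL_power:
  assumes "A \<in> carrier G"
  shows "A [^]\<^bsub>G\<^esub> (m::nat) \<in> carrier G \<and>
    logL (chol (A [^]\<^bsub>G\<^esub> m)) i j = of_nat m * logL (chol A) i j"
proof (induction m)
  case 0
  then show ?case by (simp add: chol_one) (simp add: logL_def idmat_def)
next
  case (Suc m)
  then show ?case using assms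
    by (simp add: mult_closed chol_mult logL_mult[of _ s K] chol_LT algebra_simps)
qed

text \<open>A vanishing multiple in logarithmic coordinates forces the logarithm itself to vanish,
  so the factor of a torsion element is the identity. Conversely every sign sequence squares to
  1.\<close>

lemma torsion_eq:
  "torsion_elements G - {\<one>\<^bsub>G\<^esub>} = {\<Psi> (idmat s) \<epsilon> |\<epsilon>. \<epsilon> \<in> signs s \<and> \<epsilon> \<noteq> \<one>\<^bsub>sign_group s\<^esub>}"
proof (intro subset_antisym subsetI)
  fix A assume "A \<in> torsion_elements G - {\<one>\<^bsub>G\<^esub>}"
  then obtain m :: nat where A: "A \<in> carrier G" "A \<noteq> \<one>\<^bsub>G\<^esub>" and m: "0 < m" "A [^]\<^bsub>G\<^esub> m = \<one>\<^bsub>G\<^esub>"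
    by (auto simp: torsion_elements_def)
  have "logL (chol A) i j = logL (idmat s) i j" for i j
    using logL_power[OF A(1), of m i j] m by (simp add: chol_one logL_def idmat_def split: if_splits)
  then have "chol A = idmat s"
    by (intro logL_inj[OF chol_LT[OF A(1)] idmat_closed[OF K]]) auto
  then have "A = \<Psi> (idmat s) (sg A)" using chart_chol[OF A(1)] by simp
  moreover have "sg A \<noteq> \<one>\<^bsub>sign_group s\<^esub>" using calculation A(2) one_eq by auto
  ultimately show "A \<in> {\<Psi> (idmat s) \<epsilon> |\<epsilon>. \<epsilon> \<in> signs s \<and> \<epsilon> \<noteq> \<one>\<^bsub>sign_group s\<^esub>}"
    using sg_signs[OF A(1)] by blast
next
  fix A assume "A \<in> {\<Psi> (idmat s) \<epsilon> |\<epsilon>. \<epsilon> \<in> signs s \<and> \<epsilon> \<noteq> \<one>\<^bsub>sign_group s\<^esub>}"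
  then obtain \<epsilon> where \<epsilon>: "\<epsilon> \<in> signs s" "\<epsilon> \<noteq> \<one>\<^bsub>sign_group s\<^esub>" "A = \<Psi> (idmat s) \<epsilon>" by blast
  have A: "A \<in> carrier G" using \<epsilon> idmat_closed[OF K] chart_carrier by blast
  have "A [^]\<^bsub>G\<^esub> (2::nat) = \<Psi> (LT_mult (idmat s) (idmat s)) (\<epsilon> \<otimes>\<^bsub>sign_group s\<^esub> \<epsilon>)"
    using A \<epsilon> idmat_closed[OF K] by (simp add: numeral_2_eq_2 mult_chart)
  then have "A [^]\<^bsub>G\<^esub> (2::nat) = \<one>\<^bsub>G\<^esub>"
    using \<epsilon> LT_mult_one[OF idmat_closed[OF K]] by (simp add: sign_square one_eq)
  moreover have "A \<noteq> \<one>\<^bsub>G\<^esub>"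
    using \<epsilon> sg_chart[OF idmat_closed[OF K] \<epsilon>(1)] sg_one by auto
  ultimately show "A \<in> torsion_elements G - {\<one>\<^bsub>G\<^esub>}"
    using A by (auto simp: torsion_elements_def intro!: exI[of _ "2::nat"])
qed

end

section \<open>The factorization\<close>

text \<open>Row \<open>j\<close> of \<open>L\<close> vanishes beyond column \<open>j\<close>, so any
  bound \<open>N\<close> above \<open>j\<close> works. Leaving \<open>N\<close> free lets one lemma
  serve column recursions, comparisons of blocks and common bounds for two entries.\<close>

lemma ldl_entry:
  assumes "L \<in> lower_tri s F" "j < N"
  shows "ldl s L \<epsilon> i j = (\<Sum>k<N. L i k * sign_diag s \<epsilon> k k * cnj (L j k))"
  unfolding ldl_def using assms
  by (subst mmul_finite[of "{..<N}"]) (auto simp: mmul_sign_diag ctrans_def lower_tri_def)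

text \<open>Both entries are expanded up to the same bound; the summands are then conjugate because
  the sign matrix is real.\<close>

lemma ldl_hermitian:
  assumes "L \<in> lower_tri s F"
  shows "cnj (ldl s L \<epsilon> i j) = ldl s L \<epsilon> j i"
  by (subst (1 2) ldl_entry[OF assms, of _ "Suc (max i j)"])
    (auto simp: cnj_sign_diag mult_ac)

lemma ldl_idmat: "ldl s (idmat s) \<epsilon> = sign_diag s \<epsilon>"
proof (intro ext)
  fix i j
  have "idmat s \<in> lower_tri s UNIV" by (rule LT_lower[OF idmat_closed[OF conj_field_UNIV]])
  from ldl_entry[OF this lessI] have "ldl s (idmat s) \<epsilon> i j =
      (\<Sum>k<Suc j. idmat s i k * sign_diag s \<epsilon> k k * cnj (idmat s j k))" .
  also have "\<dots> = (\<Sum>k<Suc j. if k = j then sign_diag s \<epsilon> i j else 0)"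
    by (intro sum.cong) (auto simp: idmat_def sign_diag_def)
  also have "\<dots> = sign_diag s \<epsilon> i j" by simp
  finally show "ldl s (idmat s) \<epsilon> i j = sign_diag s \<epsilon> i j" .
qed

text \<open>Column by column. If the earlier columns agree, the diagonal entry of column
  \<open>j\<close> yields the pivot sign and the square of a positive number; dividing by these
  determines the rest of the column. The two fields may differ, since factors over \<open>F\<close>
  are compared with factors over \<open>conj_core F\<close>.\<close>

lemma ldl_unique:
  assumes L: "L \<in> LT s F" and L': "L' \<in> LT s F'" and \<epsilon>: "\<epsilon> \<in> signs s" and \<epsilon>': "\<epsilon>' \<in> signs s"
    and eq: "ldl s L \<epsilon> = ldl s L' \<epsilon>'"
  shows "L = L' \<and> \<epsilon> = \<epsilon>'"
proof -
  have col: "(\<forall>i. L i j = L' i j) \<and> (j \<in> idx s \<longrightarrow> pivot_sign \<epsilon> j = pivot_sign \<epsilon>' j)" for j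
  proof (induction j rule: less_induct)
    case (less j)
    show ?case
    proof (cases "j \<in> idx s")
      case False
      then show ?thesis using LT_outside[OF L] LT_outside[OF L'] by auto
    next
      case j: True
      have sums: "(\<Sum>k<j. L i k * sign_diag s \<epsilon> k k * cnj (L j k)) =
          (\<Sum>k<j. L' i k * sign_diag s \<epsilon>' k k * cnj (L' j k))" for i
        using less.IH idx_downward[OF j] by (intro sum.cong) (auto simp: sign_diag_diag)
      \<comment> \<open>Earlier columns and pivots contribute equally by induction, so only the
        summand with index \<open>j\<close> is left.\<close>
      have step: "L i j * pivot_sign \<epsilon> j * cnj (L j j) = L' i j * pivot_sign \<epsilon>' j * cnj (L' j j)" for i
      proof -
        have "ldl s L \<epsilon> i j = ldl s L' \<epsilon>' i j" using eq by simp
        then show ?thesis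
          using sums[of i] ldl_entry[OF LT_lower[OF L], of j "Suc j" \<epsilon> i]
            ldl_entry[OF LT_lower[OF L'], of j "Suc j" \<epsilon>' i] sign_diag_diag[OF j]
          by simp
      qed
      obtain a b where ab: "L j j = complex_of_real a" "0 < a" "L' j j = complex_of_real b" "0 < b"
        using LT_diag[OF L j] LT_diag[OF L' j] by blast
      have "complex_of_real (a * pivot_sign \<epsilon> j * a) = complex_of_real (b * pivot_sign \<epsilon>' j * b)"
        using step[of j] ab by simp
      then have e: "a * a * pivot_sign \<epsilon> j = b * b * pivot_sign \<epsilon>' j"
        unfolding of_real_eq_iff by (simp add: mult_ac)
      have pos: "0 < a * a" "0 < b * b" using ab by auto
      \<comment> \<open>Both squares are positive, so equality of the products forces equality of
        the signs.\<close>
      have \<delta>: "pivot_sign \<epsilon> j = pivot_sign \<epsilon>' j"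
        using pivot_sign_cases[OF \<epsilon> j] pivot_sign_cases[OF \<epsilon>' j] e pos by auto
      then have "a * a = b * b" using e pivot_sign_cases[OF \<epsilon>' j] by auto
      then have "a = b" using ab by (simp add: square_eq_iff)
      then have "L i j = L' i j" for i
        using step[of i] ab \<delta> pivot_sign_cases[OF \<epsilon>' j] by auto
      then show ?thesis using \<delta> by simp
    qed
  qed
  then show ?thesis using signs_eqI[OF \<epsilon> \<epsilon>'] by (auto simp: fun_eq_iff)
qed

section \<open>Minors and factorizations\<close>

lemma det_lower:
  fixes f :: "nat \<times> nat \<Rightarrow> complex"
  assumes "\<And>i j. i < j \<Longrightarrow> j < m \<Longrightarrow> f (i, j) = 0"
  shows "Determinant.det (Matrix.mat m m f) = (\<Prod>k<m. f (k, k))"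
proof -
  have "Determinant.det (Matrix.mat m m f) = prod_list (diag_mat (Matrix.mat m m f))"
    by (rule det_lower_triangular[of m]) (use assms in auto)
  also have "\<dots> = (\<Prod>k<m. f (k, k))"
    unfolding diag_mat_def by (subst prod.distinct_set_conv_list[symmetric])
      (auto simp: lessThan_atLeast0)
  finally show ?thesis .
qed

text \<open>The determinant of a product of triangular matrices is read off the diagonals. A
  factorization of the lower triangle suffices as input, since Hermitian symmetry supplies the other
  entries.\<close>

lemma leading_minor_factor:
  assumes herm: "\<And>i j. A i j = cnj (A j i)" and d: "\<And>k. cnj (d k) = d k"
    and upper: "\<And>i j. i < j \<Longrightarrow> M i j = 0"
    and fac: "\<And>i j. j \<le> i \<Longrightarrow> i < m \<Longrightarrow> A i j = (\<Sum>k<m. M i k * d k * cnj (M j k))"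
  shows "leading_minor m A = (\<Prod>k<m. d k * (M k k * cnj (M k k)))"
proof -
  have fac': "A i j = (\<Sum>k<m. M i k * d k * cnj (M j k))" if "i < m" "j < m" for i j
  proof (cases "j \<le> i")
    case False
    then have "A j i = (\<Sum>k<m. M j k * d k * cnj (M i k))" using that by (intro fac) auto
    then show ?thesis using herm[of i j] d by (simp add: mult_ac)
  qed (use fac that in auto)
  \<comment> \<open>The diagonal is absorbed into the left factor; the transpose of \<open>P\<close>
    is the adjoint of \<open>M\<close>.\<close>
  define N where "N = Matrix.mat m m (\<lambda>(i, k). M i k * d k)"
  define P where "P = Matrix.mat m m (\<lambda>(j, k). cnj (M j k))"
  have NP: "N \<in> carrier_mat m m" "P \<in> carrier_mat m m" by (auto simp: N_def P_def)
  have "Matrix.mat m m (\<lambda>(i, j). A i j) = N * P\<^sup>T"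
    by (rule eq_matI) (auto simp: N_def P_def scalar_prod_def fac' lessThan_atLeast0)
  then have "leading_minor m A = Determinant.det N * Determinant.det P"
    unfolding leading_minor_def using NP by (simp add: Determinant.det_mult[of _ m]
        Determinant.det_transpose[of _ m])
  also have "Determinant.det N = (\<Prod>k<m. M k k * d k)"
    unfolding N_def by (subst det_lower) (auto simp: upper)
  also have "Determinant.det P = (\<Prod>k<m. cnj (M k k))"
    unfolding P_def by (subst det_lower) (auto simp: upper)
  finally show ?thesis by (simp add: mult_ac flip: prod.distrib)
qed

text \<open>The product telescopes, because the square of each sign is 1.\<close>

lemma prod_pivot_sign:
  assumes "\<And>k. k < m \<Longrightarrow> \<epsilon> k = 1 \<or> \<epsilon> k = -1" "0 < m"
  shows "(\<Prod>k<m. pivot_sign \<epsilon> k) = \<epsilon> (m - 1)"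
  using assms(2,1)
proof (induction m rule: nat_induct_non_zero)
  case 1
  then show ?case by (simp add: pivot_sign_def)
next
  case (Suc m)
  then have "(\<Prod>k<Suc m. pivot_sign \<epsilon> k) = \<epsilon> (m - 1) * (\<epsilon> (m - 1) * \<epsilon> m)"
    by (simp add: pivot_sign_def)
  moreover have "m - 1 < Suc m" by simp
  ultimately show ?case using Suc.prems[of "m - 1"] by auto
qed

text \<open>The minor of order \<open>m\<close> is the product of the first \<open>m\<close> pivot
  signs times positive squares, and the pivot signs telescope. The signs are constrained below
  \<open>n\<close> alone, so initial segments of an infinite sequence are covered.\<close>

lemma ldl_LPMn:
  assumes K: "conj_field K" and L: "L \<in> LT (Fin n) K" and \<epsilon>: "\<And>k. k < n \<Longrightarrow> \<epsilon> k = 1 \<or> \<epsilon> k = -1"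
  shows "ldl (Fin n) L \<epsilon> \<in> LPMn n K \<epsilon>"
proof -
  let ?A = "ldl (Fin n) L \<epsilon>"
  have low: "L \<in> lower_tri (Fin n) K" using L by simp
  have D: "sign_diag (Fin n) \<epsilon> k k \<in> K" for k
  proof (cases "k < n")
    case True
    then have "pivot_sign \<epsilon> k = 1 \<or> pivot_sign \<epsilon> k = -1"
      using \<epsilon>[of k] \<epsilon>[of "k - 1"] by (auto simp: pivot_sign_def)
    then show ?thesis using True field_closed[OF K] by (auto simp: sign_diag_diag)
  qed (use field_0[OF K] in \<open>auto simp: sign_diag_def\<close>)
  have "?A i j \<in> K" for i j
    by (subst ldl_entry[OF low lessI]) (intro field_closed[OF K] D LT_field[OF L])
  moreover have "?A i j = 0" if "i \<ge> n \<or> j \<ge> n" for i j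
    by (subst ldl_entry[OF low lessI]) (use that LT_outside[OF L] in auto)
  moreover have "ctrans ?A = ?A"
    using ldl_hermitian[OF low] by (auto simp: ctrans_def fun_eq_iff)
  moreover have "sgn (leading_minor m ?A) = complex_of_real (\<epsilon> (m - 1))" if m: "m \<in> {1..n}" for m
  proof -
    have "leading_minor m ?A = (\<Prod>k<m. sign_diag (Fin n) \<epsilon> k k * (L k k * cnj (L k k)))"
    proof (rule leading_minor_factor[where M = L and d = "\<lambda>k. sign_diag (Fin n) \<epsilon> k k"])
      fix i j :: nat assume ij: "j \<le> i" "i < m"
      show "?A i j = (\<Sum>k<m. L i k * sign_diag (Fin n) \<epsilon> k k * cnj (L j k))"
        using ij by (intro ldl_entry[OF low]) auto
    qed (use ldl_hermitian[OF low] LT_upper[OF L] in \<open>auto simp: cnj_sign_diag\<close>)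
    also have "\<dots> = (\<Prod>k<m. complex_of_real (pivot_sign \<epsilon> k * (Re (L k k))\<^sup>2))"
    proof (intro prod.cong refl)
      fix k assume "k \<in> {..<m}"
      then have k: "k < n" using m by simp
      then obtain a where "L k k = complex_of_real a" using LT_diag[OF L, of k] by auto
      then show "sign_diag (Fin n) \<epsilon> k k * (L k k * cnj (L k k)) =
          complex_of_real (pivot_sign \<epsilon> k * (Re (L k k))\<^sup>2)"
        using k by (simp add: sign_diag_diag power2_eq_square)
    qed
    also have "\<dots> = complex_of_real ((\<Prod>k<m. pivot_sign \<epsilon> k) * (\<Prod>k<m. (Re (L k k))\<^sup>2))"
      by (simp add: prod.distrib)
    also have "(\<Prod>k<m. pivot_sign \<epsilon> k) = \<epsilon> (m - 1)"
      using m \<epsilon> by (intro prod_pivot_sign) auto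
    finally have *: "leading_minor m ?A = complex_of_real (\<epsilon> (m - 1) * (\<Prod>k<m. (Re (L k k))\<^sup>2))" .
    have "0 < (\<Prod>k<m. (Re (L k k))\<^sup>2)"
    proof (intro prod_pos ballI)
      fix k assume "k \<in> {..<m}"
      then have "0 < Re (L k k)" using m LT_diag[OF L, of k] by auto
      then show "0 < (Re (L k k))\<^sup>2" by simp
    qed
    moreover have "\<epsilon> (m - 1) = 1 \<or> \<epsilon> (m - 1) = -1" using m by (intro \<epsilon>) auto
    ultimately have "sgn (\<epsilon> (m - 1) * (\<Prod>k<m. (Re (L k k))\<^sup>2)) = \<epsilon> (m - 1)"
      by (auto simp: sgn_mult)
    then show ?thesis unfolding * sgn_of_real by simp
  qed
  ultimately show ?thesis by (auto simp: LPMn_def herm_def)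
qed

text \<open>The first index of \<open>ldl_col\<close> is the column.  The formula covers the diagonal as well: there the
  numerator is the pivot \<open>p\<close>, and \<open>p / (\<delta> sqrt (\<delta> p)) = sqrt (\<delta> p)\<close> if \<open>\<delta> p > 0\<close>.\<close>

fun ldl_col :: "(nat \<Rightarrow> real) \<Rightarrow> cmat \<Rightarrow> nat \<Rightarrow> nat \<Rightarrow> complex"
  where "ldl_col \<delta> A j i = (if i < j then 0 else
    (A i j - (\<Sum>k<j. ldl_col \<delta> A k i * \<delta> k * cnj (ldl_col \<delta> A k j))) /
    (\<delta> j * sqrt (Re (\<delta> j * (A j j - (\<Sum>k<j. ldl_col \<delta> A k j * \<delta> k * cnj (ldl_col \<delta> A k j)))))))"

declare ldl_col.simps [simp del]

text \<open>Induction on the column. The minor of order \<open>j + 1\<close> is a product of earlier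
  pivots, whose signs are known, with the pivot \<open>p j\<close>; its prescribed sign therefore
  determines the sign of \<open>p j\<close>. This is what makes the square root in
  \<open>ldl_col\<close> one of a positive number.\<close>

lemma LPMn_pivots:
  assumes A: "A \<in> LPMn n F \<epsilon>" and \<epsilon>: "\<forall>k<n. \<epsilon> k = 1 \<or> \<epsilon> k = -1" and "j < n"
  defines "\<delta> \<equiv> pivot_sign \<epsilon>"
  defines "c \<equiv> ldl_col \<delta> A"
  defines "p \<equiv> \<lambda>j. A j j - (\<Sum>k<j. c k j * \<delta> k * cnj (c k j))"
  shows "p j \<in> \<real> \<and> 0 < \<delta> j * Re (p j) \<and> c j j = complex_of_real (sqrt (\<delta> j * Re (p j))) \<and>
    (\<forall>i\<ge>j. c j i * \<delta> j * cnj (c j j) = A i j - (\<Sum>k<j. c k i * \<delta> k * cnj (c k j)))"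
  using \<open>j < n\<close>
proof (induction j rule: less_induct)
  case (less j)
  have herm: "A i j = cnj (A j i)" for i j
    using A by (auto simp: LPMn_def herm_def ctrans_def fun_eq_iff)
  have \<delta>j: "\<delta> j = 1 \<or> \<delta> j = -1"
    using \<epsilon>[rule_format, of j] \<epsilon>[rule_format, of "j - 1"] less.prems
        by (auto simp: \<delta>_def pivot_sign_def)
  have c_upper: "c k i = 0" if "i < k" for i k
    using that by (simp add: c_def ldl_col.simps)
  have real: "p j \<in> \<real>"
    unfolding p_def using herm[of j j]
    by (intro Reals_diff sum_in_Reals) (auto simp: complex_is_Real_iff complex_eq_iff)
  have "leading_minor (Suc j) A =
    (\<Prod>k<Suc j. (if k < j then complex_of_real (\<delta> k) else p j) *
      ((if k < j then c k k else 1) * cnj (if k < j then c k k else 1)))"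
  proof -
    \<comment> \<open>The last pivot stays in the diagonal factor and the last column of
      \<open>M\<close> is a unit vector: the sign of \<open>p j\<close> is not yet known, so its
      square root must be avoided.\<close>
    let ?M = "\<lambda>i k. if k < j then c k i else if i = j \<and> k = j then 1 else 0"
    let ?d = "\<lambda>k. if k < j then complex_of_real (\<delta> k) else p j"
    have "leading_minor (Suc j) A = (\<Prod>k<Suc j. ?d k * (?M k k * cnj (?M k k)))"
    proof (rule leading_minor_factor[OF herm, where M = ?M and d = ?d])
      show "cnj (?d k) = ?d k" for k using real by (simp add: Reals_cnj_iff)
      show "?M i k = 0" if "i < k" for i k using that c_upper by auto
      fix i i' assume i: "i' \<le> i" "i < Suc j"
      show "A i i' = (\<Sum>k<Suc j. ?M i k * ?d k * cnj (?M i' k))"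
      proof (cases "i' = j")
        case True
        then have "i = j" using i by simp
        then show ?thesis using True by (simp add: p_def)
      next
        case False
        then have i': "i' < j" using i by simp
        \<comment> \<open>The induction hypothesis for column \<open>i'\<close> reaches only to
          index \<open>i'\<close>; the later columns vanish in row \<open>i'\<close> and may be
          added.\<close>
        have "A i i' = (\<Sum>k<Suc i'. c k i * \<delta> k * cnj (c k i'))"
          by (simp only: sum.lessThan_Suc less.IH[OF i' less_trans[OF i' less.prems], THEN conjunct2,
              THEN conjunct2, THEN conjunct2, rule_format, OF i(1)]) simp
        also have "\<dots> = (\<Sum>k<j. c k i * \<delta> k * cnj (c k i'))"
          using i' c_upper by (intro sum.mono_neutral_left) auto
        finally show ?thesis using False by simp
      qed
    qed
    then show ?thesis by (auto intro!: prod.cong)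
  qed
  also have "\<dots> = (\<Prod>k<j. complex_of_real (\<delta> k) * (c k k * cnj (c k k))) * p j" by simp
  also have "(\<Prod>k<j. complex_of_real (\<delta> k) * (c k k * cnj (c k k))) =
      (\<Prod>k<j. complex_of_real (\<delta> k * (\<delta> k * Re (p k))))"
  proof (intro prod.cong refl)
    fix k assume "k \<in> {..<j}"
    then have "0 < \<delta> k * Re (p k)" "c k k = complex_of_real (sqrt (\<delta> k * Re (p k)))"
      using less.IH[of k] less.prems by auto
    then show "complex_of_real (\<delta> k) * (c k k * cnj (c k k)) = complex_of_real (\<delta> k * (\<delta> k * Re (p k)))"
      by (simp flip: of_real_mult)
  qed
  finally have minor: "leading_minor (Suc j) A =
      complex_of_real ((\<Prod>k<j. \<delta> k) * (\<Prod>k<j. \<delta> k * Re (p k)) * Re (p j))"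
    using real by (simp add: prod.distrib of_real_Re)
  have pos: "0 < (\<Prod>k<j. \<delta> k * Re (p k))"
    using less.IH less.prems by (intro prod_pos) auto
  have "sgn (leading_minor (Suc j) A) = complex_of_real (\<epsilon> j)"
    using A less.prems by (auto simp: LPMn_def dest!: bspec[of _ _ "Suc j"])
  then have "sgn ((\<Prod>k<j. \<delta> k) * (\<Prod>k<j. \<delta> k * Re (p k)) * Re (p j)) = \<epsilon> j"
    unfolding minor sgn_of_real of_real_eq_iff .
  then have "sgn (\<Prod>k<j. \<delta> k) * sgn (Re (p j)) = \<epsilon> j" using pos by (simp add: sgn_mult)
  moreover have "\<delta> j = (\<Prod>k<j. \<delta> k) * \<epsilon> j" "(\<Prod>k<j. \<delta> k) = 1 \<or> (\<Prod>k<j. \<delta> k) = -1"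
  proof -
    \<comment> \<open>For \<open>j = 0\<close> the product is empty and the pivot sign is
      \<open>\<epsilon> 0\<close> itself, so that case is treated apart.\<close>
    have "(\<Prod>k<j. \<delta> k) = \<epsilon> (j - 1)" if "0 < j"
      unfolding \<delta>_def using that less.prems \<epsilon> by (intro prod_pivot_sign) auto
    then show "\<delta> j = (\<Prod>k<j. \<delta> k) * \<epsilon> j" "(\<Prod>k<j. \<delta> k) = 1 \<or> (\<Prod>k<j. \<delta> k) = -1"
      using \<epsilon>[rule_format, of "j - 1"] less.prems by (cases "j = 0"; simp add: \<delta>_def pivot_sign_def)+
  qed
  ultimately have sg: "sgn (Re (p j)) = \<delta> j" by auto
  then have "Re (p j) \<noteq> 0" using \<delta>j by auto
  then have pos': "0 < \<delta> j * Re (p j)"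
    using abs_sgn[of "Re (p j)"] unfolding sg by (simp add: mult.commute)
  \<comment> \<open>The absolute value of the pivot.\<close>
  define q where "q = \<delta> j * Re (p j)"
  have q: "0 < q" "Re (\<delta> j * p j) = q" "p j = complex_of_real (\<delta> j * q)"
    using pos' \<delta>j real by (auto simp: q_def of_real_Re)
  have ci: "c j i = (A i j - (\<Sum>k<j. c k i * \<delta> k * cnj (c k j))) / (\<delta> j * sqrt q)" if "j \<le> i" for i
    unfolding c_def using that q(2) by (subst ldl_col.simps) (simp add: p_def c_def)
  have sq: "complex_of_real (sqrt q) * complex_of_real (sqrt q) = complex_of_real q"
    using q(1) by (simp flip: of_real_mult)
  have "c j j = p j / (\<delta> j * sqrt q)" using ci[of j] by (simp add: p_def)
  also have "\<dots> = complex_of_real (sqrt q)"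
    unfolding q(3) using \<delta>j sq q(1) by (auto simp: divide_simps)
  finally have cj: "c j j = complex_of_real (sqrt q)" .
  have "c j i * \<delta> j * cnj (c j j) = A i j - (\<Sum>k<j. c k i * \<delta> k * cnj (c k j))" if "j \<le> i" for i
    unfolding cj ci[OF that] using q(1) \<delta>j by (auto simp: divide_simps)
  then show ?case using real pos' cj by (simp add: q_def)
qed

text \<open>The columns computed by \<open>ldl_col\<close> form the factor. They stay in
  \<open>K\<close> because the recursion uses field operations, conjugation and square roots of
  positive reals in \<open>K\<close>.\<close>

lemma LPMn_ldl:
  assumes K: "conj_field K" and A: "A \<in> LPMn n K \<epsilon>" and \<epsilon>: "\<And>k. k < n \<Longrightarrow> \<epsilon> k = 1 \<or> \<epsilon> k = -1"
  shows "\<exists>L\<in>LT (Fin n) K. A = ldl (Fin n) L \<epsilon>"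
proof -
  define c where "c = ldl_col (pivot_sign \<epsilon>) A"
  \<comment> \<open>The recursion \<open>ldl_col\<close> knows nothing of the size \<open>n\<close>,
    whereas a matrix of size \<open>n\<close> has to vanish outside its block.\<close>
  define L where "L = (\<lambda>i k. if i < n \<and> k < n then c k i else 0)"
  have "\<forall>k<n. \<epsilon> k = 1 \<or> \<epsilon> k = -1" using \<epsilon> by blast
  note piv = LPMn_pivots[OF A this, folded c_def]
  have c_upper: "c k i = 0" if "i < k" for i k
    using that by (simp add: c_def ldl_col.simps)
  have AK: "A i j \<in> K" "i \<ge> n \<or> j \<ge> n \<Longrightarrow> A i j = 0" "cnj (A i j) = A j i" for i j
    using A by (auto simp: LPMn_def herm_def ctrans_def fun_eq_iff)
  have \<delta>: "pivot_sign \<epsilon> k = 1 \<or> pivot_sign \<epsilon> k = -1" if "k < n" for k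
    using \<epsilon>[of k] \<epsilon>[of "k - 1"] that by (auto simp: pivot_sign_def)
  have \<delta>K: "complex_of_real (pivot_sign \<epsilon> k) \<in> K" if "k < n" for k
    using \<delta>[OF that] field_closed[OF K] by auto
  have cK: "c j i \<in> K" if "j < n" for i j
    using that
  proof (induction j arbitrary: i rule: less_induct)
    case (less j)
    let ?S = "\<lambda>i. \<Sum>k<j. c k i * pivot_sign \<epsilon> k * cnj (c k j)"
    let ?q = "pivot_sign \<epsilon> j * Re (A j j - ?S j)"
    have S: "?S i \<in> K" for i
      using less by (intro field_closed[OF K] \<delta>K) auto
    have r: "A j j - ?S j \<in> \<real>" and q: "0 < ?q" using piv[OF less.prems] by auto
    have q': "complex_of_real ?q = pivot_sign \<epsilon> j * (A j j - ?S j)"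
      unfolding of_real_mult of_real_Re[OF r] ..
    have "complex_of_real (sqrt ?q) \<in> K"
    proof (rule field_sqrt[OF K q])
      show "complex_of_real ?q \<in> K"
        unfolding q' by (intro field_closed[OF K] \<delta>K less.prems AK S)
    qed
    moreover have "Re (pivot_sign \<epsilon> j * (A j j - ?S j)) = ?q" by simp
    moreover have "c j i = (if i < j then 0 else (A i j - ?S i) / (pivot_sign \<epsilon> j * sqrt (Re
        (pivot_sign \<epsilon> j * (A j j - ?S j)))))"
      unfolding c_def by (subst ldl_col.simps) simp
    ultimately show ?case
      using S[of i] AK(1)[of i j] \<delta>K[OF less.prems] field_closed[OF K]
          by (simp only: split: if_split) simp
  qed
  have low: "L \<in> lower_tri (Fin n) K"
    unfolding lower_tri_def using cK c_upper field_0[OF K] piv by (auto simp: L_def)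
  have tri: "A i j = ldl (Fin n) L \<epsilon> i j" if "j \<le> i" for i j
  proof (cases "i < n")
    case True
    have "ldl (Fin n) L \<epsilon> i j = (\<Sum>k<Suc j. c k i * pivot_sign \<epsilon> k * cnj (c k j))"
      using True that by (subst ldl_entry[OF low lessI]) (auto simp: L_def sign_diag_diag intro!:
          sum.cong)
    also have "\<dots> = A i j"
      by (simp only: sum.lessThan_Suc piv[OF le_less_trans[OF that True], THEN conjunct2,
          THEN conjunct2, THEN conjunct2, rule_format, OF that]) simp
    finally show ?thesis by simp
  next
    case False
    then show ?thesis using AK(2)[of i j] by (subst ldl_entry[OF low lessI]) (simp add: L_def)
  qed
  have "A i j = ldl (Fin n) L \<epsilon> i j" for i j
  proof (cases "j \<le> i")
    case False
    then have "A j i = ldl (Fin n) L \<epsilon> j i" by (intro tri) simp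
    then show ?thesis using AK(3)[of j i] ldl_hermitian[OF low, of \<epsilon> j i] by simp
  qed (rule tri)
  then have "A = ldl (Fin n) L \<epsilon>" by (intro ext)
  then show ?thesis using low by (intro bexI[of _ L]) simp_all
qed


section \<open>The cones of the three shapes\<close>

lemma LPM_Fin:
  assumes K: "conj_field K" and \<epsilon>: "\<epsilon> \<in> signs (Fin n)"
  shows "LPM (Fin n) K \<epsilon> = {ldl (Fin n) L \<epsilon> |L. L \<in> LT (Fin n) K}"
proof -
  have "\<And>k. k < n \<Longrightarrow> \<epsilon> k = 1 \<or> \<epsilon> k = -1" using signs_cases[OF \<epsilon>] by simp
  then show ?thesis
    using ldl_LPMn[OF K, of _ n \<epsilon>] LPMn_ldl[OF K, of _ n \<epsilon>] unfolding LPM.simps by blast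
qed

lemma LPM_Finitary:
  assumes K: "conj_field K" and \<epsilon>: "\<epsilon> \<in> signs Finitary"
  shows "LPM Finitary K \<epsilon> = {ldl Finitary L \<epsilon> |L. L \<in> LT Finitary K}"
proof (intro subset_antisym subsetI)
  have \<epsilon>': "\<And>k. k < m \<Longrightarrow> \<epsilon> k = 1 \<or> \<epsilon> k = -1" for m using signs_cases[OF \<epsilon>] by simp
  {
    \<comment> \<open>If \<open>L'\<close> is \<open>L\<close> bordered by the identity, then the
      product formed from \<open>L'\<close> is the one formed from \<open>L\<close> bordered by the
      sign matrix. This serves both inclusions: to extend a finite factor and to cut a semi-infinite
      one.\<close>
    fix m :: nat and L L' :: cmat
    assume m: "1 \<le> m" and L: "L \<in> LT (Fin m) K" and L': "L' \<in> LT Finitary K"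
      and agree: "\<And>i j. i < m \<Longrightarrow> j < m \<Longrightarrow> L' i j = L i j"
      and off: "\<And>i j. i \<ge> m \<or> j \<ge> m \<Longrightarrow> L' i j = (if i = j then 1 else 0)"
    have "ldl Finitary L' \<epsilon> i j = (if i < m \<and> j < m then ldl (Fin m) L \<epsilon> i j
      else if i = j then complex_of_real (\<epsilon> (i - 1) * \<epsilon> i) else 0)" for i j
    proof (cases "i < m \<and> j < m")
      case True
      then show ?thesis
        by (simp add: ldl_entry[OF LT_lower[OF L'], of j m] ldl_entry[OF LT_lower[OF L], of j m] agree
            sign_diag_diag)
    next
      case False
      \<comment> \<open>The bound exceeds both indices, so the only index that can survive is within
        range.\<close>
      have "ldl Finitary L' \<epsilon> i j = (\<Sum>k<Suc (i + j). L' i k * sign_diag Finitary \<epsilon> k k * cnj (L' j k))"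
        by (rule ldl_entry[OF LT_lower[OF L']]) simp
      also have "\<dots> = (\<Sum>k<Suc (i + j). if k = i \<and> i = j then sign_diag Finitary \<epsilon> i i else 0)"
      proof (rule sum.cong[OF refl])
        fix k
        show "L' i k * sign_diag Finitary \<epsilon> k k * cnj (L' j k) = (if k = i \<and> i =
            j then sign_diag Finitary \<epsilon> i i else 0)"
          using False off[of i k] off[of j k] off[of i j]
              by (cases "i < m"; cases "j < m") (auto split: if_splits)
      qed
      also have "\<dots> = (if i = j then complex_of_real (\<epsilon> (i - 1) * \<epsilon> i) else 0)"
        \<comment> \<open>As \<open>m\<close> is at least 1, a diagonal index outside the block is
          positive and has a predecessor in the sign sequence.\<close>
        using False m by (cases i) (auto simp: sign_diag_def)
      finally show ?thesis unfolding if_not_P[OF False] .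
    qed
  } note block = this
  {
    fix B assume "B \<in> LPM Finitary K \<epsilon>"
    then obtain m A where m: "1 \<le> m" and A: "A \<in> LPMn m K \<epsilon>"
      and B: "B = (\<lambda>i j. if i < m \<and> j < m then A i j
                     else if i = j then complex_of_real (\<epsilon> (i - 1) * \<epsilon> i) else 0)" by auto
    obtain L where L: "L \<in> LT (Fin m) K" "A = ldl (Fin m) L \<epsilon>" using LPMn_ldl[OF K A \<epsilon>'] by blast
    let ?L = "\<lambda>i j. if i < m \<and> j < m then L i j else if i = j then 1 else 0"
    have "{j. ?L j j \<noteq> 1} \<subseteq> {..<m}" "{(i, j). j < i \<and> ?L i j \<noteq> 0} \<subseteq> {..<m} \<times> {..<m}"
      by (auto split: if_splits)
    then have "finite {j. ?L j j \<noteq> 1}" "finite {(i, j). j < i \<and> ?L i j \<noteq> 0}"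
      by (rule_tac [!] finite_subset) (assumption, simp)+
    moreover have "?L \<in> lower_tri Finitary K"
      using L(1) field_closed[OF K] by (auto simp: lower_tri_def)
    ultimately have L': "?L \<in> LT Finitary K" by simp
    have "B = ldl Finitary ?L \<epsilon>"
    proof (intro ext)
      fix i j
      show "B i j = ldl Finitary ?L \<epsilon> i j"
        unfolding B L(2) by (subst block[OF m L(1) L']) auto
    qed
    then show "B \<in> {ldl Finitary L \<epsilon> |L. L \<in> LT Finitary K}" using L' by blast
  next
    fix B assume "B \<in> {ldl Finitary L \<epsilon> |L. L \<in> LT Finitary K}"
    then obtain L' where L': "L' \<in> LT Finitary K" "B = ldl Finitary L' \<epsilon>" by blast
    have "finite ({j. L' j j \<noteq> 1} \<union> fst ` {(i, j). j < i \<and> L' i j \<noteq> 0})"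
      using L' by auto
    then obtain m0 where m0: "\<And>i. i \<in> {j. L' j j \<noteq> 1} \<union> fst ` {(i, j). j < i \<and> L' i j \<noteq> 0} \<Longrightarrow> i < m0"
      unfolding finite_nat_set_iff_bounded by blast
    \<comment> \<open>From row \<open>m0\<close> on, \<open>L'\<close> agrees with the identity. The
      block has size \<open>Suc m0\<close> because the definition of the cone requires a nonempty
      block.\<close>
    let ?L = "\<lambda>i j. if i < Suc m0 \<and> j < Suc m0 then L' i j else 0"
    have off: "L' i j = (if i = j then 1 else 0)" if "i \<ge> Suc m0 \<or> j \<ge> Suc m0" for i j
    proof -
      consider "i < j" | "i = j" | "j < i" by force
      then show ?thesis
      proof cases
        case 1
        then show ?thesis using LT_upper[OF L'(1)] by simp
      next
        case 2
        then show ?thesis using m0[of j] that by force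
      next
        case 3
        then have "L' i j = 0" using m0[of i] that by force
        then show ?thesis using 3 by simp
      qed
    qed
    have L: "?L \<in> LT (Fin (Suc m0)) K"
      using LT_lower[OF L'(1)] field_0[OF K] by (auto simp: lower_tri_def)
    have "B = (\<lambda>i j. if i < Suc m0 \<and> j < Suc m0 then ldl (Fin (Suc m0)) ?L \<epsilon> i j
      else if i = j then complex_of_real (\<epsilon> (i - 1) * \<epsilon> i) else 0)"
      unfolding L'(2)
    proof (intro ext)
      fix i j
      show "ldl Finitary L' \<epsilon> i j = (if i < Suc m0 \<and> j < Suc m0 then ldl (Fin (Suc m0)) ?L \<epsilon> i j
        else if i = j then complex_of_real (\<epsilon> (i - 1) * \<epsilon> i) else 0)"
        by (rule block[OF _ L L'(1) _ off]) auto
    qed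
    moreover have "ldl (Fin (Suc m0)) ?L \<epsilon> \<in> LPMn (Suc m0) K \<epsilon>" by (rule ldl_LPMn[OF K L \<epsilon>'])
    ultimately show "B \<in> LPM Finitary K \<epsilon>"
      by (auto intro!: exI[of _ "Suc m0"])
  }
qed

lemma ldl_field:
  assumes K: "conj_field K" and L: "L \<in> LT s K" and \<epsilon>: "\<epsilon> \<in> signs s"
  shows "ldl s L \<epsilon> i j \<in> K"
proof -
  have "sign_diag s \<epsilon> k k \<in> K" for k
    using pivot_sign_cases[OF \<epsilon>, of k] field_closed[OF K]
    by (cases "k \<in> idx s") (auto simp: sign_diag_diag sign_diag_outside)
  then show ?thesis
    by (subst ldl_entry[OF LT_lower[OF L] lessI]) (intro field_closed[OF K] LT_field[OF L], auto)
qed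

text \<open>For the Hilbert shape the definition provides a factor over \<open>F\<close>. Each
  column is a quotient formed from entries of the Hermitian product and from earlier columns, so
  induction over the columns places it in \<open>conj_core F\<close>.\<close>

lemma ldl_factor_field:
  assumes F: "is_subfield F"
    and sq: "\<forall>x::real. 0 < x \<and> complex_of_real x \<in> F \<longrightarrow> complex_of_real (sqrt x) \<in> F"
    and L: "L \<in> LT s F" and \<epsilon>: "\<epsilon> \<in> signs s" and A: "\<And>i j. ldl s L \<epsilon> i j \<in> F"
  shows "L \<in> LT s (conj_core F)"
proof -
  note K = conj_field_conj_core[OF F sq]
  have AK: "ldl s L \<epsilon> i j \<in> conj_core F" for i j
    using A ldl_hermitian[OF LT_lower[OF L]] by (simp add: conj_core_def)
  have D: "sign_diag s \<epsilon> k k \<in> conj_core F" for k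
    using pivot_sign_cases[OF \<epsilon>, of k] field_closed[OF K]
    by (cases "k \<in> idx s") (auto simp: sign_diag_diag sign_diag_outside)
  have "L i j \<in> conj_core F" for i j
  proof (induction j arbitrary: i rule: less_induct)
    case (less j)
    show ?case
    proof (cases "j \<in> idx s")
      case True
      have "L j j \<in> \<real>" using LT_diag[OF L True] by (metis Reals_of_real)
      then have Lj: "L j j \<in> conj_core F" using LT_field[OF L]
          by (simp add: conj_core_def Reals_cnj_iff)
      have ne: "L j j \<noteq> 0" "sign_diag s \<epsilon> j j \<noteq> 0"
        using LT_diag_nonzero[OF L True] pivot_sign_cases[OF \<epsilon> True] by (auto simp: sign_diag_diag True)
      have "ldl s L \<epsilon> i j = (\<Sum>k<j. L i k * sign_diag s \<epsilon> k k * cnj (L j k)) +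
          L i j * sign_diag s \<epsilon> j j * cnj (L j j)"
        by (subst ldl_entry[OF LT_lower[OF L] lessI]) simp
      then have "L i j = (ldl s L \<epsilon> i j - (\<Sum>k<j. L i k * sign_diag s \<epsilon> k k * cnj (L j k))) /
          (sign_diag s \<epsilon> j j * cnj (L j j))"
        using ne by simp
      also have "\<dots> \<in> conj_core F"
        using less by (intro field_closed[OF K] AK D Lj) auto
      finally show ?thesis .
    qed (use LT_outside[OF L] field_0[OF K] in auto)
  qed
  then show ?thesis by (rule LT_subfield[OF L])
qed

text \<open>The conjugate of an entry of a Hermitian matrix is again one of its entries.\<close>

lemma LPMn_conj_core: "LPMn n F \<epsilon> = LPMn n (conj_core F) \<epsilon>"
  by (auto simp: LPMn_def herm_def conj_core_def ctrans_def fun_eq_iff)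

text \<open>Brings the three differently shaped definitions into one form. For the first two shapes
  \<open>F\<close> is exchanged for \<open>conj_core F\<close> before factoring; for the third the
  given factor is shown to lie over the smaller field.\<close>

lemma LPM_eq:
  assumes F: "is_subfield F"
    and sq: "\<forall>x::real. 0 < x \<and> complex_of_real x \<in> F \<longrightarrow> complex_of_real (sqrt x) \<in> F"
    and \<epsilon>: "\<epsilon> \<in> signs s"
  shows "LPM s F \<epsilon> = {ldl s L \<epsilon> |L. L \<in> LT s (conj_core F)}"
proof -
  note K = conj_field_conj_core[OF F sq]
  show ?thesis
  proof (cases s)
    case (Fin n)
    have "LPM (Fin n) F \<epsilon> = LPM (Fin n) (conj_core F) \<epsilon>"
      unfolding LPM.simps by (rule LPMn_conj_core)
    with LPM_Fin[OF K \<epsilon>[unfolded Fin]] show ?thesis by (simp only: Fin)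
  next
    case Finitary
    have "LPM Finitary F \<epsilon> = LPM Finitary (conj_core F) \<epsilon>"
      unfolding LPM.simps using LPMn_conj_core[of _ F \<epsilon>] by simp
    with LPM_Finitary[OF K \<epsilon>[unfolded Finitary]] show ?thesis by (simp only: Finitary)
  next
    case Hilbert
    have sub: "conj_core F \<subseteq> F" by (auto simp: conj_core_def)
    note \<epsilon>H = \<epsilon>[unfolded Hilbert]
    show ?thesis unfolding Hilbert
    proof (intro subset_antisym subsetI)
      fix B assume "B \<in> LPM Hilbert F \<epsilon>"
      then have B: "\<And>i j. B i j \<in> F" "\<exists>L\<in>LT Hilbert F. B = ldl Hilbert L \<epsilon>"
        unfolding LPM.simps by blast+
      then obtain L where L: "L \<in> LT Hilbert F" "B = ldl Hilbert L \<epsilon>" by blast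
      have "L \<in> LT Hilbert (conj_core F)"
        by (rule ldl_factor_field[OF F sq L(1) \<epsilon>H]) (use B(1) L(2) in simp)
      then show "B \<in> {ldl Hilbert L \<epsilon> |L. L \<in> LT Hilbert (conj_core F)}"
        using L(2) by blast
    next
      fix B assume "B \<in> {ldl Hilbert L \<epsilon> |L. L \<in> LT Hilbert (conj_core F)}"
      then obtain L where L: "L \<in> LT Hilbert (conj_core F)" "B = ldl Hilbert L \<epsilon>" by blast
      have "B i j \<in> F" for i j unfolding L(2) using ldl_field[OF K L(1) \<epsilon>H] sub by blast
      moreover have "L \<in> LT Hilbert F" by (rule LT_mono[OF sub L(1)])
      ultimately show "B \<in> LPM Hilbert F \<epsilon>" unfolding LPM.simps using L(2) by blast
    qed
  qed
qed

lemma LPM_all_eq: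
  assumes "is_subfield F"
    and "\<forall>x::real. 0 < x \<and> complex_of_real x \<in> F \<longrightarrow> complex_of_real (sqrt x) \<in> F"
  shows "LPM_all s F = {ldl s L \<epsilon> |L \<epsilon>. L \<in> LT s (conj_core F) \<and> \<epsilon> \<in> signs s}"
  unfolding LPM_all_def using LPM_eq[OF assms] by blast

section \<open>Recovering factor and signs\<close>

context
  fixes F :: "complex set" and s :: shape
  assumes F: "is_subfield F"
    and sq: "\<forall>x::real. 0 < x \<and> complex_of_real x \<in> F \<longrightarrow> complex_of_real (sqrt x) \<in> F"
begin

lemma LT_core: "L \<in> LT s (conj_core F) \<Longrightarrow> L \<in> LT s F"
  by (rule LT_mono[of "conj_core F"]) (auto simp: conj_core_def)

text \<open>The theorem speaks of factors over \<open>F\<close>. If such a product lies in the cone,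
  it also has a factor over the smaller field, and uniqueness identifies the two.\<close>

lemma LT_core_of_ldl:
  assumes "L \<in> LT s F" "\<epsilon> \<in> signs s" "ldl s L \<epsilon> \<in> LPM_all s F"
  shows "L \<in> LT s (conj_core F)"
proof -
  obtain L' \<epsilon>' where *: "L' \<in> LT s (conj_core F)" "\<epsilon>' \<in> signs s" "ldl s L \<epsilon> = ldl s L' \<epsilon>'"
    using assms(3) unfolding LPM_all_eq[OF F sq] by blast
  then show ?thesis using ldl_unique[OF assms(1) *(1) assms(2) *(2,3)] by simp
qed

lemma lpm_sign_ldl:
  assumes L: "L \<in> LT s (conj_core F)" and \<epsilon>: "\<epsilon> \<in> signs s"
  shows "lpm_sign s F (ldl s L \<epsilon>) = \<epsilon>"
  unfolding lpm_sign_def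
proof (rule the_equality)
  show "\<epsilon> \<in> signs s \<and> ldl s L \<epsilon> \<in> LPM s F \<epsilon>" using assms unfolding LPM_eq[OF F sq \<epsilon>] by blast
  fix \<epsilon>' assume "\<epsilon>' \<in> signs s \<and> ldl s L \<epsilon> \<in> LPM s F \<epsilon>'"
  then obtain L' where *: "\<epsilon>' \<in> signs s" "L' \<in> LT s (conj_core F)" "ldl s L \<epsilon> = ldl s L' \<epsilon>'"
    using LPM_eq[OF F sq, of \<epsilon>' s] by blast
  show "\<epsilon>' = \<epsilon>" using ldl_unique[OF L *(2) \<epsilon> *(1,3)] by simp
qed

lemma ldl_factor_ldl:
  assumes L: "L \<in> LT s (conj_core F)" and \<epsilon>: "\<epsilon> \<in> signs s"
  shows "ldl_factor s F \<epsilon> (ldl s L \<epsilon>) = L"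
  unfolding ldl_factor_def
proof (rule the_equality)
  fix L' assume *: "L' \<in> LT s F \<and> ldl s L \<epsilon> = ldl s L' \<epsilon>"
  show "L' = L" using ldl_unique[OF L conjunct1[OF *] \<epsilon> \<epsilon> conjunct2[OF *]] by simp
qed (simp add: LT_core[OF L])

lemma lpm_chol_ldl:
  assumes "L \<in> LT s (conj_core F)" "\<epsilon> \<in> signs s"
  shows "lpm_chol s F (ldl s L \<epsilon>) = L"
  unfolding lpm_chol_def lpm_sign_ldl[OF assms] by (rule ldl_factor_ldl[OF assms])

text \<open>\<open>pd_chol\<close> is specified by products without a sign matrix; since the sign
  matrix of the constant sequence is the identity, uniqueness of the signed factorization
  applies.\<close>

lemma pd_chol_ldl:
  assumes L: "L \<in> LT s (conj_core F)"
  shows "pd_chol s F (ldl s L \<one>\<^bsub>sign_group s\<^esub>) = L"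
proof -
  have eq: "L \<star> ctrans L = ldl s L \<one>\<^bsub>sign_group s\<^esub>" if "L \<in> LT s F" for L
  proof -
    have "L \<star> sign_diag s \<one>\<^bsub>sign_group s\<^esub> = L"
      by (intro ext, subst mmul_sign_diag) (use LT_outside[OF that]
          in \<open>auto simp: sign_diag_one idmat_def\<close>)
    then show ?thesis by (simp add: ldl_def)
  qed
  show ?thesis unfolding pd_chol_def
  proof (rule the_equality)
    show "L \<in> LT s F \<and> ldl s L \<one>\<^bsub>sign_group s\<^esub> = L \<star> ctrans L"
      using eq[OF LT_core[OF L]] LT_core[OF L] by simp
    fix L' assume *: "L' \<in> LT s F \<and> ldl s L \<one>\<^bsub>sign_group s\<^esub> = L' \<star> ctrans L'"
    have "ldl s L \<one>\<^bsub>sign_group s\<^esub> = ldl s L' \<one>\<^bsub>sign_group s\<^esub>"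
      using conjunct2[OF *] unfolding eq[OF conjunct1[OF *]] .
    then show "L' = L"
      using ldl_unique[OF L conjunct1[OF *] sign_one_signs sign_one_signs] by blast
  qed
qed

end

section \<open>Reversal and trailing minors\<close>

lemma antidiag_left: "(antidiag n \<star> A) i j = (if i < n then A (n - 1 - i) j else 0)"
proof (cases "i < n")
  case True
  then show ?thesis by (subst mmul_finite[of "{n - 1 - i}"]) (auto simp: antidiag_def)
qed (subst mmul_finite[of "{}"], auto simp: antidiag_def)

lemma antidiag_right: "(A \<star> antidiag n) i j = (if j < n then A i (n - 1 - j) else 0)"
proof (cases "j < n")
  case True
  then show ?thesis by (subst mmul_finite[of "{n - 1 - j}"]) (auto simp: antidiag_def)
qed (subst mmul_finite[of "{}"], auto simp: antidiag_def)

text \<open>Up to conjugation, reversal reflects in the antidiagonal. Hence it keeps the positions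
  on and below the diagonal and maps lower triangular matrices to such.\<close>

lemma reversal_entry:
  "reversal n A i j = (if i < n \<and> j < n then cnj (A (n - 1 - j) (n - 1 - i)) else 0)"
  by (simp add: reversal_def ctrans_def antidiag_left antidiag_right)

lemma reversal_reversal:
  "(\<And>i j. i \<ge> n \<or> j \<ge> n \<Longrightarrow> A i j = 0) \<Longrightarrow> reversal n (reversal n A) = A"
  by (auto simp: fun_eq_iff reversal_entry)

lemma reversal_LT:
  assumes K: "conj_field K" and L: "L \<in> LT (Fin n) K"
  shows "reversal n L \<in> LT (Fin n) K"
  using LT_lower[OF L] field_closed[OF K]
  by (auto simp: lower_tri_def reversal_entry elim!: Reals_cases)

lemma reversal_reversal_LT: "L \<in> LT (Fin n) K \<Longrightarrow> reversal n (reversal n L) = L"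
  using LT_outside[of L "Fin n" K] by (intro reversal_reversal) auto

lemma tldl_entry:
  assumes "L \<in> LT (Fin n) K"
  shows "tldl n L \<epsilon> i j =
    (\<Sum>k<n. cnj (L k i) * sign_diag (Fin n) \<epsilon> (n - 1 - k) (n - 1 - k) * L k j)"
  unfolding tldl_def using LT_outside[OF assms]
  by (subst mmul_finite[of "{..<n}"]) (auto simp: antidiag_right mmul_sign_diag ctrans_def)

text \<open>With \<open>R = P L\<^sup>* P\<close> one has
  \<open>P R D R\<^sup>* P = L\<^sup>* P D P L\<close>. All facts about trailing factorizations are
  derived from this identity.\<close>

lemma tldl_reversal:
  assumes L: "L \<in> LT (Fin n) K"
  shows "tldl n L \<epsilon> = reversal n (ldl (Fin n) (reversal n L) \<epsilon>)"
proof (intro ext)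
  fix i j
  have low: "reversal n L \<in> lower_tri (Fin n) UNIV"
    by (rule LT_lower[OF reversal_LT[OF conj_field_UNIV LT_UNIV[OF L]]])
  show "tldl n L \<epsilon> i j = reversal n (ldl (Fin n) (reversal n L) \<epsilon>) i j"
  proof (cases "i < n \<and> j < n")
    case True
    then have "reversal n (ldl (Fin n) (reversal n L) \<epsilon>) i j =
        (\<Sum>k<n. L (n - Suc k) j * sign_diag (Fin n) \<epsilon> k k * cnj (L (n - Suc k) i))"
      by (simp add: reversal_entry ldl_entry[OF low, of "n - Suc i" n] cnj_sign_diag)
    \<comment> \<open>Summing over \<open>n - 1 - k\<close> in place of \<open>k\<close> moves the
      reversal from the factor to the sign matrix.\<close>
    also have "\<dots> = (\<Sum>k<n. L (n - Suc (n - Suc k)) j * sign_diag (Fin n) \<epsilon> (n - Suc k) (n - Suc k) *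
        cnj (L (n - Suc (n - Suc k)) i))"
      by (rule sum.nat_diff_reindex[symmetric])
    also have "\<dots> = (\<Sum>k<n. cnj (L k i) * sign_diag (Fin n) \<epsilon> (n - 1 - k) (n - 1 - k) * L k j)"
      by (rule sum.cong) auto
    finally show ?thesis by (simp add: tldl_entry[OF L])
  next
    case False
    then have "L k i = 0 \<or> L k j = 0" for k using LT_outside[OF L] by auto
    then have "tldl n L \<epsilon> i j = 0" unfolding tldl_entry[OF L] by (intro sum.neutral) auto
    then show ?thesis using False by (auto simp: reversal_entry)
  qed
qed

lemma ldl_support:
  assumes "L \<in> LT (Fin n) K" "i \<ge> n \<or> j \<ge> n"
  shows "ldl (Fin n) L \<epsilon> i j = 0"
  by (subst ldl_entry[OF LT_lower[OF assms(1)] lessI]) (use assms(2) LT_outside[OF assms(1)] in auto)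

lemma tldl_unique:
  assumes L: "L \<in> LT (Fin n) F" and L': "L' \<in> LT (Fin n) F'"
    and \<epsilon>: "\<epsilon> \<in> signs (Fin n)" and \<epsilon>': "\<epsilon>' \<in> signs (Fin n)" and eq: "tldl n L \<epsilon> = tldl n L' \<epsilon>'"
  shows "L = L' \<and> \<epsilon> = \<epsilon>'"
proof -
  have R: "reversal n L \<in> LT (Fin n) UNIV" "reversal n L' \<in> LT (Fin n) UNIV"
    using reversal_LT[OF conj_field_UNIV LT_UNIV] L L' by blast+
  have "reversal n (tldl n L \<epsilon>) = ldl (Fin n) (reversal n L) \<epsilon>"
    unfolding tldl_reversal[OF L] by (rule reversal_reversal) (rule ldl_support[OF R(1)])
  moreover have "reversal n (tldl n L' \<epsilon>') = ldl (Fin n) (reversal n L') \<epsilon>'"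
    unfolding tldl_reversal[OF L'] by (rule reversal_reversal) (rule ldl_support[OF R(2)])
  ultimately have "reversal n L = reversal n L' \<and> \<epsilon> = \<epsilon>'"
    using eq by (intro ldl_unique[OF R \<epsilon> \<epsilon>']) simp
  then show ?thesis using reversal_reversal_LT[OF L] reversal_reversal_LT[OF L'] by metis
qed

text \<open>The matrix is conjugated by the antidiagonal permutation, whose determinant enters
  squared and therefore as 1, whatever its sign.\<close>

lemma det_reverse:
  fixes f :: "nat \<Rightarrow> nat \<Rightarrow> complex"
  shows "Determinant.det (Matrix.mat k k (\<lambda>(i, j). f (k - 1 - i) (k - 1 - j))) =
    Determinant.det (Matrix.mat k k (\<lambda>(i, j). f i j))"
proof -
  define P :: "complex mat" where "P = Matrix.mat k k (\<lambda>(i, j). if j = k - 1 - i then 1 else 0)"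
  define M where "M = Matrix.mat k k (\<lambda>(i, j). f i j)"
  have c: "P \<in> carrier_mat k k" "M \<in> carrier_mat k k" by (auto simp: P_def M_def)
  have P': "P = Matrix.mat k k (\<lambda>(i, j). if i = k - 1 - j then 1 else 0)"
    unfolding P_def by (rule eq_matI) auto
  have "P * P = 1\<^sub>m k"
    by (rule eq_matI) (auto simp: P_def scalar_prod_def if_distrib[of "\<lambda>x. x * _"] cong: if_cong)
  then have PP: "Determinant.det P * Determinant.det P = 1"
    using c by (metis Determinant.det_mult det_one)
  have "P * M = Matrix.mat k k (\<lambda>(i, j). f (k - 1 - i) j)"
    by (rule eq_matI) (auto simp: P_def M_def scalar_prod_def if_distrib[of "\<lambda>x. x * _"] cong: if_cong)
  then have "P * M * P = Matrix.mat k k (\<lambda>(i, j). f (k - 1 - i) (k - 1 - j))"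
    by (intro eq_matI) (auto simp: P' scalar_prod_def if_distrib[of "\<lambda>x. _ * x"] cong: if_cong)
  then have "Determinant.det (Matrix.mat k k (\<lambda>(i, j). f (k - 1 - i) (k - 1 - j))) =
      Determinant.det P * Determinant.det M * Determinant.det P"
    using c by (metis Determinant.det_mult mult_carrier_mat)
  also have "\<dots> = Determinant.det M" using PP by (simp add: mult_ac)
  finally show ?thesis by (simp add: M_def)
qed

lemma reversal_herm:
  assumes "A \<in> herm n F"
  shows "reversal n A \<in> herm n F" "i < n \<Longrightarrow> j < n \<Longrightarrow> reversal n A i j = A (n - 1 - i) (n - 1 - j)"
    "reversal n (reversal n A) = A"
proof -
  have A: "A i j \<in> F" "i \<ge> n \<or> j \<ge> n \<Longrightarrow> A i j = 0" "cnj (A i j) = A j i" for i j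
    using assms by (auto simp: herm_def ctrans_def fun_eq_iff)
  show "reversal n (reversal n A) = A" using A by (intro reversal_reversal) auto
  show "i < n \<Longrightarrow> j < n \<Longrightarrow> reversal n A i j = A (n - 1 - i) (n - 1 - j)"
    using A by (simp add: reversal_entry)
  have "0 \<in> F" using A(1)[of n n] A(2)[of n n] by simp
  then show "reversal n A \<in> herm n F"
    using A by (auto simp: herm_def reversal_entry ctrans_def fun_eq_iff)
qed

lemma trailing_minor_reversal:
  assumes A: "A \<in> herm n F" and k: "k \<le> n"
  shows "trailing_minor n k A = leading_minor k (reversal n A)"
proof -
  \<comment> \<open>The reversed index \<open>n - 1 - i\<close> is written with the offset
    \<open>n - k\<close> of the trailing block, which reduces the claim to reversing a block of size
    \<open>k\<close>.\<close>
  have "leading_minor k (reversal n A) =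
      Determinant.det (Matrix.mat k k (\<lambda>(i, j). A (n - k + (k - 1 - i)) (n - k + (k - 1 - j))))"
    unfolding leading_minor_def using k reversal_herm(2)[OF A]
    by (intro arg_cong[where f = Determinant.det] eq_matI) auto
  also have "\<dots> = trailing_minor n k A"
    unfolding trailing_minor_def by (rule det_reverse[of k "\<lambda>i j. A (n - k + i) (n - k + j)"])
  finally show ?thesis by simp
qed

text \<open>Reversal is an involution on Hermitian matrices that exchanges trailing and leading
  minors of the same order.\<close>

lemma TPM_reversal: "TPM n F \<epsilon> = reversal n ` LPMn n F \<epsilon>"
proof (intro subset_antisym subsetI)
  fix A assume "A \<in> TPM n F \<epsilon>"
  then have A: "A \<in> herm n F" "\<And>k. k \<in> {1..n} \<Longrightarrow> sgn (trailing_minor n k A) =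
      complex_of_real (\<epsilon> (k - 1))"
    by (auto simp: TPM_def)
  have "reversal n A \<in> LPMn n F \<epsilon>"
    using A(2) reversal_herm(1)[OF A(1)] trailing_minor_reversal[OF A(1)] by (auto simp: LPMn_def)
  then show "A \<in> reversal n ` LPMn n F \<epsilon>" using reversal_herm(3)[OF A(1)] by force
next
  fix A assume "A \<in> reversal n ` LPMn n F \<epsilon>"
  then obtain B where B: "B \<in> herm n F" "A = reversal n B"
    "\<And>k. k \<in> {1..n} \<Longrightarrow> sgn (leading_minor k B) = complex_of_real (\<epsilon> (k - 1))"
    by (auto simp: LPMn_def)
  have A: "A \<in> herm n F" "reversal n A = B" using reversal_herm[OF B(1)] B(2) by auto
  then show "A \<in> TPM n F \<epsilon>"
    using B(3) trailing_minor_reversal[OF A(1)] by (auto simp: TPM_def)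
qed

lemma TPM_eq:
  assumes F: "is_subfield F"
    and sq: "\<forall>x::real. 0 < x \<and> complex_of_real x \<in> F \<longrightarrow> complex_of_real (sqrt x) \<in> F"
    and \<epsilon>: "\<epsilon> \<in> signs (Fin n)"
  shows "TPM n F \<epsilon> = {tldl n L \<epsilon> |L. L \<in> LT (Fin n) (conj_core F)}"
proof -
  note K = conj_field_conj_core[OF F sq]
  have LPM: "LPMn n F \<epsilon> = {ldl (Fin n) L \<epsilon> |L. L \<in> LT (Fin n) (conj_core F)}"
    using LPM_eq[OF F sq \<epsilon>] unfolding LPM.simps .
  show ?thesis unfolding TPM_reversal LPM
  proof (intro subset_antisym subsetI)
    fix A assume "A \<in> reversal n ` {ldl (Fin n) L \<epsilon> |L. L \<in> LT (Fin n) (conj_core F)}"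
    then obtain L where L: "L \<in> LT (Fin n) (conj_core F)" "A = reversal n (ldl (Fin n) L \<epsilon>)" by blast
    have "A = tldl n (reversal n L) \<epsilon>"
      unfolding tldl_reversal[OF reversal_LT[OF K L(1)]] reversal_reversal_LT[OF L(1)] by (rule L(2))
    then show "A \<in> {tldl n L \<epsilon> |L. L \<in> LT (Fin n) (conj_core F)}"
      using reversal_LT[OF K L(1)] by blast
  next
    fix A assume "A \<in> {tldl n L \<epsilon> |L. L \<in> LT (Fin n) (conj_core F)}"
    then obtain L where L: "L \<in> LT (Fin n) (conj_core F)" "A = tldl n L \<epsilon>" by blast
    show "A \<in> reversal n ` {ldl (Fin n) L \<epsilon> |L. L \<in> LT (Fin n) (conj_core F)}"
      unfolding L(2) tldl_reversal[OF L(1)] using reversal_LT[OF K L(1)] by blast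
  qed
qed

lemma tldl_idmat: "tldl n (idmat (Fin n)) \<one>\<^bsub>sign_group (Fin n)\<^esub> = idmat (Fin n)"
proof (intro ext)
  fix i j
  have "idmat (Fin n) \<in> LT (Fin n) UNIV" by (rule idmat_closed[OF conj_field_UNIV])
  from tldl_entry[OF this, of "\<one>\<^bsub>sign_group (Fin n)\<^esub>" i j] have "tldl n (idmat (Fin n)) \<one>\<^bsub>sign_group
      (Fin n)\<^esub> i j =
      (\<Sum>k<n. cnj (idmat (Fin n) k i) * idmat (Fin n) (n - 1 - k) (n - 1 - k) * idmat (Fin n) k j)"
    unfolding sign_diag_one .
  also have "\<dots> = (\<Sum>k<n. if k = i then idmat (Fin n) i j else 0)"
    by (rule sum.cong) (auto simp: idmat_def)
  also have "\<dots> = idmat (Fin n) i j" by (simp add: idmat_def)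
  finally show "tldl n (idmat (Fin n)) \<one>\<^bsub>sign_group (Fin n)\<^esub> i j = idmat (Fin n) i j" .
qed

section \<open>The groups\<close>

context
  fixes F :: "complex set"
  assumes F: "is_subfield F"
    and sq: "\<forall>x::real. 0 < x \<and> complex_of_real x \<in> F \<longrightarrow> complex_of_real (sqrt x) \<in> F"
begin

lemma TPM_all_eq:
  "TPM_all n F = {tldl n L \<epsilon> |L \<epsilon>. L \<in> LT (Fin n) (conj_core F) \<and> \<epsilon> \<in> signs (Fin n)}"
  unfolding TPM_all_def using TPM_eq[OF F sq] by blast

lemma tpm_sign_tldl:
  assumes L: "L \<in> LT (Fin n) (conj_core F)" and \<epsilon>: "\<epsilon> \<in> signs (Fin n)"
  shows "tpm_sign n F (tldl n L \<epsilon>) = \<epsilon>"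
  unfolding tpm_sign_def
proof (rule the_equality)
  show "\<epsilon> \<in> signs (Fin n) \<and> tldl n L \<epsilon> \<in> TPM n F \<epsilon>"
    using assms unfolding TPM_eq[OF F sq \<epsilon>] by blast
  fix \<epsilon>' assume "\<epsilon>' \<in> signs (Fin n) \<and> tldl n L \<epsilon> \<in> TPM n F \<epsilon>'"
  then obtain L' where *: "\<epsilon>' \<in> signs (Fin n)" "L' \<in> LT (Fin n) (conj_core F)" "tldl n L \<epsilon> =
      tldl n L' \<epsilon>'"
    using TPM_eq[OF F sq, of \<epsilon>' n] by blast
  show "\<epsilon>' = \<epsilon>" using tldl_unique[OF L *(2) \<epsilon> *(1,3)] by simp
qed

lemma tpm_chol_tldl:
  assumes L: "L \<in> LT (Fin n) (conj_core F)" and \<epsilon>: "\<epsilon> \<in> signs (Fin n)"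
  shows "tpm_chol n F (tldl n L \<epsilon>) = L"
  unfolding tpm_chol_def tpm_sign_tldl[OF assms]
proof (rule the_equality)
  fix L' assume *: "L' \<in> LT (Fin n) F \<and> tldl n L \<epsilon> = tldl n L' \<epsilon>"
  show "L' = L" using tldl_unique[OF L conjunct1[OF *] \<epsilon> \<epsilon> conjunct2[OF *]] by simp
qed (simp only: LT_core[OF F sq L] simp_thms)

lemma LT_core_of_tldl:
  assumes "L \<in> LT (Fin n) F" "\<epsilon> \<in> signs (Fin n)" "tldl n L \<epsilon> \<in> TPM_all n F"
  shows "L \<in> LT (Fin n) (conj_core F)"
proof -
  obtain L' \<epsilon>' where *: "L' \<in> LT (Fin n) (conj_core F)" "\<epsilon>' \<in> signs (Fin n)" "tldl n L \<epsilon> = tldl n L' \<epsilon>'"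
    using assms(3) unfolding TPM_all_eq by blast
  then show ?thesis using tldl_unique[OF assms(1) *(1) assms(2) *(2,3)] by simp
qed

lemma cone_chart_LPM:
  "cone_chart s (conj_core F) (ldl s) (LPM_group s F) (lpm_chol s F) (lpm_sign s F)"
proof
  note K = conj_field_conj_core[OF F sq]
  show "conj_field (conj_core F)" by (rule K)
  show car: "carrier (LPM_group s F) = {ldl s L \<epsilon> |L \<epsilon>. L \<in> LT s (conj_core F) \<and> \<epsilon> \<in> signs s}"
    unfolding LPM_group_def by (simp add: LPM_all_eq[OF F sq])
  fix A B assume "A \<in> carrier (LPM_group s F)" "B \<in> carrier (LPM_group s F)"
  then have "lpm_sign s F A \<in> signs s" "lpm_sign s F B \<in> signs s"
    using lpm_sign_ldl[OF F sq] unfolding car by auto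
  then show "A \<otimes>\<^bsub>LPM_group s F\<^esub> B =
      ldl s (LT_mult (lpm_chol s F A) (lpm_chol s F B)) (lpm_sign s F A \<otimes>\<^bsub>sign_group s\<^esub> lpm_sign s F B)"
    by (simp add: LPM_group_def lpm_box_def Let_def sign_diag_mult ldl_def)
next
  show "\<one>\<^bsub>LPM_group s F\<^esub> = ldl s (idmat s) \<one>\<^bsub>sign_group s\<^esub>"
    by (simp add: LPM_group_def ldl_idmat sign_diag_one)
qed (rule lpm_chol_ldl[OF F sq] lpm_sign_ldl[OF F sq]; assumption)+

lemma cone_chart_TPM:
  "cone_chart (Fin n) (conj_core F) (tldl n) (TPM_group n F) (tpm_chol n F) (tpm_sign n F)"
proof
  note K = conj_field_conj_core[OF F sq]
  show "conj_field (conj_core F)" by (rule K)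
  show car: "carrier (TPM_group n F) =
      {tldl n L \<epsilon> |L \<epsilon>. L \<in> LT (Fin n) (conj_core F) \<and> \<epsilon> \<in> signs (Fin n)}"
    unfolding TPM_group_def by (simp only: TPM_all_eq partial_object.simps)
  fix A B assume "A \<in> carrier (TPM_group n F)" "B \<in> carrier (TPM_group n F)"
  then have "tpm_sign n F A \<in> signs (Fin n)" "tpm_sign n F B \<in> signs (Fin n)"
    using tpm_sign_tldl unfolding car by auto
  then show "A \<otimes>\<^bsub>TPM_group n F\<^esub> B =
      tldl n (LT_mult (tpm_chol n F A) (tpm_chol n F B)) (tpm_sign n F A \<otimes>\<^bsub>sign_group (Fin n)\<^esub>
          tpm_sign n F B)"
    by (simp add: TPM_group_def tpm_box_def Let_def sign_diag_mult tldl_def)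
next
  show "\<one>\<^bsub>TPM_group n F\<^esub> = tldl n (idmat (Fin n)) \<one>\<^bsub>sign_group (Fin n)\<^esub>"
    by (simp add: TPM_group_def tldl_idmat)
qed (rule tpm_chol_tldl tpm_sign_tldl; assumption)+

end

section \<open>The cones as manifolds\<close>

declare LT.simps [simp del]

lemma continuous_on_entry: "continuous_on UNIV (\<lambda>A::cmat. A i j)"
proof -
  have "continuous_on UNIV (\<lambda>A::cmat. A i)"
    by (rule continuous_on_product_then_coordinatewise[OF continuous_on_id])
  then show ?thesis by (rule continuous_on_product_then_coordinatewise)
qed

lemma linear_entry: "linear (\<lambda>A::cmat. A i j)"
  by (rule linearI) (simp_all add: scaleR_fun_def)

lemma elementary_entry: "elementary U (\<lambda>A::cmat. A i j)"
  by (rule elementary.cont_linear[OF linear_entry continuous_on_entry])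

lemma herm_entries:
  assumes "A \<in> herm n F"
  shows "A i j \<in> F" "i \<ge> n \<or> j \<ge> n \<Longrightarrow> A i j = 0" "cnj (A j i) = A i j"
  using assms by (auto simp: herm_def ctrans_def fun_eq_iff)

lemma hermI:
  assumes "\<And>i j. A i j \<in> F" "\<And>i j. i \<ge> n \<or> j \<ge> n \<Longrightarrow> A i j = 0" "\<And>i j. cnj (A j i) = A i j"
  shows "A \<in> herm n F"
  using assms by (auto simp: herm_def ctrans_def fun_eq_iff)

lemma sum_matrix_entry: "(\<Sum>x\<in>S. f x) i j = (\<Sum>x\<in>S. f x i j)" for f :: "'a \<Rightarrow> cmat"
  by (induction S rule: infinite_finite_induct) auto

definition unit_matrix :: "complex \<Rightarrow> nat \<Rightarrow> nat \<Rightarrow> cmat"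
  where "unit_matrix z k l = (\<lambda>i j. if i = k \<and> j = l then z else 0)"

lemma matrix_expansion:
  assumes "\<And>i j. i \<ge> n \<or> j \<ge> n \<Longrightarrow> A i j = 0"
  shows "A = (\<Sum>k<n. \<Sum>l<n. Re (A k l) *\<^sub>R unit_matrix 1 k l + Im (A k l) *\<^sub>R unit_matrix \<i> k l)"
proof (intro ext)
  fix i j
  have "(\<Sum>k<n. \<Sum>l<n. Re (A k l) *\<^sub>R unit_matrix 1 k l + Im (A k l) *\<^sub>R unit_matrix \<i> k l) i j =
      (\<Sum>k<n. \<Sum>l<n. if l = j then (if k = i then A i j else 0) else 0)"
    unfolding sum_matrix_entry
    by (intro sum.cong refl) (auto simp: unit_matrix_def scaleR_fun_def complex_eq_iff)
  also have "\<dots> = A i j" using assms[of i j] by (cases "i < n"; cases "j < n"; simp)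
  finally show "A i j = (\<Sum>k<n. \<Sum>l<n. Re (A k l) *\<^sub>R unit_matrix 1 k l +
      Im (A k l) *\<^sub>R unit_matrix \<i> k l) i j"
    by simp
qed

locale real_or_complex =
  fixes F :: "complex set"
  assumes F_cases: "F = \<real> \<or> F = UNIV"
begin

lemma F_field: "conj_field F"
  using F_cases by (auto simp: conj_field_def is_subfield_def elim!: Reals_cases)

lemma closed_F: "closed F"
  using F_cases closed_complex_Reals by auto

lemma F_scaleR: "z \<in> F \<Longrightarrow> r *\<^sub>R z \<in> F"
  using F_cases by (auto simp: scaleR_conv_of_real)

lemma subspace_herm: "subspace (herm n F)"
proof (rule subspaceI)
  show "0 \<in> herm n F" by (rule hermI) (auto simp: field_0[OF F_field])
  fix A B assume A: "A \<in> herm n F" and B: "B \<in> herm n F"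
  show "A + B \<in> herm n F"
    by (rule hermI) (use herm_entries[OF A] herm_entries[OF B] field_add[OF F_field] in auto)
next
  fix r :: real and A assume A: "A \<in> herm n F"
  show "r *\<^sub>R A \<in> herm n F"
    by (rule hermI) (use herm_entries[OF A] F_scaleR in \<open>auto simp: scaleR_fun_def\<close>)
qed

lemma closed_herm: "closed (herm n F)"
proof -
  have "herm n F = (\<Inter>i j. (\<lambda>A. A i j) -` F) \<inter> (\<Inter>(i, j)\<in>{(i, j). i \<ge> n \<or> j \<ge> n}. (\<lambda>A. A i j) -` {0}) \<inter>
      (\<Inter>i j. (\<lambda>A. cnj (A j i) - A i j) -` {0})"
    by (auto simp: herm_def ctrans_def fun_eq_iff split: if_splits)
  moreover have "closed (\<Inter>i j. (\<lambda>A::cmat. A i j) -` F)"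
    by (intro closed_INT ballI closed_vimage closed_F continuous_on_entry)
  moreover have "closed (\<Inter>(i, j)\<in>{(i, j). i \<ge> n \<or> j \<ge> n}. (\<lambda>A::cmat. A i j) -` {0})"
    by (intro closed_INT ballI) (auto intro!: closed_vimage continuous_on_entry)
  moreover have "closed (\<Inter>i j. (\<lambda>A::cmat. cnj (A j i) - A i j) -` {0})"
    by (intro closed_INT ballI closed_vimage closed_singleton continuous_on_diff continuous_on_cnj
        continuous_on_entry)
  ultimately show ?thesis by (simp only: closed_Int)
qed

text \<open>The matrix units and their multiples by the imaginary unit span a finite-dimensional
  space containing the Hermitian matrices, but are mostly not Hermitian themselves.\<close>

lemma herm_span: "\<exists>B. finite B \<and> herm n F = span B"
proof -
  let ?T = "(\<lambda>(k, l). unit_matrix 1 k l) ` ({..<n} \<times> {..<n}) \<union> (\<lambda>(k,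
      l). unit_matrix \<i> k l) ` ({..<n} \<times> {..<n})"
  have "A \<in> span ?T" if "A \<in> herm n F" for A
  proof -
    have eq: "A = (\<Sum>k<n. \<Sum>l<n. Re (A k l) *\<^sub>R unit_matrix 1 k l + Im (A k l) *\<^sub>R unit_matrix \<i> k l)"
      by (rule matrix_expansion) (rule herm_entries(2)[OF that])
    have "(\<Sum>k<n. \<Sum>l<n. Re (A k l) *\<^sub>R unit_matrix 1 k l + Im (A k l) *\<^sub>R unit_matrix \<i> k l) \<in> span ?T"
      by (intro span_sum span_add span_scale span_base) auto
    then show ?thesis by (subst eq)
  qed
  then have T: "herm n F \<subseteq> span ?T" by blast
  \<comment> \<open>A maximal independent set is therefore chosen inside the Hermitian matrices, and
    its size is bounded by that of the spanning set.\<close>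
  obtain B where B: "B \<subseteq> herm n F" "independent B" "herm n F \<subseteq> span B"
    using maximal_independent_subset by blast
  have "finite B" using independent_span_bound[of ?T B] B T by auto
  moreover have "span B \<subseteq> herm n F" by (rule span_minimal[OF B(1) subspace_herm])
  ultimately show ?thesis using B by blast
qed

text \<open>Here closedness of \<open>F\<close> enters: a limit of Hermitian difference quotients
  over \<open>F\<close> is again of this kind.\<close>

lemma dirderiv_herm:
  assumes d: "has_dirderiv f v x d" and "\<forall>\<^sub>F t in at 0. f (x + t *\<^sub>R v) \<in> herm n F" "f x \<in> herm n F"
  shows "d \<in> herm n F"
proof (rule Lim_in_closed_set[OF closed_herm _ _ d[unfolded has_dirderiv_def]])
  show "\<forall>\<^sub>F t in at 0. inverse t *\<^sub>R (f (x + t *\<^sub>R v) - f x) \<in> herm n F"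
    using assms(2) by eventually_elim
      (use assms(3) in \<open>auto intro!: subspace_scale subspace_diff subspace_herm\<close>)
qed auto

lemma line_open_herm:
  assumes "openin (top_of_set (herm n F)) U"
  shows "line_open (herm n F) U"
  unfolding line_open_def
proof (intro ballI conjI)
  fix x v assume x: "x \<in> U" and v: "v \<in> herm n F"
  have "((\<lambda>t. x i j + t *\<^sub>R v i j) \<longlongrightarrow> x i j + 0 *\<^sub>R v i j) (at 0)" for i j
    by (intro tendsto_intros)
  then show lim: "((\<lambda>t. x + t *\<^sub>R v) \<longlongrightarrow> x) (at 0)"
    unfolding tendsto_matrix_iff by (simp add: scaleR_fun_def)
  obtain W where W: "open W" "U = herm n F \<inter> W" using assms by (auto simp: openin_open)
  have "\<forall>\<^sub>F t in at 0. x + t *\<^sub>R v \<in> W" by (rule topological_tendstoD[OF lim]) (use W x in auto)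
  then show "\<forall>\<^sub>F t in at 0. x + t *\<^sub>R v \<in> U"
    by eventually_elim (use W x v in \<open>auto intro!: subspace_add subspace_scale subspace_herm\<close>)
qed

end

lemma line_open_Times:
  assumes "line_open E U"
  shows "line_open (E \<times> E) (U \<times> U)"
  unfolding line_open_def
proof (intro ballI conjI)
  fix x v assume "x \<in> U \<times> U" "v \<in> E \<times> E"
  then obtain x1 x2 v1 v2 where x: "x = (x1, x2)" "x1 \<in> U" "x2 \<in> U" "v = (v1, v2)" "v1 \<in> E" "v2 \<in> E"
    by auto
  have "((\<lambda>t. (x1 + t *\<^sub>R v1, x2 + t *\<^sub>R v2)) \<longlongrightarrow> (x1, x2)) (at 0)"
    using assms x by (intro tendsto_Pair) (auto simp: line_open_def)
  then show "((\<lambda>t. x + t *\<^sub>R v) \<longlongrightarrow> x) (at 0)" by (simp add: x)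
  have "\<forall>\<^sub>F t in at 0. x1 + t *\<^sub>R v1 \<in> U" "\<forall>\<^sub>F t in at 0. x2 + t *\<^sub>R v2 \<in> U"
    using assms x by (auto simp: line_open_def)
  then show "\<forall>\<^sub>F t in at 0. x + t *\<^sub>R v \<in> U \<times> U"
    by eventually_elim (simp add: x)
qed

lemma LT_mult_entry_elementary:
  assumes "\<And>i j. elementary U (\<lambda>y. p y i j)" "\<And>i j. elementary U (\<lambda>y. q y i j)"
  shows "elementary U (\<lambda>y. LT_mult (p y) (q y) i j)"
proof -
  consider "j < i" | "i = j" | "i < j" by linarith
  then show ?thesis
    by cases (auto simp: LT_mult_def intro: elementary.add elementary.mult assms elementary_const)
qed

text \<open>\<open>tr\<close> is the identity for the leading and the conjugate transpose for the trailing cones.\<close>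

locale manifold_chart = real_or_complex F + cone_chart "Fin n" F \<Psi> G chol sg
  for n :: nat and F :: "complex set" and \<Psi> :: "cmat \<Rightarrow> (nat \<Rightarrow> real) \<Rightarrow> cmat"
    and G :: "cmat monoid" and chol :: "cmat \<Rightarrow> cmat" and sg :: "cmat \<Rightarrow> nat \<Rightarrow> real" +
  fixes tr :: "cmat \<Rightarrow> cmat" and dg :: "(nat \<Rightarrow> real) \<Rightarrow> nat \<Rightarrow> complex"
  assumes tr_cases: "tr = (\<lambda>L. L) \<or> tr = ctrans"
    and \<Psi>_entry: "L \<in> LT (Fin n) F \<Longrightarrow> \<Psi> L \<epsilon> i j = (\<Sum>k<n. dg \<epsilon> k * (tr L i k * cnj (tr L j k)))"
    and open_carrier: "openin (top_of_set (herm n F)) (carrier G)"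
    and sg_locally_const: "A \<in> carrier G \<Longrightarrow> \<exists>W. open W \<and> A \<in> W \<and> (\<forall>B\<in>W \<inter> carrier G. sg B = sg A)"
    and chol_elementary: "elementary (carrier G) (\<lambda>A. chol A i j)"
begin

abbreviation E :: "cmat set" where "E \<equiv> herm n F"
abbreviation U :: "cmat set" where "U \<equiv> carrier G"

lemma U_E: "A \<in> U \<Longrightarrow> A \<in> E"
  using openin_imp_subset[OF open_carrier] by blast

lemma line_U: "line_open E U"
  by (rule line_open_herm[OF open_carrier])

lemma open_submanifold_U: "open_submanifold E U"
  unfolding open_submanifold_def using herm_span open_carrier by blast

lemma tr_elementary:
  "(\<And>i j. elementary V (\<lambda>y. q y i j)) \<Longrightarrow> elementary V (\<lambda>y. tr (q y) i j)"
  using tr_cases elementary.cnj[of V "\<lambda>y. q y j i"] by (auto simp: ctrans_def)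

lemma tr_derivative:
  assumes "\<And>i j. ((\<lambda>t. M t i j) has_vector_derivative X i j) (at 0)"
  shows "((\<lambda>t. tr (M t) i j) has_vector_derivative tr X i j) (at 0)"
  using tr_cases assms[of i j] has_vector_derivative_cnj[OF assms[of j i]] by (auto simp: ctrans_def)

lemma \<Psi>_elementary:
  assumes q: "\<And>i j. elementary V (\<lambda>y. q y i j)" "\<And>y. y \<in> V \<Longrightarrow> q y \<in> LT (Fin n) F"
    and e: "\<And>y. y \<in> V \<Longrightarrow> \<exists>W. open W \<and> y \<in> W \<and> (\<forall>z\<in>W \<inter> V. e z = e y)"
  shows "elementary V (\<lambda>y. \<Psi> (q y) (e y) i j)"
proof (rule elementary.cong)
  \<comment> \<open>The signs may vary with \<open>y\<close>, but they are locally constant, so the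
    coefficients behave like constants.\<close>
  have "elementary V (\<lambda>y. dg (e y) k)" for k
  proof (rule elementary.locally_const)
    fix y assume "y \<in> V"
    with e obtain W where "open W" "y \<in> W" "\<forall>z\<in>W \<inter> V. e z = e y" by blast
    then show "\<exists>W. open W \<and> y \<in> W \<and> (\<forall>z\<in>W \<inter> V. dg (e z) k = dg (e y) k)"
      by (intro exI[of _ W]) auto
  qed
  then show "elementary V (\<lambda>y. \<Sum>k<n. dg (e y) k * (tr (q y) i k * cnj (tr (q y) j k)))"
    by (intro elementary_sum elementary.mult elementary.cnj tr_elementary q(1))
qed (rule \<Psi>_entry[OF q(2)])

definition D\<Psi> :: "(nat \<Rightarrow> real) \<Rightarrow> cmat \<Rightarrow> cmat \<Rightarrow> cmat"
  where "D\<Psi> \<epsilon> L X = (\<lambda>i j. \<Sum>k<n. dg \<epsilon> k * (tr L i k * cnj (tr X j k) + tr X i k * cnj (tr L j k)))"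

lemma \<Psi>_derivative:
  assumes M: "\<And>i j. ((\<lambda>t. M t i j) has_vector_derivative X i j) (at 0)"
    and LT: "\<forall>\<^sub>F t in at 0. M t \<in> LT (Fin n) F" "M 0 \<in> LT (Fin n) F"
  shows "((\<lambda>t. \<Psi> (M t) \<epsilon> i j) has_vector_derivative D\<Psi> \<epsilon> (M 0) X i j) (at 0)"
proof -
  have d: "((\<lambda>t. \<Sum>k<n. dg \<epsilon> k * (tr (M t) i k * cnj (tr (M t) j k))) has_vector_derivative
      D\<Psi> \<epsilon> (M 0) X i j) (at 0)"
    unfolding D\<Psi>_def
    by (intro has_vector_derivative_sum has_vector_derivative_mult_right has_vector_derivative_mult
        has_vector_derivative_cnj tr_derivative M)
  have ev: "\<forall>\<^sub>F t in at 0. inverse t *\<^sub>R ((\<Sum>k<n. dg \<epsilon> k * (tr (M t) i k * cnj (tr (M t) j k))) -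
       (\<Sum>k<n. dg \<epsilon> k * (tr (M 0) i k * cnj (tr (M 0) j k)))) =
           inverse t *\<^sub>R (\<Psi> (M t) \<epsilon> i j - \<Psi> (M 0) \<epsilon> i j)"
    using LT(1) by eventually_elim (simp only: \<Psi>_entry LT(2))
  show ?thesis
    using d unfolding has_vector_derivative_at_0_iff by (rule iffD1[OF tendsto_cong[OF ev]])
qed

section \<open>Smoothness of the group operations\<close>

lemma mult_smooth: "smooth_on (E \<times> E) (U \<times> U) (\<lambda>(x, y). x \<otimes>\<^bsub>G\<^esub> y)"
proof (rule smooth_on_matrix[OF line_open_Times[OF line_U]])
  fix i j
  have el: "elementary (U \<times> U) (\<lambda>z. chol (fst z) i j)" "elementary (U \<times> U) (\<lambda>z. chol (snd z) i j)"
      for i j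
    by (rule elementary_linear_comp[OF chol_elementary]; auto intro: linear_fst linear_snd
        continuous_on_fst continuous_on_snd continuous_on_id)+
  have "elementary (U \<times> U) (\<lambda>z. \<Psi> (LT_mult (chol (fst z)) (chol (snd z)))
      (sg (fst z) \<otimes>\<^bsub>sign_group (Fin n)\<^esub> sg (snd z)) i j)"
  proof (rule \<Psi>_elementary)
    show "elementary (U \<times> U) (\<lambda>z. LT_mult (chol (fst z)) (chol (snd z)) i j)" for i j
      by (rule LT_mult_entry_elementary) (rule el)+
    show "LT_mult (chol (fst z)) (chol (snd z)) \<in> LT (Fin n) F" if "z \<in> U \<times> U" for z
      by (rule LT_mult_closed[OF K]; rule chol_LT) (use that in auto)
    fix z assume "z \<in> U \<times> U"
    then have z: "fst z \<in> U" "snd z \<in> U" by auto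
    obtain W W' where W: "open W" "fst z \<in> W" "\<forall>B\<in>W \<inter> U. sg B = sg (fst z)"
        "open W'" "snd z \<in> W'" "\<forall>B\<in>W' \<inter> U. sg B = sg (snd z)"
      using sg_locally_const[OF z(1)] sg_locally_const[OF z(2)] by blast
    show "\<exists>W. open W \<and> z \<in> W \<and> (\<forall>y\<in>W \<inter> U \<times> U. sg (fst y) \<otimes>\<^bsub>sign_group (Fin n)\<^esub> sg (snd y) =
        sg (fst z) \<otimes>\<^bsub>sign_group (Fin n)\<^esub> sg (snd z))"
      by (rule exI[of _ "W \<times> W'"]) (use W in \<open>auto simp: open_Times mem_Times_iff\<close>)
  qed
  then show "elementary (U \<times> U) (\<lambda>x. (case x of (x, y) \<Rightarrow> x \<otimes>\<^bsub>G\<^esub> y) i j)"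
    by (rule elementary.cong) (auto simp: mult_eq)
qed

lemma inv_smooth: "smooth_on E U (\<lambda>x. inv\<^bsub>G\<^esub> x)"
proof (rule smooth_on_matrix[OF line_U])
  fix i j
  have "elementary U (\<lambda>z. \<Psi> (LT_inv (chol z)) (sg z) i j)"
  proof (rule \<Psi>_elementary)
    fix i j
    consider "j < i" | "i < j" | "i = j" "i < n" | "i = j" "i \<ge> n" by linarith
    then show "elementary U (\<lambda>z. LT_inv (chol z) i j)"
    proof cases
      case 3
      then show ?thesis
        using LT_diag_nonzero[OF chol_LT, of _ j]
        by (auto simp: LT_inv_def intro!: elementary.inverse chol_elementary)
    next
      case 4
      have "elementary U (\<lambda>z. 0)" by (rule elementary_const)
      then show ?thesis
        by (rule elementary.cong) (use 4 LT_outside[OF chol_LT, of _ j] in \<open>auto simp: LT_inv_def\<close>)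
    qed (auto simp: LT_inv_def intro: elementary_uminus chol_elementary elementary_const)
  qed (auto intro!: LT_inv_closed[OF K] chol_LT sg_locally_const)
  then show "elementary U (\<lambda>z. (inv\<^bsub>G\<^esub> z) i j)"
  proof (rule elementary.cong)
    fix x assume "x \<in> U"
    then show "(inv\<^bsub>G\<^esub> x) i j = \<Psi> (LT_inv (chol x)) (sg x) i j"
      using inv_chart[of "chol x" "sg x"] by (simp add: chart_chol chol_LT sg_signs)
  qed
qed

lemma lie_group_G: "lie_group E G"
  unfolding lie_group_def using G.is_group open_submanifold_U mult_smooth inv_smooth by blast

definition left_deriv :: "cmat \<Rightarrow> cmat \<Rightarrow> cmat \<Rightarrow> cmat"
  where "left_deriv b v a = dirderiv (\<lambda>x. b \<otimes>\<^bsub>G\<^esub> x) v a"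

text \<open>The third claim makes a translated line admissible in \<open>D\<phi>_curve\<close>; this
  is how the chain rule through a translation is obtained.\<close>

lemma left_mult_deriv:
  assumes b: "b \<in> U" and a: "a \<in> U" and v: "v \<in> E"
  shows "has_dirderiv (\<lambda>x. b \<otimes>\<^bsub>G\<^esub> x) v a (left_deriv b v a)" "left_deriv b v a \<in> E"
    "curve_in U (\<lambda>t. b \<otimes>\<^bsub>G\<^esub> (a + t *\<^sub>R v)) (b \<otimes>\<^bsub>G\<^esub> a) (left_deriv b v a)"
proof -
  have ev: "\<forall>\<^sub>F t in at 0. a + t *\<^sub>R v \<in> U" using line_U a v by (auto simp: line_open_def)
  have el: "elementary U (\<lambda>x. (b \<otimes>\<^bsub>G\<^esub> x) i j)" for i j
  proof (rule elementary.cong)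
    show "elementary U (\<lambda>x. \<Psi> (LT_mult (chol b) (chol x)) (sg b \<otimes>\<^bsub>sign_group (Fin n)\<^esub> sg x) i j)"
    proof (rule \<Psi>_elementary)
      show "elementary U (\<lambda>y. LT_mult (chol b) (chol y) i j)" for i j
        by (rule LT_mult_entry_elementary) (rule elementary_const chol_elementary)+
      show "LT_mult (chol b) (chol y) \<in> LT (Fin n) F" if "y \<in> U" for y
        by (rule LT_mult_closed[OF K]; rule chol_LT) (use that b in auto)
      fix y assume "y \<in> U"
      from sg_locally_const[OF this]
      show "\<exists>W. open W \<and> y \<in> W \<and> (\<forall>z\<in>W \<inter> U. sg b \<otimes>\<^bsub>sign_group (Fin n)\<^esub> sg z =
          sg b \<otimes>\<^bsub>sign_group (Fin n)\<^esub> sg y)"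
        by metis
    qed
  qed (use b in \<open>simp add: mult_eq\<close>)
  note d = has_dirderiv_matrix[OF line_U a v el]
  show d': "has_dirderiv (\<lambda>x. b \<otimes>\<^bsub>G\<^esub> x) v a (left_deriv b v a)"
    unfolding left_deriv_def using d dirderiv_eqI[OF d] by simp
  show "left_deriv b v a \<in> E"
  proof (rule dirderiv_herm[OF d'])
    show "\<forall>\<^sub>F t in at 0. b \<otimes>\<^bsub>G\<^esub> (a + t *\<^sub>R v) \<in> E"
      using ev by eventually_elim (use b in \<open>auto intro: U_E mult_closed\<close>)
  qed (use b a in \<open>auto intro: U_E mult_closed\<close>)
  show "curve_in U (\<lambda>t. b \<otimes>\<^bsub>G\<^esub> (a + t *\<^sub>R v)) (b \<otimes>\<^bsub>G\<^esub> a) (left_deriv b v a)"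
  proof (rule curve_in_matrix)
    show "\<forall>\<^sub>F t in at 0. b \<otimes>\<^bsub>G\<^esub> (a + t *\<^sub>R v) \<in> U"
      using ev by eventually_elim (use b in \<open>auto intro: mult_closed\<close>)
    show "((\<lambda>t. (b \<otimes>\<^bsub>G\<^esub> (a + t *\<^sub>R v)) i j) has_vector_derivative left_deriv b v a i j) (at 0)" for i j
      using d'[unfolded has_dirderiv_matrix_iff] by (simp add: has_dirderiv_iff_vector)
  qed simp
qed


text \<open>Applied with \<open>F\<close>, with \<open>\<real>\<close> and with \<open>{0}\<close>,
  it shows that derivatives of the chart inherit the field, the real diagonal and the triangular
  pattern.\<close>

lemma eder_closed_subspace:
  assumes "closed S" "subspace S" "elementary U f" "\<And>y. y \<in> U \<Longrightarrow> f y \<in> S" "x \<in> U" "v \<in> E"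
  shows "eder U f v x \<in> S"
proof (rule Lim_in_closed_set[OF assms(1) _ _ has_dirderiv_eder[OF line_U assms(5,6,3),
    unfolded has_dirderiv_def]])
  have "\<forall>\<^sub>F t in at 0. x + t *\<^sub>R v \<in> U" using line_U assms(5,6) by (auto simp: line_open_def)
  then show "\<forall>\<^sub>F t in at 0. inverse t *\<^sub>R (f (x + t *\<^sub>R v) - f x) \<in> S"
    by eventually_elim (intro subspace_scale subspace_diff assms)
qed simp

lemma closed_subspace_F: "closed F" "subspace F"
  using closed_F field_0[OF F_field] field_add[OF F_field] F_scaleR by (auto simp: subspace_def)

lemma closed_subspace_Reals: "closed (\<real> :: complex set)" "subspace (\<real> :: complex set)"
  using closed_complex_Reals by (auto simp: subspace_def scaleR_conv_of_real)

section \<open>The logarithmic chart and its derivatives\<close>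

lemma logL_entry_elementary: "elementary U (\<lambda>A. logL (chol A) i j)"
proof -
  consider "j < i" | "i < j" | "i = j" "i < n" | "i = j" "i \<ge> n" by linarith
  then show ?thesis
  proof cases
    case 3
    then show ?thesis using LT_diag[OF chol_LT, of _ j]
      by (auto simp: logL_def intro!: elementary.ln chol_elementary)
  next
    case 4
    have "elementary U (\<lambda>z. 0)" by (rule elementary_const)
    then show ?thesis
      by (rule elementary.cong) (use 4 LT_outside[OF chol_LT, of _ j] in \<open>auto simp: logL_def\<close>)
  qed (auto simp: logL_def intro: chol_elementary elementary_const)
qed

text \<open>The differential of the chart at the second argument, in the direction of the
  first.\<close>

definition D\<phi> :: "cmat \<Rightarrow> cmat \<Rightarrow> cmat"
  where "D\<phi> X A = (\<lambda>i j. eder U (\<lambda>A. logL (chol A) i j) X A)"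

text \<open>Iterated derivative at the third argument: the inner one is in direction
  \<open>Y\<close>, the outer one in direction \<open>X\<close>.\<close>

definition D2\<phi> :: "cmat \<Rightarrow> cmat \<Rightarrow> cmat \<Rightarrow> cmat"
  where "D2\<phi> X Y A = (\<lambda>i j. eder U (\<lambda>A. D\<phi> Y A i j) X A)"

text \<open>The flat model: the real vector space in which the chart and its derivatives take their
  values.\<close>

definition tangent :: "cmat set"
  where "tangent = {H. (\<forall>i j. H i j \<in> F) \<and> (\<forall>i j. i \<ge> n \<or> i < j \<longrightarrow> H i j = 0) \<and> (\<forall>j. H j j \<in> \<real>)}"

lemma D\<phi>_elementary: "elementary U (\<lambda>A. D\<phi> X A i j)"
  unfolding D\<phi>_def by (rule elementary_eder[OF logL_entry_elementary])

lemma D2\<phi>_elementary: "elementary U (\<lambda>A. D2\<phi> X Y A i j)"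
  unfolding D2\<phi>_def by (rule elementary_eder[OF D\<phi>_elementary])

lemma logL_F: "x \<in> U \<Longrightarrow> logL (chol x) i j \<in> F" "x \<in> U \<Longrightarrow> logL (chol x) j j \<in> \<real>"
  "x \<in> U \<Longrightarrow> i \<ge> n \<or> i < j \<Longrightarrow> logL (chol x) i j = 0"
  using LT_field[OF chol_LT, of x i j] F_cases field_0[OF F_field] LT_outside[OF chol_LT, of x i j]
  by (auto simp: logL_def)

lemma D\<phi>_tangent:
  assumes x: "x \<in> U" and v: "v \<in> E"
  shows "D\<phi> v x \<in> tangent"
proof -
  have "D\<phi> v x i j \<in> F" for i j unfolding D\<phi>_def
    by (rule eder_closed_subspace[OF closed_subspace_F logL_entry_elementary logL_F(1) x v])
  moreover have "D\<phi> v x j j \<in> \<real>" for j unfolding D\<phi>_def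
    by (rule eder_closed_subspace[OF closed_subspace_Reals logL_entry_elementary logL_F(2) x v])
  moreover have "D\<phi> v x i j \<in> {0}" if "i \<ge> n \<or> i < j" for i j unfolding D\<phi>_def
    by (rule eder_closed_subspace[OF _ _ logL_entry_elementary _ x v]) (use logL_F(3) that
        in \<open>auto intro: subspace_0\<close>)
  ultimately show ?thesis by (auto simp: tangent_def)
qed

lemma D2\<phi>_tangent:
  assumes x: "x \<in> U" and v: "v \<in> E" and w: "w \<in> E"
  shows "D2\<phi> v w x \<in> tangent"
proof -
  have *: "D\<phi> w y i j \<in> F" "D\<phi> w y j j \<in> \<real>" "i \<ge> n \<or> i < j \<Longrightarrow> D\<phi> w y i j = 0" if "y \<in> U" for y i j
    using D\<phi>_tangent[OF that w] by (auto simp: tangent_def)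
  have "D2\<phi> v w x i j \<in> F" for i j unfolding D2\<phi>_def
    by (rule eder_closed_subspace[OF closed_subspace_F D\<phi>_elementary *(1) x v])
  moreover have "D2\<phi> v w x j j \<in> \<real>" for j unfolding D2\<phi>_def
    by (rule eder_closed_subspace[OF closed_subspace_Reals D\<phi>_elementary *(2) x v])
  moreover have "D2\<phi> v w x i j \<in> {0}" if "i \<ge> n \<or> i < j" for i j unfolding D2\<phi>_def
    by (rule eder_closed_subspace[OF _ _ D\<phi>_elementary _ x v]) (use *(3) that
        in \<open>auto intro: subspace_0\<close>)
  ultimately show ?thesis by (auto simp: tangent_def)
qed

lemma D\<phi>_linear: "x \<in> U \<Longrightarrow> linear (\<lambda>v. D\<phi> v x i j)"
  unfolding D\<phi>_def by (rule linear_eder[OF logL_entry_elementary])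

lemma D\<phi>_curve:
  "x \<in> U \<Longrightarrow> curve_in U c x v \<Longrightarrow> ((\<lambda>t. logL (chol (c t)) i j) has_vector_derivative D\<phi> v x i j) (at 0)"
  unfolding D\<phi>_def by (rule eder_curve[OF logL_entry_elementary])

lemma D2\<phi>_symmetric: "x \<in> U \<Longrightarrow> v \<in> E \<Longrightarrow> w \<in> E \<Longrightarrow> D2\<phi> v w x = D2\<phi> w v x"
  unfolding D2\<phi>_def D\<phi>_def using eder_symmetric[OF logL_entry_elementary line_U] by (intro ext) simp

text \<open>The inverse of \<open>D\<phi>\<close> at \<open>A\<close>. The diagonal of
  \<open>H\<close> is first turned from a logarithmic velocity into one of the factor, which
  multiplies it by the diagonal entry; the differential of \<open>\<Psi>\<close> is then
  applied.\<close>

definition lift :: "cmat \<Rightarrow> cmat \<Rightarrow> cmat"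
  where "lift A H = D\<Psi> (sg A) (chol A)
    (\<lambda>i j. if j < i then H i j else if i = j then chol A j j * H j j else 0)"

text \<open>Moving \<open>logL\<close> along a straight line gives a curve in the cone with prescribed logarithmic
    velocity.\<close>

lemma lift:
  assumes A: "A \<in> U" and H: "H \<in> tangent"
  shows "lift A H \<in> E" "D\<phi> (lift A H) A = H"
proof -
  define M where "M t = (\<lambda>i j. if j < i then chol A i j + t *\<^sub>R H i j
    else if i = j then chol A j j * complex_of_real (exp (t * Re (H j j))) else 0)" for t :: real
  note L = chol_LT[OF A]
  have H': "H i j \<in> F" "i \<ge> n \<or> i < j \<Longrightarrow> H i j = 0" "complex_of_real (Re (H j j)) = H j j" for i j
    using H by (auto simp: tangent_def of_real_Re)
  have M: "M t \<in> LT (Fin n) F" for t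
  proof -
    have "M t i j \<in> F" for i j
      using LT_field[OF L] H'(1) F_scaleR field_add[OF F_field] field_0[OF F_field] field_mult[OF
          F_field] F_cases
      by (auto simp: M_def)
    moreover have "M t i j = 0" if "i \<ge> n \<or> j \<ge> n \<or> i < j" for i j
      using that LT_outside[OF L, of i j] H'(2)[of i j] by (auto simp: M_def)
    moreover have "M t j j \<in> \<real> \<and> 0 < Re (M t j j)" if j: "j < n" for j
    proof -
      obtain a where "chol A j j = complex_of_real a" "0 < a" using LT_diag[OF L, of j] j by auto
      then show ?thesis by (simp add: M_def)
    qed
    ultimately show ?thesis by (auto simp: LT.simps lower_tri_def)
  qed
  have M0: "M 0 = chol A" using LT_upper[OF L] by (auto simp: M_def fun_eq_iff)
  have M': "((\<lambda>t. M t i j) has_vector_derivative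
      (if j < i then H i j else if i = j then chol A j j * H j j else 0)) (at 0)" for i j
  proof -
    have e: "((\<lambda>t. complex_of_real (exp (t * r))) has_vector_derivative
        complex_of_real r) (at 0)" for r :: real
    proof -
      have "((\<lambda>t. exp (t * r)) has_real_derivative r) (at 0)"
        by (auto intro!: derivative_eq_intros)
      then show ?thesis by (rule has_vector_derivative_of_real)
    qed
    have "((\<lambda>t. chol A j j * complex_of_real (exp (t * Re (H j j)))) has_vector_derivative
        chol A j j * H j j) (at 0)"
      using has_vector_derivative_mult_right[OF e[of "Re (H j j)"], of "chol A j j"]
          by (simp only: H'(3))
    moreover have "((\<lambda>t. chol A i j + t *\<^sub>R H i j) has_vector_derivative H i j) (at 0)"
      by (auto intro!: derivative_eq_intros)
    ultimately show ?thesis by (auto simp: M_def)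
  qed
  have c0: "\<Psi> (M 0) (sg A) = A" by (simp add: M0 chart_chol[OF A])
  have c: "curve_in U (\<lambda>t. \<Psi> (M t) (sg A)) A (lift A H)"
  proof (rule curve_in_matrix)
    show "\<Psi> (M 0) (sg A) = A" by (rule c0)
    show "\<forall>\<^sub>F t in at 0. \<Psi> (M t) (sg A) \<in> U" using chart_carrier[OF M sg_signs[OF A]] by simp
    show "((\<lambda>t. \<Psi> (M t) (sg A) i j) has_vector_derivative lift A H i j) (at 0)" for i j
      using \<Psi>_derivative[OF M' always_eventually[OF allI[OF M]] M, of "sg A" i j]
          by (simp only: lift_def M0)
  qed
  show "lift A H \<in> E"
  proof (rule Lim_in_closed_set[OF closed_herm])
    show "((\<lambda>t. inverse t *\<^sub>R (\<Psi> (M t) (sg A) - A)) \<longlongrightarrow> lift A H) (at 0)"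
      using c by (simp add: curve_in_def)
    show "\<forall>\<^sub>F t in at 0. inverse t *\<^sub>R (\<Psi> (M t) (sg A) - A) \<in> E"
      using U_E[OF chart_carrier[OF M sg_signs[OF A]]] U_E[OF A]
      by (intro always_eventually allI subspace_scale subspace_diff subspace_herm)
  qed simp
  show "D\<phi> (lift A H) A = H"
  proof (intro ext)
    fix i j
    have "logL (chol (\<Psi> (M t) (sg A))) i j = logL (chol A) i j + t *\<^sub>R H i j" for t
    proof -
      consider "j < i" | "i < j \<or> (i = j \<and> i \<ge> n)" | "i = j" "i < n" by linarith
      then show ?thesis unfolding chol_chart[OF M sg_signs[OF A]]
      proof cases
        case 2
        then show "logL (M t) i j = logL (chol A) i j + t *\<^sub>R H i j"
          using H'(2)[of i j] LT_outside[OF L, of i j] LT_outside[OF M, of i j t]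
              by (auto simp: logL_def)
      next
        case 3
        then obtain a where a: "chol A i i = complex_of_real a" "0 < a" using LT_diag[OF L, of i]
            by auto
        have "ln (a * exp (t * Re (H i i))) = ln a + t * Re (H i i)"
          using a by (simp add: ln_mult_pos)
        then show "logL (M t) i j = logL (chol A) i j + t *\<^sub>R H i j"
          using 3 a H'(3)[of i] by (simp add: logL_def M_def scaleR_conv_of_real)
      qed (simp add: logL_def M_def)
    qed
    moreover have "((\<lambda>t. logL (chol A) i j + t *\<^sub>R H i j) has_vector_derivative H i j) (at 0)"
      by (auto intro!: derivative_eq_intros)
    ultimately show "D\<phi> (lift A H) A i j = H i j"
      using D\<phi>_curve[OF A c, of i j] by (auto intro: vector_derivative_unique_at)
  qed
qed


section \<open>The Riemannian metric in logarithmic coordinates\<close>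

definition riem :: "cmat \<Rightarrow> cmat \<Rightarrow> cmat \<Rightarrow> real"
  where "riem A X Y = LT_riem n (chol A) (dirderiv chol X A) (dirderiv chol Y A)"

definition ip :: "cmat \<Rightarrow> cmat \<Rightarrow> real"
  where "ip P Q = Re (\<Sum>i<n. \<Sum>j\<le>i. cnj (P i j) * Q i j)"

lemma dirderiv_chol:
  "A \<in> U \<Longrightarrow> X \<in> E \<Longrightarrow> dirderiv chol X A = (\<lambda>i j. eder U (\<lambda>A. chol A i j) X A)"
  by (rule dirderiv_matrix[OF line_U _ _ chol_elementary])

lemma D\<phi>_lower: "j < i \<Longrightarrow> D\<phi> X A i j = eder U (\<lambda>A. chol A i j) X A"
  by (simp add: D\<phi>_def logL_def)

lemma D\<phi>_diag:
  assumes "A \<in> U" "X \<in> E" "j < n"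
  shows "D\<phi> X A j j = complex_of_real (Re (eder U (\<lambda>A. chol A j j) X A)) * inverse (complex_of_real
      (Re (chol A j j)))"
proof -
  have "eder U (\<lambda>A. complex_of_real (ln (Re (chol A j j)))) X A =
      complex_of_real (Re (eder U (\<lambda>A. chol A j j) X A)) * inverse (complex_of_real (Re (chol A j j)))"
    by (rule eder_ln[OF line_U assms(1,2) chol_elementary])
        (use LT_diag[OF chol_LT, of _ j] assms(3) in auto)
  then show ?thesis by (simp add: D\<phi>_def logL_def)
qed

text \<open>Differentiating the logarithm divides by the diagonal entry, which accounts for the
  weight \<open>1 / (Re (L j j))\<^sup>2\<close> of \<open>LT_riem\<close>. The metric is thus the
  pullback of an inner product that does not depend on the point.\<close>

lemma riem_ip:
  assumes A: "A \<in> U" and X: "X \<in> E" and Y: "Y \<in> E"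
  shows "riem A X Y = ip (D\<phi> X A) (D\<phi> Y A)"
proof -
  have diag: "Re (cnj (D\<phi> X A j j) * D\<phi> Y A j j) =
      Re (dirderiv chol X A j j) * Re (dirderiv chol Y A j j) / (Re (chol A j j))\<^sup>2" if "j < n" for j
    unfolding D\<phi>_diag[OF A X that] D\<phi>_diag[OF A Y that] dirderiv_chol[OF A X] dirderiv_chol[OF A Y]
    by (simp add: power2_eq_square divide_inverse mult_ac flip: of_real_mult of_real_inverse)
  have "ip (D\<phi> X A) (D\<phi> Y A) = (\<Sum>i<n. Re (\<Sum>j<i. cnj (D\<phi> X A i j) * D\<phi> Y A i j) +
      Re (cnj (D\<phi> X A i i) * D\<phi> Y A i i))"
    unfolding ip_def by (simp flip: lessThan_Suc_atMost)
  also have "\<dots> = Re (\<Sum>i<n. \<Sum>j<i. cnj (D\<phi> X A i j) * D\<phi> Y A i j) +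
      (\<Sum>j<n. Re (dirderiv chol X A j j) * Re (dirderiv chol Y A j j) / (Re (chol A j j))\<^sup>2)"
    unfolding sum.distrib using diag by simp
  also have "(\<Sum>i<n. \<Sum>j<i. cnj (D\<phi> X A i j) * D\<phi> Y A i j) =
      (\<Sum>i<n. \<Sum>j<i. cnj (dirderiv chol X A i j) * dirderiv chol Y A i j)"
    by (intro sum.cong refl) (simp add: D\<phi>_lower dirderiv_chol[OF A X] dirderiv_chol[OF A Y])
  finally show ?thesis by (simp add: riem_def LT_riem_def)
qed

lemma ip_commute: "ip P Q = ip Q P"
  unfolding ip_def Re_sum by (intro sum.cong refl) (simp add: mult.commute)

lemma ip_add_left: "ip (\<lambda>i j. P i j + P' i j) Q = ip P Q + ip P' Q"
  unfolding ip_def by (simp add: ring_distribs sum.distrib)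

lemma ip_scale_left: "ip (\<lambda>i j. r *\<^sub>R P i j) Q = r * ip P Q"
  unfolding ip_def by (simp add: scaleR_conv_of_real sum_distrib_left mult.assoc right_diff_distrib
      ring_distribs)

lemma ip_nonneg: "0 \<le> ip P P"
  unfolding ip_def Re_sum by (intro sum_nonneg) (simp add: complex_mult_cnj mult.commute)

lemma ip_zero:
  assumes "ip H H = 0" "H \<in> tangent"
  shows "H = (\<lambda>i j. 0)"
proof (intro ext)
  fix i j
  have nn: "0 \<le> Re (cnj (H i j) * H i j)" for i j by (simp add: mult.commute)
  show "H i j = 0"
  proof (cases "i < n \<and> j \<le> i")
    case True
    have "(\<Sum>i<n. \<Sum>j\<le>i. Re (cnj (H i j) * H i j)) = 0"
      using assms(1) by (simp add: ip_def)
    then have "(\<Sum>j\<le>i. Re (cnj (H i j) * H i j)) = 0"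
      using True nn by (subst (asm) sum_nonneg_eq_0_iff) (auto intro!: sum_nonneg)
    then have "Re (cnj (H i j) * H i j) = 0"
      using True nn by (subst (asm) sum_nonneg_eq_0_iff) auto
    then show ?thesis by (auto simp: complex_eq_iff add_nonneg_eq_0_iff)
  next
    case False
    then show ?thesis using assms(2) by (auto simp: tangent_def)
  qed
qed

text \<open>If the logarithms have velocity 0, so has the triangular factor. As
  \<open>\<Psi>\<close> rebuilds the matrix from its factor and its locally constant signs, the line
  through \<open>x\<close> has velocity 0, but that velocity is \<open>v\<close>.\<close>

lemma D\<phi>_inj:
  assumes x: "x \<in> U" and v: "v \<in> E" and 0: "D\<phi> v x = (\<lambda>i j. 0)"
  shows "v = 0"
proof -
  have e0: "eder U (\<lambda>A. chol A i j) v x = 0" for i j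
  proof -
    consider "j < i" | "i < j \<or> (i = j \<and> i \<ge> n)" | "i = j" "i < n" by linarith
    then show ?thesis
    proof cases
      case 1
      then show ?thesis using D\<phi>_lower[OF 1, of v x] 0 by simp
    next
      case 2
      have "eder U (\<lambda>A. chol A i j) v x \<in> {0}"
        by (rule eder_closed_subspace[OF _ _ chol_elementary _ x v])
          (use 2 LT_upper[OF chol_LT, of _ i j] LT_outside[OF chol_LT, of _ i j]
              in \<open>auto intro: subspace_0\<close>)
      then show ?thesis by simp
    next
      case 3
      have "eder U (\<lambda>A. chol A j j) v x \<in> \<real>"
        by (rule eder_closed_subspace[OF closed_subspace_Reals chol_elementary _ x v])
          (metis LT_diag_real chol_LT Reals_of_real)
      moreover have "Re (chol x j j) \<noteq> 0" using LT_diag[OF chol_LT[OF x], of j] 3 by auto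
      then have "Re (eder U (\<lambda>A. chol A j j) v x) = 0"
        using D\<phi>_diag[OF x v, of j] 0 3 by simp
      ultimately show ?thesis using 3 by (simp add: complex_is_Real_iff complex_eq_iff)
    qed
  qed
  let ?c = "\<lambda>t. x + t *\<^sub>R v"
  have ev: "\<forall>\<^sub>F t in at 0. ?c t \<in> U" using line_U x v by (auto simp: line_open_def)
  \<comment> \<open>For small \<open>t\<close> the line must keep the signs of \<open>x\<close>, so
    that one and the same \<open>\<Psi>\<close> with fixed signs rebuilds it.\<close>
  obtain W where W: "open W" "x \<in> W" "\<forall>B\<in>W \<inter> U. sg B = sg x" using sg_locally_const[OF x] by blast
  have "(?c \<longlongrightarrow> x) (at 0)" using line_U x v by (auto simp: line_open_def)
  then have evW: "\<forall>\<^sub>F t in at 0. ?c t \<in> W" by (rule topological_tendstoD) (use W in auto)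
  have "v i j = 0" for i j
  proof -
    have M': "((\<lambda>t. chol (?c t) i j) has_vector_derivative 0) (at 0)" for i j
      using eder_line[OF line_U x v chol_elementary, of i j] e0 by simp
    have LTc: "\<forall>\<^sub>F t in at 0. chol (?c t) \<in> LT (Fin n) F"
      using ev by eventually_elim (rule chol_LT)
    have D: "((\<lambda>t. \<Psi> (chol (?c t)) (sg x) i j) has_vector_derivative
        D\<Psi> (sg x) (chol (?c 0)) (\<lambda>i j. 0) i j) (at 0)"
      by (rule \<Psi>_derivative[OF M' LTc]) (use chol_LT[OF x] in simp)
    have Z: "D\<Psi> (sg x) (chol (?c 0)) (\<lambda>i j. 0) i j = 0"
      using tr_cases by (auto simp: D\<Psi>_def ctrans_def)
    \<comment> \<open>After rebuilding, the difference quotient equals \<open>v\<close> exactly for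
      all small nonzero \<open>t\<close>; it also tends to the derivative computed in
      \<open>D\<close>, which is 0.\<close>
    have "\<forall>\<^sub>F t in at 0. inverse t *\<^sub>R (\<Psi> (chol (?c t)) (sg x) i j - \<Psi> (chol (?c 0)) (sg x) i j) = v i j"
    proof -
      have "\<forall>\<^sub>F t in at (0::real). t \<noteq> 0" by (simp add: eventually_at_filter)
      with ev evW show ?thesis
      proof eventually_elim
        case (elim t)
        then have sgt: "sg (?c t) = sg x" using W(3) by blast
        have ct: "\<Psi> (chol (?c t)) (sg x) = ?c t" using chart_chol[OF elim(1)] unfolding sgt .
        have c0: "\<Psi> (chol (?c 0)) (sg x) = x" using chart_chol[OF x] by simp
        show ?case unfolding ct c0 using elim(3) by (simp add: scaleR_fun_def)
      qed
    qed
    then have T: "((\<lambda>t. inverse t *\<^sub>R (\<Psi> (chol (?c t)) (sg x) i j - \<Psi> (chol (?c 0)) (sg x) i j)) \<longlongrightarrow> v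
        i j) (at 0)"
      by (rule tendsto_eventually)
    show ?thesis
      using tendsto_unique[OF trivial_limit_at D[unfolded has_vector_derivative_at_0_iff] T]
          unfolding Z by simp
  qed
  then show ?thesis by (auto simp: fun_eq_iff)
qed

lemma D\<phi>_add: "x \<in> U \<Longrightarrow> D\<phi> (u + v) x = (\<lambda>i j. D\<phi> u x i j + D\<phi> v x i j)"
  by (intro ext) (rule linear_add[OF D\<phi>_linear])

lemma D\<phi>_diff: "x \<in> U \<Longrightarrow> D\<phi> (u - v) x = (\<lambda>i j. D\<phi> u x i j - D\<phi> v x i j)"
  by (intro ext) (rule linear_diff[OF D\<phi>_linear])

lemma D\<phi>_scale: "x \<in> U \<Longrightarrow> D\<phi> (r *\<^sub>R v) x = (\<lambda>i j. r *\<^sub>R D\<phi> v x i j)"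
  by (intro ext) (rule linear_cmul[OF D\<phi>_linear])

lemma D\<phi>_zero: "x \<in> U \<Longrightarrow> D\<phi> 0 x = (\<lambda>i j. 0)"
  by (intro ext) (rule linear_0[OF D\<phi>_linear])

lemma inner_product_riem:
  assumes x: "x \<in> U"
  shows "inner_product_on E (riem x)"
  unfolding inner_product_on_def
proof (intro conjI ballI allI impI)
  fix u v w and r :: real assume "u \<in> E" "v \<in> E" "w \<in> E"
  moreover from this have "r *\<^sub>R u + v \<in> E" by (intro subspace_add subspace_scale subspace_herm)
  ultimately show "riem x (r *\<^sub>R u + v) w = r * riem x u w + riem x v w"
    using x by (simp add: riem_ip D\<phi>_add D\<phi>_scale ip_add_left ip_scale_left)
next
  fix u v assume "u \<in> E" "v \<in> E"
  then show "riem x u v = riem x v u" using x by (simp add: riem_ip ip_commute)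
next
  fix u :: cmat assume u: "u \<in> E" "u \<noteq> 0"
  then have "ip (D\<phi> u x) (D\<phi> u x) \<noteq> 0"
    using ip_zero[OF _ D\<phi>_tangent[OF x u(1)]] D\<phi>_inj[OF x u(1)] by blast
  then show "0 < riem x u u" using riem_ip[OF x u(1) u(1)] ip_nonneg[of "D\<phi> u x"] by simp
qed

lemma ip_elementary:
  assumes "\<And>i j. elementary U (\<lambda>y. P y i j)" "\<And>i j. elementary U (\<lambda>y. Q y i j)"
  shows "elementary U (\<lambda>y. \<Sum>i<n. \<Sum>j\<le>i. cnj (P y i j) * Q y i j)"
  by (intro elementary_sum elementary.mult elementary.cnj assms)

lemma riem_elementary:
  assumes "v \<in> E" "w \<in> E"
  shows "elementary U (\<lambda>x. complex_of_real (riem x v w))"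
  by (rule elementary.cong[OF elementary_Re[OF ip_elementary[OF D\<phi>_elementary D\<phi>_elementary]]])
    (use assms in \<open>simp add: riem_ip ip_def\<close>)

lemma riemannian_U: "riemannian_manifold E U riem"
  unfolding riemannian_manifold_def
  using open_submanifold_U inner_product_riem smooth_on_real[OF line_U riem_elementary] by blast

section \<open>Connection and curvature\<close>

lemma dirderiv_riem:
  assumes x: "x \<in> U" and v: "v \<in> E" and w: "w \<in> E" and z: "z \<in> E"
  shows "dirderiv (\<lambda>y. riem y w z) v x = ip (D2\<phi> v w x) (D\<phi> z x) + ip (D\<phi> w x) (D2\<phi> v z x)"
proof -
  let ?S = "\<lambda>y. \<Sum>i<n. \<Sum>j\<le>i. cnj (D\<phi> w y i j) * D\<phi> z y i j"
  have el: "elementary U ?S" by (rule ip_elementary[OF D\<phi>_elementary D\<phi>_elementary])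
  have "complex_of_real (dirderiv (\<lambda>y. riem y w z) v x) = eder U (\<lambda>y. complex_of_real (riem y w z)) v x"
    by (rule dirderiv_real(2)[OF line_U x v riem_elementary[OF w z]])
  also have "\<dots> = eder U (\<lambda>y. complex_of_real (Re (?S y))) v x"
    by (rule eder_cong[OF line_U x v elementary_Re[OF el]]) (use w z in \<open>simp add: riem_ip ip_def\<close>)
  also have "\<dots> = complex_of_real (Re (eder U ?S v x))"
    by (rule eder_Re[OF line_U x v el])
  finally have "dirderiv (\<lambda>y. riem y w z) v x = Re (eder U ?S v x)" by (simp only: of_real_eq_iff)
  also have "eder U ?S v x = (\<Sum>i<n. \<Sum>j\<le>i. eder U (\<lambda>y. cnj (D\<phi> w y i j) * D\<phi> z y i j) v x)"
    by (subst eder_sum[OF line_U x v])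
      (auto intro!: elementary_sum elementary.mult elementary.cnj D\<phi>_elementary sum.cong eder_sum[OF
          line_U x v])
  also have "\<dots> = (\<Sum>i<n. \<Sum>j\<le>i. cnj (D\<phi> w x i j) * D2\<phi> v z x i j + cnj (D2\<phi> v w x i j) * D\<phi> z x i j)"
    unfolding D2\<phi>_def
    by (simp only: eder_mult[OF line_U x v elementary.cnj[OF D\<phi>_elementary] D\<phi>_elementary]
        eder_cnj[OF line_U x v D\<phi>_elementary])
  finally show ?thesis by (simp add: ip_def sum.distrib)
qed

text \<open>By the product rule the right-hand side of the Koszul formula has six terms. Symmetry of
  \<open>D2\<phi>\<close> cancels four of them and leaves twice the inner product of
  \<open>D2\<phi> v w\<close> with \<open>D\<phi> z\<close>, so the solution is the preimage of
  \<open>D2\<phi> v w\<close> under \<open>D\<phi>\<close>.\<close>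

lemma christoffel_eq:
  assumes x: "x \<in> U" and v: "v \<in> E" and w: "w \<in> E"
  shows "christoffel E riem x v w = lift x (D2\<phi> v w x)"
  unfolding christoffel_def
proof (rule the_equality)
  let ?u = "lift x (D2\<phi> v w x)"
  note u = lift[OF x D2\<phi>_tangent[OF x v w]]
  have koszul: "2 * riem x ?u z = dirderiv (\<lambda>y. riem y w z) v x + dirderiv (\<lambda>y. riem y v z) w x -
      dirderiv (\<lambda>y. riem y v w) z x" if z: "z \<in> E" for z
  proof -
    have "2 * riem x ?u z = 2 * ip (D2\<phi> v w x) (D\<phi> z x)" by (simp add: riem_ip[OF x u(1) z] u(2))
    then show ?thesis
      unfolding dirderiv_riem[OF x v w z] dirderiv_riem[OF x w v z] dirderiv_riem[OF x z v w]
        D2\<phi>_symmetric[OF x w v] D2\<phi>_symmetric[OF x z v] D2\<phi>_symmetric[OF x z w]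
      using ip_commute[of "D\<phi> w x" "D2\<phi> v z x"] by simp
  qed
  then show "?u \<in> E \<and> (\<forall>z\<in>E. 2 * riem x ?u z = dirderiv (\<lambda>y. riem y w z) v x +
      dirderiv (\<lambda>y. riem y v z) w x - dirderiv (\<lambda>y. riem y v w) z x)" using u(1) by blast
  fix u' assume u': "u' \<in> E \<and> (\<forall>z\<in>E. 2 * riem x u' z = dirderiv (\<lambda>y. riem y w z) v x +
      dirderiv (\<lambda>y. riem y v z) w x - dirderiv (\<lambda>y. riem y v w) z x)"
  note ipr = inner_product_riem[OF x, unfolded inner_product_on_def]
  \<comment> \<open>Uniqueness: the difference of two solutions is a legitimate test direction and
    hence orthogonal to itself.\<close>
  have d: "(-1) *\<^sub>R ?u + u' \<in> E" using u' u(1) by (intro subspace_add subspace_scale subspace_herm) auto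
  have "riem x u' ((-1) *\<^sub>R ?u + u') = riem x ?u ((-1) *\<^sub>R ?u + u')" 
    using bspec[OF conjunct2[OF u'] d] koszul[OF d] by linarith
  moreover have "riem x ((-1) *\<^sub>R ?u + u') ((-1) *\<^sub>R ?u + u') =
      (-1) * riem x ?u ((-1) *\<^sub>R ?u + u') + riem x u' ((-1) *\<^sub>R ?u + u')"
    by (rule ipr[THEN conjunct1, rule_format, OF u(1) conjunct1[OF u'] d])
  ultimately have "riem x ((-1) *\<^sub>R ?u + u') ((-1) *\<^sub>R ?u + u') = 0" by simp
  then have "(-1) *\<^sub>R ?u + u' = 0"
    using ipr[THEN conjunct2, THEN conjunct2, rule_format, OF d] by (metis less_irrefl)
  then show "u' = ?u" by simp
qed

text \<open>Makes the Christoffel symbols differentiable as functions of the base point.\<close>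

lemma lift_elementary:
  assumes H: "\<And>i j. elementary U (\<lambda>y. H y i j)"
  shows "elementary U (\<lambda>y. lift y (H y) i j)"
proof -
  let ?X = "\<lambda>y i j. if j < i then H y i j else if i = j then chol y j j * H y j j else 0"
  have X: "elementary U (\<lambda>y. ?X y i j)" for i j
  proof -
    consider "j < i" | "i = j" | "i < j" by linarith
    then show ?thesis
      by cases (simp_all add: H elementary_const elementary.mult[OF chol_elementary H])
  qed
  have dg: "elementary U (\<lambda>y. dg (sg y) k)" for k
  proof (rule elementary.locally_const)
    fix y assume "y \<in> U"
    with sg_locally_const obtain W where "open W" "y \<in> W" "\<forall>z\<in>W \<inter> U. sg z = sg y" by blast
    then show "\<exists>W. open W \<and> y \<in> W \<and> (\<forall>z\<in>W \<inter> U. dg (sg z) k = dg (sg y) k)"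
      by (intro exI[of _ W]) auto
  qed
  show ?thesis unfolding lift_def D\<Psi>_def
    by (intro elementary_sum elementary.mult elementary.add elementary.cnj tr_elementary X dg
        chol_elementary)
qed

text \<open>The unit matrices are mostly not tangent directions; what is used is the linear
  extension that \<open>eder\<close> selects beyond the tangent space.\<close>

lemma D\<phi>_expand:
  assumes x: "x \<in> U" and Z: "Z \<in> E"
  shows "D\<phi> Z x i j = (\<Sum>k<n. \<Sum>l<n. complex_of_real (Re (Z k l)) * D\<phi> (unit_matrix 1 k l) x i j +
    complex_of_real (Im (Z k l)) * D\<phi> (unit_matrix \<i> k l) x i j)"
proof -
  have Z: "Z = (\<Sum>k<n. \<Sum>l<n. Re (Z k l) *\<^sub>R unit_matrix 1 k l + Im (Z k l) *\<^sub>R unit_matrix \<i> k l)"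
    by (rule matrix_expansion) (rule herm_entries(2)[OF Z])
  show ?thesis
    by (subst Z) (simp add: linear_sum[OF D\<phi>_linear[OF x]] linear_add[OF D\<phi>_linear[OF x]]
        linear_cmul[OF D\<phi>_linear[OF x]] scaleR_conv_of_real)
qed

text \<open>The direction \<open>Z y\<close> varies with the base point; expanding it over matrix units reduces the claim
  to the product rule.\<close>

lemma eder_D\<phi>_varying:
  assumes x: "x \<in> U" and u: "u \<in> E" and el: "\<And>i j. elementary U (\<lambda>y. Z y i j)" and Z: "\<And>y. y \<in> U \<Longrightarrow>
      Z y \<in> E"
  shows "dirderiv Z u x \<in> E"
    "eder U (\<lambda>y. D\<phi> (Z y) y i j) u x = D\<phi> (dirderiv Z u x) x i j + D2\<phi> u (Z x) x i j"
proof -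
  let ?e = "unit_matrix 1" and ?f = "unit_matrix \<i>"
  note dZ = dirderiv_matrix[OF line_U x u el]
  have "has_dirderiv Z u x (dirderiv Z u x)"
    using has_dirderiv_matrix[OF line_U x u el] unfolding dZ .
  then show dE: "dirderiv Z u x \<in> E"
  proof (rule dirderiv_herm)
    have "\<forall>\<^sub>F t in at 0. x + t *\<^sub>R u \<in> U" using line_U x u by (auto simp: line_open_def)
    then show "\<forall>\<^sub>F t in at 0. Z (x + t *\<^sub>R u) \<in> E" by eventually_elim (rule Z)
  qed (rule Z[OF x])
  note R = elementary_Re[OF el] and I = elementary_Im[OF el]
  have eIm: "eder U (\<lambda>y. complex_of_real (Im (Z y k l))) u x =
      complex_of_real (Im (dirderiv Z u x k l))" for k l
  proof -
    have "eder U (\<lambda>y. complex_of_real (Im (Z y k l))) u x =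
        eder U (\<lambda>y. complex_of_real (Re (- \<i> * Z y k l))) u x"
      by simp
    also have "\<dots> = complex_of_real (Re (eder U (\<lambda>y. - \<i> * Z y k l) u x))"
      by (rule eder_Re[OF line_U x u elementary.mult[OF elementary_const el]])
    also have "eder U (\<lambda>y. - \<i> * Z y k l) u x = - \<i> * eder U (\<lambda>y. Z y k l) u x"
      by (rule eder_cmult[OF line_U x u el])
    finally show ?thesis by (simp add: dZ)
  qed
  have eRe: "eder U (\<lambda>y. complex_of_real (Re (Z y k l))) u x =
      complex_of_real (Re (dirderiv Z u x k l))" for k l
    by (subst eder_Re[OF line_U x u el]) (simp add: dZ)
  have sum: "eder U (\<lambda>y. \<Sum>k<n. \<Sum>l<n. r y k l * D\<phi> (?e k l) y i j + s y k l * D\<phi> (?f k l) y i j) u x =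
      (\<Sum>k<n. \<Sum>l<n. (r x k l * D2\<phi> u (?e k l) x i j + eder U (\<lambda>y. r y k l) u x * D\<phi> (?e k l) x i j) +
        (s x k l * D2\<phi> u (?f k l) x i j + eder U (\<lambda>y. s y k l) u x * D\<phi> (?f k l) x i j))"
    if r: "\<And>k l. elementary U (\<lambda>y. r y k l)" and s: "\<And>k l. elementary U (\<lambda>y. s y k l)" for r s
  proof -
    note a = elementary.mult[OF r D\<phi>_elementary] and b = elementary.mult[OF s D\<phi>_elementary]
    have "eder U (\<lambda>y. \<Sum>k<n. \<Sum>l<n. r y k l * D\<phi> (?e k l) y i j + s y k l * D\<phi> (?f k l) y i j) u x =
        (\<Sum>k<n. eder U (\<lambda>y. \<Sum>l<n. r y k l * D\<phi> (?e k l) y i j + s y k l * D\<phi> (?f k l) y i j) u x)"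
      by (intro eder_sum[OF line_U x u] elementary_sum elementary.add a b)
    also have "\<dots> = (\<Sum>k<n. \<Sum>l<n. eder U (\<lambda>y. r y k l * D\<phi> (?e k l) y i j +
        s y k l * D\<phi> (?f k l) y i j) u x)"
      by (intro sum.cong refl eder_sum[OF line_U x u] elementary.add a b)
    also have "\<dots> = (\<Sum>k<n. \<Sum>l<n. (r x k l * D2\<phi> u (?e k l) x i j +
        eder U (\<lambda>y. r y k l) u x * D\<phi> (?e k l) x i j) +
        (s x k l * D2\<phi> u (?f k l) x i j + eder U (\<lambda>y. s y k l) u x * D\<phi> (?f k l) x i j))"
      unfolding D2\<phi>_def
      by (simp only: eder_add[OF line_U x u a b] eder_mult[OF line_U x u r D\<phi>_elementary]
          eder_mult[OF line_U x u s D\<phi>_elementary])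
    finally show ?thesis .
  qed
  have elS: "elementary U (\<lambda>y. \<Sum>k<n. \<Sum>l<n. r y k l * D\<phi> (?e k l) y i j + s y k l * D\<phi> (?f k l) y i j)"
    if "\<And>k l. elementary U (\<lambda>y. r y k l)" "\<And>k l. elementary U (\<lambda>y. s y k l)" for r s
    by (intro elementary_sum elementary.add elementary.mult D\<phi>_elementary that)
  \<comment> \<open>With coefficients frozen at \<open>x\<close>, the same expansion computes the
    second derivative in the fixed direction \<open>Z x\<close>. Against the moving direction the
    only new terms are those in which a coefficient is differentiated.\<close>
  have "D2\<phi> u (Z x) x i j = eder U (\<lambda>y. \<Sum>k<n. \<Sum>l<n. complex_of_real (Re (Z x k l)) * D\<phi> (?e k l) y i j +
      complex_of_real (Im (Z x k l)) * D\<phi> (?f k l) y i j) u x"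
    unfolding D2\<phi>_def
    by (rule eder_cong[OF line_U x u elS[OF elementary_const elementary_const]]) (rule D\<phi>_expand[OF
        _ Z[OF x]])
  also have "\<dots> = (\<Sum>k<n. \<Sum>l<n. complex_of_real (Re (Z x k l)) * D2\<phi> u (?e k l) x i j +
      complex_of_real (Im (Z x k l)) * D2\<phi> u (?f k l) x i j)"
    unfolding sum[OF elementary_const elementary_const] by (simp add: eder_const[OF line_U x u])
  finally have D2: "D2\<phi> u (Z x) x i j = \<dots>" .
  have "eder U (\<lambda>y. D\<phi> (Z y) y i j) u x = eder U (\<lambda>y. \<Sum>k<n. \<Sum>l<n. complex_of_real (Re (Z y k l)) *
      D\<phi> (?e k l) y i j +
      complex_of_real (Im (Z y k l)) * D\<phi> (?f k l) y i j) u x"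
    by (rule eder_cong[OF line_U x u elS[OF R I]]) (rule D\<phi>_expand[OF _ Z])
  also have "\<dots> = D\<phi> (dirderiv Z u x) x i j + D2\<phi> u (Z x) x i j"
    unfolding sum[OF R I] eRe eIm D2 D\<phi>_expand[OF x dE] by (simp add: sum.distrib add_ac)
  finally show "eder U (\<lambda>y. D\<phi> (Z y) y i j) u x = D\<phi> (dirderiv Z u x) x i j + D2\<phi> u (Z x) x i j" .
qed

text \<open>Since \<open>D\<phi>\<close> maps the Christoffel symbol to the second derivative of the global chart \<open>\<phi>\<close>,
  it maps the curvature to an antisymmetrised third derivative of \<open>\<phi>\<close>.\<close>

lemma curvature_zero:
  assumes x: "x \<in> U" and u: "u \<in> E" and v: "v \<in> E" and w: "w \<in> E"
  shows "riemann_curvature E riem x u v w = 0"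
proof -
  define \<Gamma> where "\<Gamma> = (\<lambda>v y. lift y (D2\<phi> v w y))"
  have el: "elementary U (\<lambda>y. \<Gamma> v y i j)" for v i j
    unfolding \<Gamma>_def by (rule lift_elementary[OF D2\<phi>_elementary])
  have \<Gamma>E: "\<Gamma> v y \<in> E" and \<Gamma>D: "D\<phi> (\<Gamma> v y) y = D2\<phi> v w y" if "y \<in> U" "v \<in> E" for v y
    unfolding \<Gamma>_def using lift[OF that(1) D2\<phi>_tangent[OF that w]] by auto
  have chr: "christoffel E riem y v w = \<Gamma> v y" if "y \<in> U" "v \<in> E" for v y
    unfolding \<Gamma>_def by (rule christoffel_eq[OF that w])
  have dchr: "dirderiv (\<lambda>y. christoffel E riem y v w) u x =
      dirderiv (\<Gamma> v) u x" if "u \<in> E" "v \<in> E" for u v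
    by (rule dirderiv_cong[OF line_U x that(1)]) (rule chr[OF _ that(2)])
  \<comment> \<open>This is the defining relation of the connection,
    \<open>D\<phi> (\<Gamma> v y) y = D2\<phi> v w y\<close>, differentiated in direction
    \<open>u\<close>.\<close>
  have key: "D\<phi> (dirderiv (\<Gamma> v) u x) x i j + D2\<phi> u (\<Gamma> v x) x i j = eder U (\<lambda>y. D2\<phi> v w y i j) u x"
    if "u \<in> E" "v \<in> E" for u v i j
  proof -
    have "eder U (\<lambda>y. D\<phi> (\<Gamma> v y) y i j) u x = eder U (\<lambda>y. D2\<phi> v w y i j) u x"
      by (rule eder_cong[OF line_U x that(1) D2\<phi>_elementary]) (simp add: \<Gamma>D that(2))
    then show ?thesis
      using eder_D\<phi>_varying(2)[OF x that(1) el \<Gamma>E[OF _ that(2)], of i j] by simp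
  qed
  have dE: "dirderiv (\<Gamma> v) u x \<in> E" if "u \<in> E" "v \<in> E" for u v
    by (rule eder_D\<phi>_varying(1)[OF x that(1) el \<Gamma>E[OF _ that(2)]])
  have l: "lift x (D2\<phi> u z x) \<in> E" "D\<phi> (lift x (D2\<phi> u z x)) x = D2\<phi> u z x" if "u \<in> E" "z \<in> E" for u z
    using lift[OF x D2\<phi>_tangent[OF x that]] by auto
  let ?R = "dirderiv (\<Gamma> v) u x - dirderiv (\<Gamma> u) v x + lift x (D2\<phi> u (\<Gamma> v x) x) - lift x (D2\<phi> v (\<Gamma> u
      x) x)"
  have R: "riemann_curvature E riem x u v w = ?R"
    unfolding riemann_curvature_def dchr[OF u v] dchr[OF v u] chr[OF x v] chr[OF x u]
      christoffel_eq[OF x u \<Gamma>E[OF x v]] christoffel_eq[OF x v \<Gamma>E[OF x u]] ..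
  have RE: "?R \<in> E"
    by (intro subspace_add subspace_diff subspace_herm dE l u v \<Gamma>E[OF x])
  have "D\<phi> ?R x i j = 0" for i j
  proof -
    have "D\<phi> ?R x i j = D\<phi> (dirderiv (\<Gamma> v) u x) x i j - D\<phi> (dirderiv (\<Gamma> u) v x) x i j +
        D2\<phi> u (\<Gamma> v x) x i j - D2\<phi> v (\<Gamma> u x) x i j"
      by (simp only: D\<phi>_add[OF x] D\<phi>_diff[OF x] l(2)[OF u \<Gamma>E[OF x v]] l(2)[OF v \<Gamma>E[OF x u]])
    \<comment> \<open>The two relations from \<open>key\<close> absorb exactly the terms quadratic
      in the connection, so only third derivatives of the chart remain.\<close>
    also have "\<dots> = eder U (\<lambda>y. D2\<phi> v w y i j) u x - eder U (\<lambda>y. D2\<phi> u w y i j) v x"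
      using key[OF u v, of i j] key[OF v u, of i j] by (simp add: algebra_simps)
    also have "\<dots> = 0"
      unfolding D2\<phi>_def using eder_symmetric[OF D\<phi>_elementary line_U x v u, of w i j] by simp
    finally show ?thesis .
  qed
  then show ?thesis unfolding R by (intro D\<phi>_inj[OF x RE]) auto
qed

lemma sectional_curvature_zero_U: "sectional_curvature_zero E U riem"
  unfolding sectional_curvature_zero_def
proof (intro ballI impI)
  fix x u v assume x: "x \<in> U" and u: "u \<in> E" and v: "v \<in> E"
  have "riem x 0 u = 0"
    using x u subspace_0[OF subspace_herm] by (simp add: riem_ip D\<phi>_zero ip_def)
  then show "sectional_curvature E riem x u v = 0"
    unfolding sectional_curvature_def curvature_zero[OF x u v v] by simp
qed

text \<open>In logarithmic coordinates a left translation adds a constant, which differentiation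
  removes.\<close>

lemma D\<phi>_left_deriv:
  assumes b: "b \<in> U" and a: "a \<in> U" and v: "v \<in> E"
  shows "D\<phi> (left_deriv b v a) (b \<otimes>\<^bsub>G\<^esub> a) = D\<phi> v a"
proof (intro ext)
  fix i j
  have ev: "\<forall>\<^sub>F t in at 0. a + t *\<^sub>R v \<in> U" using line_U a v by (auto simp: line_open_def)
  have log: "logL (chol (b \<otimes>\<^bsub>G\<^esub> x)) i j = logL (chol b) i j + logL (chol x) i j" if "x \<in> U" for x
    using that b by (simp add: chol_mult logL_mult[of _ "Fin n" F] chol_LT)
  have "((\<lambda>t. logL (chol (b \<otimes>\<^bsub>G\<^esub> (a + t *\<^sub>R v))) i j) has_vector_derivative
      D\<phi> (left_deriv b v a) (b \<otimes>\<^bsub>G\<^esub> a) i j) (at 0)"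
    by (rule D\<phi>_curve[OF mult_closed[OF b a] left_mult_deriv(3)[OF b a v]])
  then have 1: "((\<lambda>t. inverse t *\<^sub>R (logL (chol (b \<otimes>\<^bsub>G\<^esub> (a + t *\<^sub>R v))) i j - logL (chol (b \<otimes>\<^bsub>G\<^esub> a)) i j)) \<longlongrightarrow>
      D\<phi> (left_deriv b v a) (b \<otimes>\<^bsub>G\<^esub> a) i j) (at 0)"
    by (simp add: has_vector_derivative_at_0_iff)
  have "\<forall>\<^sub>F t in at 0. inverse t *\<^sub>R (logL (chol (b \<otimes>\<^bsub>G\<^esub> (a + t *\<^sub>R v))) i j - logL (chol (b \<otimes>\<^bsub>G\<^esub> a)) i j) =
      inverse t *\<^sub>R (logL (chol (a + t *\<^sub>R v)) i j - logL (chol a) i j)"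
    using ev by eventually_elim (simp add: log a)
  from iffD1[OF tendsto_cong[OF this] 1]
  have 2: "((\<lambda>t. inverse t *\<^sub>R (logL (chol (a + t *\<^sub>R v)) i j - logL (chol a) i j)) \<longlongrightarrow>
      D\<phi> (left_deriv b v a) (b \<otimes>\<^bsub>G\<^esub> a) i j) (at 0)" .
  have "((\<lambda>t. inverse t *\<^sub>R (logL (chol (a + t *\<^sub>R v)) i j - logL (chol a) i j)) \<longlongrightarrow> D\<phi> v a i j) (at 0)"
    using D\<phi>_curve[OF a curve_in_line[OF line_U a v], of i j]
        by (simp add: has_vector_derivative_at_0_iff)
  from tendsto_unique[OF trivial_limit_at 2 this]
  show "D\<phi> (left_deriv b v a) (b \<otimes>\<^bsub>G\<^esub> a) i j = D\<phi> v a i j" .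
qed

lemma bi_invariant_riem: "bi_invariant_riemannian E G riem"
  unfolding bi_invariant_riemannian_def
proof (intro ballI conjI)
  fix a b v w assume a: "a \<in> U" and b: "b \<in> U" and v: "v \<in> E" and w: "w \<in> E"
  show left: "riem (b \<otimes>\<^bsub>G\<^esub> a) (dirderiv (\<lambda>x. b \<otimes>\<^bsub>G\<^esub> x) v a) (dirderiv (\<lambda>x. b \<otimes>\<^bsub>G\<^esub> x) w a) = riem a v w"
    unfolding left_deriv_def[symmetric] riem_ip[OF mult_closed[OF b a] left_mult_deriv(2)[OF b a v]
        left_mult_deriv(2)[OF b a w]]
      D\<phi>_left_deriv[OF b a v] D\<phi>_left_deriv[OF b a w] riem_ip[OF a v w] ..
  \<comment> \<open>Right translations coincide with left translations by commutativity.\<close>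
  have "dirderiv (\<lambda>x. x \<otimes>\<^bsub>G\<^esub> b) v a = dirderiv (\<lambda>x. b \<otimes>\<^bsub>G\<^esub> x) v a" if "v \<in> E" for v
    by (rule dirderiv_cong[OF line_U a that]) (rule G.m_comm[OF _ b])
  then show "riem (a \<otimes>\<^bsub>G\<^esub> b) (dirderiv (\<lambda>x. x \<otimes>\<^bsub>G\<^esub> b) v a) (dirderiv (\<lambda>x. x \<otimes>\<^bsub>G\<^esub> b) w a) = riem a v w"
    using left v w by (simp add: G.m_comm[OF a b])
qed


section \<open>Topology and completeness of the distances\<close>

lemma LT_dist_Fin:
  "LT_dist (Fin n) L K = sqrt ((\<Sum>(i, j)\<in>{(i, j). i < n \<and> j < i}. (cmod (L i j - K i j))\<^sup>2) +
    (\<Sum>j<n. (ln (Re (L j j)) - ln (Re (K j j)))\<^sup>2))"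
proof -
  have "finite {(i, j). i < n \<and> j < i}"
    by (rule finite_subset[of _ "{..<n} \<times> {..<n}"]) auto
  then show ?thesis by (simp add: LT_dist_def)
qed

lemma LT_dist_tendsto:
  assumes "\<And>i j. j < i \<Longrightarrow> i < n \<Longrightarrow> ((\<lambda>m. L m i j) \<longlongrightarrow> M i j) net"
    "\<And>j. j < n \<Longrightarrow> ((\<lambda>m. ln (Re (L m j j))) \<longlongrightarrow> ln (Re (M j j))) net"
  shows "((\<lambda>m. LT_dist (Fin n) M (L m)) \<longlongrightarrow> 0) net"
proof -
  have "((\<lambda>m. sqrt ((\<Sum>x\<in>{(i, j). i < n \<and> j < i}. (cmod (M (fst x) (snd x) - L m (fst x) (snd x)))\<^sup>2) +
      (\<Sum>j<n. (ln (Re (M j j)) - ln (Re (L m j j)))\<^sup>2))) \<longlongrightarrow>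
    sqrt ((\<Sum>x\<in>{(i, j). i < n \<and> j < i}. (cmod (M (fst x) (snd x) - M (fst x) (snd x)))\<^sup>2) +
      (\<Sum>j<n. (ln (Re (M j j)) - ln (Re (M j j)))\<^sup>2))) net"
    by (intro tendsto_real_sqrt tendsto_add tendsto_sum tendsto_power tendsto_norm tendsto_diff
        tendsto_const)
      (auto intro: assms)
  then show ?thesis by (simp add: LT_dist_Fin case_prod_unfold)
qed

lemma LT_dist_entry:
  shows "j < i \<Longrightarrow> i < n \<Longrightarrow> cmod (L i j - M i j) \<le> LT_dist (Fin n) L M"
    and "j < n \<Longrightarrow> \<bar>ln (Re (L j j)) - ln (Re (M j j))\<bar> \<le> LT_dist (Fin n) L M"
proof -
  let ?I = "{(i, j). i < n \<and> j < i}"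
  have fin: "finite ?I"
    by (rule finite_subset[of _ "{..<n} \<times> {..<n}"]) auto
  show "cmod (L i j - M i j) \<le> LT_dist (Fin n) L M" if "j < i" "i < n"
    unfolding LT_dist_Fin
  proof (rule real_le_rsqrt)
    have "(cmod (L i j - M i j))\<^sup>2 \<le> (\<Sum>(i, j)\<in>?I. (cmod (L i j - M i j))\<^sup>2)"
      using member_le_sum[of "(i, j)" ?I "\<lambda>(i, j). (cmod (L i j - M i j))\<^sup>2"] that fin by auto
    moreover have "0 \<le> (\<Sum>j<n. (ln (Re (L j j)) - ln (Re (M j j)))\<^sup>2)" by (intro sum_nonneg) simp
    ultimately show "(cmod (L i j - M i j))\<^sup>2 \<le> (\<Sum>(i, j)\<in>?I. (cmod (L i j - M i j))\<^sup>2) +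
        (\<Sum>j<n. (ln (Re (L j j)) - ln (Re (M j j)))\<^sup>2)" by simp
  qed
  show "\<bar>ln (Re (L j j)) - ln (Re (M j j))\<bar> \<le> LT_dist (Fin n) L M" if "j < n"
    unfolding LT_dist_Fin
  proof (rule real_le_rsqrt)
    have "(ln (Re (L j j)) - ln (Re (M j j)))\<^sup>2 \<le> (\<Sum>j<n. (ln (Re (L j j)) - ln (Re (M j j)))\<^sup>2)"
      using that by (intro member_le_sum) auto
    moreover have "0 \<le> (\<Sum>(i, j)\<in>?I. (cmod (L i j - M i j))\<^sup>2)" by (intro sum_nonneg) auto
    ultimately show "\<bar>ln (Re (L j j)) - ln (Re (M j j))\<bar>\<^sup>2 \<le> (\<Sum>(i, j)\<in>?I. (cmod (L i j - M i j))\<^sup>2) +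
        (\<Sum>j<n. (ln (Re (L j j)) - ln (Re (M j j)))\<^sup>2)" by simp
  qed
qed

text \<open>The distance controls the logarithms of the diagonal, and exponentiating returns to the
  entries themselves.\<close>

lemma LT_tendsto:
  assumes lim: "((\<lambda>m. LT_dist (Fin n) M (L m)) \<longlongrightarrow> 0) net"
    and M: "M \<in> LT (Fin n) F" and L: "\<forall>\<^sub>F m in net. L m \<in> LT (Fin n) F"
  shows "((\<lambda>m. L m i j) \<longlongrightarrow> M i j) net"
proof -
  consider "j < i" "i < n" | "i < j \<or> i \<ge> n" | "i = j" "i < n" by linarith
  then show ?thesis
  proof cases
    case 1
    have "((\<lambda>m. M i j - L m i j) \<longlongrightarrow> 0) net"
      by (rule Lim_null_comparison[OF always_eventually lim]) (use LT_dist_entry(1)[OF 1] in auto)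
    from tendsto_diff[OF tendsto_const[of "M i j"] this] show ?thesis by simp
  next
    case 2
    have "\<forall>\<^sub>F m in net. L m i j = M i j"
      using L
    proof eventually_elim
      case (elim m)
      have "N i j = 0" if "N \<in> LT (Fin n) F" for N
        using 2 LT_upper[OF that, of i j] LT_outside[OF that, of i j] by auto
      from this[OF elim] this[OF M] show ?case by simp
    qed
    then show ?thesis by (rule tendsto_eventually)
  next
    case 3
    have "((\<lambda>m. ln (Re (M j j)) - ln (Re (L m j j))) \<longlongrightarrow> 0) net"
      by (rule Lim_null_comparison[OF always_eventually lim]) (use LT_dist_entry(2)[of j M] 3 in auto)
    from tendsto_diff[OF tendsto_const[of "ln (Re (M j j))"] this]
    have "((\<lambda>m. complex_of_real (exp (ln (Re (L m j j))))) \<longlongrightarrow> complex_of_real (exp (ln (Re (M j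
        j))))) net"
      by (intro tendsto_of_real tendsto_exp) simp
    moreover have "\<forall>\<^sub>F m in net. complex_of_real (exp (ln (Re (L m j j)))) = L m j j"
      using L by eventually_elim (use LT_diag[of _ "Fin n" F j] 3 in force)
    moreover have "complex_of_real (exp (ln (Re (M j j)))) = M j j"
      using LT_diag[OF M, of j] 3 by force
    ultimately show ?thesis using 3 tendsto_cong by force
  qed
qed

text \<open>Below the diagonal limits are taken of the entries, on the diagonal of their logarithms.
  The diagonal of the limit is an exponential, so it cannot degenerate to 0, which is why the cone
  is complete.\<close>

lemma LT_limit:
  assumes L: "\<And>m. L m \<in> LT (Fin n) F"
    and cauchy: "\<And>e. 0 < e \<Longrightarrow> \<exists>N. \<forall>m\<ge>N. \<forall>m'\<ge>N. LT_dist (Fin n) (L m) (L m') < e"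
  shows "\<exists>M\<in>LT (Fin n) F. (\<lambda>m. LT_dist (Fin n) M (L m)) \<longlonglongrightarrow> 0"
proof -
  have "Cauchy (\<lambda>m. L m i j)" if "j < i" "i < n" for i j
  proof (rule metric_CauchyI)
    fix e :: real assume "0 < e"
    with cauchy obtain N where "\<And>m m'. m \<ge> N \<Longrightarrow> m' \<ge> N \<Longrightarrow> LT_dist (Fin n) (L m) (L m') < e" by blast
    then show "\<exists>N. \<forall>m\<ge>N. \<forall>m'\<ge>N. dist (L m i j) (L m' i j) < e"
      using LT_dist_entry(1)[OF that] unfolding dist_norm by (meson le_less_trans)
  qed
  then have lower: "\<exists>l. (\<lambda>m. L m i j) \<longlonglongrightarrow> l" if "j < i" "i < n" for i j
    using that Cauchy_convergent_iff convergent_def by blast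
  have "Cauchy (\<lambda>m. ln (Re (L m j j)))" if "j < n" for j
  proof (rule metric_CauchyI)
    fix e :: real assume "0 < e"
    with cauchy obtain N where "\<And>m m'. m \<ge> N \<Longrightarrow> m' \<ge> N \<Longrightarrow> LT_dist (Fin n) (L m) (L m') < e" by blast
    then show "\<exists>N. \<forall>m\<ge>N. \<forall>m'\<ge>N. dist (ln (Re (L m j j))) (ln (Re (L m' j j))) < e"
      using LT_dist_entry(2)[OF that] unfolding dist_real_def by (meson le_less_trans)
  qed
  then have diag: "\<exists>l. (\<lambda>m. ln (Re (L m j j))) \<longlonglongrightarrow> l" if "j < n" for j
    using that Cauchy_convergent_iff convergent_def by blast
  obtain a where a: "\<And>i j. j < i \<Longrightarrow> i < n \<Longrightarrow> (\<lambda>m. L m i j) \<longlonglongrightarrow> a i j"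
    using lower by metis
  obtain b where b: "\<And>j. j < n \<Longrightarrow> (\<lambda>m. ln (Re (L m j j))) \<longlonglongrightarrow> b j"
    using diag by metis
  define M where "M = (\<lambda>i j. if j < i \<and> i < n then a i j
    else if i = j \<and> i < n then complex_of_real (exp (b j)) else 0)"
  have "a i j \<in> F" if "j < i" "i < n" for i j
    by (rule Lim_in_closed_set[OF closed_F _ _ a[OF that]]) (use LT_field[OF L] in auto)
  then have "M \<in> LT (Fin n) F"
    using field_0[OF F_field] F_cases by (auto simp: LT.simps lower_tri_def M_def)
  moreover have "(\<lambda>m. LT_dist (Fin n) M (L m)) \<longlonglongrightarrow> 0"
    by (rule LT_dist_tendsto) (use a b in \<open>auto simp: M_def\<close>)
  ultimately show ?thesis by blast
qed

lemma \<Psi>_tendsto: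
  assumes "\<And>i j. ((\<lambda>m. L m i j) \<longlongrightarrow> M i j) net" "\<forall>\<^sub>F m in net. L m \<in> LT (Fin n) F" "M \<in> LT (Fin n) F"
  shows "((\<lambda>m. \<Psi> (L m) \<epsilon>) \<longlongrightarrow> \<Psi> M \<epsilon>) net"
  unfolding tendsto_matrix_iff
proof (intro allI)
  fix i j
  have t: "((\<lambda>m. tr (L m) i j) \<longlongrightarrow> tr M i j) net" for i j
    using tr_cases assms(1)[of i j] tendsto_cnj[OF assms(1)[of j i]] by (auto simp: ctrans_def)
  have "((\<lambda>m. \<Sum>k<n. dg \<epsilon> k * (tr (L m) i k * cnj (tr (L m) j k))) \<longlongrightarrow>
      (\<Sum>k<n. dg \<epsilon> k * (tr M i k * cnj (tr M j k)))) net"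
    by (intro tendsto_sum tendsto_mult tendsto_const tendsto_cnj t)
  moreover have "\<forall>\<^sub>F m in net. (\<Sum>k<n. dg \<epsilon> k * (tr (L m) i k * cnj (tr (L m) j k))) = \<Psi> (L m) \<epsilon> i j"
    using assms(2) by eventually_elim (simp only: \<Psi>_entry)
  ultimately show "((\<lambda>m. \<Psi> (L m) \<epsilon> i j) \<longlongrightarrow> \<Psi> M \<epsilon> i j) net"
    using tendsto_cong unfolding \<Psi>_entry[OF assms(3)] by fast
qed

text \<open>Once the distance is below 1 the signs agree, and entrywise convergence of the factors
  carries over to the matrices through \<open>\<Psi>\<close> with fixed signs.\<close>

lemma cone_dist_sequence:
  assumes p: "1 \<le> p" and x: "x \<in> U" and y: "\<And>m. y m \<in> U" and lim: "(\<lambda>m. cone_dist p x (y m)) \<longlonglongrightarrow> 0"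
  shows "y \<longlonglongrightarrow> x"
proof -
  have "(\<lambda>m. LT_dist (Fin n) (chol x) (chol (y m))) \<longlonglongrightarrow> 0"
    by (rule Lim_null_comparison[OF always_eventually lim])
      (use lp_norm2_lower(1)[OF p LT_dist_nonneg] LT_dist_nonneg in \<open>auto simp: cone_dist_def\<close>)
  then have t: "(\<lambda>m. chol (y m) i j) \<longlonglongrightarrow> chol x i j" for i j
    by (rule LT_tendsto) (use x y chol_LT in auto)
  have "\<forall>\<^sub>F m in sequentially. cone_dist p x (y m) < 1"
    using order_tendstoD(2)[OF lim, of 1] by simp
  then have sg: "\<forall>\<^sub>F m in sequentially. sg (y m) = sg x"
  proof eventually_elim
    case (elim m)
    then show ?case
      using lp_norm2_lower(2)[OF p LT_dist_nonneg, of "1 - (if sg x =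
          sg (y m) then 1 else 0)" "Fin n" "chol x" "chol (y m)"]
      by (auto simp: cone_dist_def split: if_splits)
  qed
  have "(\<lambda>m. \<Psi> (chol (y m)) (sg x)) \<longlonglongrightarrow> \<Psi> (chol x) (sg x)"
    by (rule \<Psi>_tendsto[OF t]) (use x y chol_LT in auto)
  moreover have "\<forall>\<^sub>F m in sequentially. \<Psi> (chol (y m)) (sg x) = y m"
    using sg by eventually_elim (use y chart_chol in metis)
  ultimately show ?thesis using tendsto_cong chart_chol[OF x] by force
qed

text \<open>Near \<open>x\<close> the signs are constant, so the distance reduces to that of the
  factors, which depend continuously on the matrix.\<close>

lemma cone_dist_tendsto:
  assumes p: "1 \<le> p" and x: "x \<in> U"
  shows "((\<lambda>y. cone_dist p x y) \<longlongrightarrow> 0) (at x within U)"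
proof -
  have c: "((\<lambda>y. chol y i j) \<longlongrightarrow> chol x i j) (at x within U)" for i j
    using elementary_continuous[OF chol_elementary] x by (auto simp: continuous_on)
  have "((\<lambda>y. LT_dist (Fin n) (chol x) (chol y)) \<longlongrightarrow> 0) (at x within U)"
    by (rule LT_dist_tendsto) (use LT_diag[OF chol_LT[OF x]]
        in \<open>force intro!: tendsto_ln tendsto_Re c\<close>)+
  moreover obtain W where W: "open W" "x \<in> W" "\<forall>B\<in>W \<inter> U. sg B = sg x" using sg_locally_const[OF x]
      by blast
  have "\<forall>\<^sub>F y in at x within U. cone_dist p x y \<le> LT_dist (Fin n) (chol x) (chol y)"
    unfolding eventually_at_topological
  proof (intro exI[of _ W] conjI ballI impI W)
    fix y assume "y \<in> W" "y \<in> U"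
    then have "sg y = sg x" using W by blast
    then show "cone_dist p x y \<le> LT_dist (Fin n) (chol x) (chol y)"
      using LT_dist_nonneg by (simp add: cone_dist_def lp_norm2_left[OF p])
  qed
  then have "\<forall>\<^sub>F y in at x within U. norm (cone_dist p x y) \<le> LT_dist (Fin n) (chol x) (chol y)"
    using lp_norm2_nonneg[OF p] by (simp add: cone_dist_def)
  ultimately show ?thesis by (rule Lim_null_comparison[rotated])
qed

text \<open>The two topologies agree by comparing neighbourhoods: continuity of the distance puts
  relatively open sets into balls, and convergence of sequences puts balls into relatively open
  sets.\<close>

lemma complete_separable:
  assumes p: "1 \<le> p"
  shows "complete_separable_metric_lie_group E G (cone_dist p)"
proof -
  interpret d: Metric_space U "cone_dist p"
    using bi_invariant_cone_dist[OF p] by (simp add: bi_invariant_metric_def)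
  have top: "d.mtopology = top_of_set U"
    unfolding topology_eq
  proof (intro allI iffI)
    fix S assume S: "openin d.mtopology S"
    show "openin (top_of_set U) S"
    proof (subst openin_subopen, intro ballI)
      fix x assume x: "x \<in> S"
      obtain r where r: "0 < r" "d.mball x r \<subseteq> S" and xU: "x \<in> U"
        using S x unfolding d.openin_mtopology by blast
      have "\<forall>\<^sub>F y in at x within U. cone_dist p x y < r"
        using order_tendstoD(2)[OF cone_dist_tendsto[OF p xU] r(1)] .
      then obtain W where W: "open W" "x \<in> W" "\<And>y. y \<in> W \<Longrightarrow> y \<noteq> x \<Longrightarrow> y \<in> U \<Longrightarrow> cone_dist p x y < r"
        unfolding eventually_at_topological by blast
      have "U \<inter> W \<subseteq> S"
        using W(3) r(2) x xU by (auto simp: subset_iff)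
      then show "\<exists>T. openin (top_of_set U) T \<and> x \<in> T \<and> T \<subseteq> S"
        using W(1,2) xU by (intro exI[of _ "U \<inter> W"]) (auto simp: openin_open)
    qed
  next
    fix S assume "openin (top_of_set U) S"
    then obtain W where W: "open W" "S = U \<inter> W" by (auto simp: openin_open)
    show "openin d.mtopology S"
      unfolding d.openin_mtopology
    proof (intro conjI allI impI)
      show "S \<subseteq> U" using W by blast
      fix x assume x: "x \<in> S"
      show "\<exists>r>0. d.mball x r \<subseteq> S"
      proof (rule ccontr)
        assume "\<not> (\<exists>r>0. d.mball x r \<subseteq> S)"
        \<comment> \<open>Shrinking balls around \<open>x\<close> of radii tending to 0 yield a
          sequence outside \<open>S\<close> that converges to \<open>x\<close> in the metric, hence
          in the ambient topology.\<close>
        then have "\<exists>y. y \<in> d.mball x (inverse (real (Suc m))) \<and> y \<notin> S" for m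
          by (metis inverse_positive_iff_positive of_nat_0_less_iff subsetI zero_less_Suc)
        then obtain y where y: "\<And>m. y m \<in> d.mball x (inverse (real (Suc m)))" "\<And>m. y m \<notin> S" by metis
        have yU: "y m \<in> U" and d: "cone_dist p x (y m) \<le> inverse (real (Suc m))" for m
          using y(1)[of m] by auto
        have "(\<lambda>m. cone_dist p x (y m)) \<longlonglongrightarrow> 0"
          by (rule Lim_null_comparison[OF always_eventually LIMSEQ_inverse_real_of_nat]) (use d in simp)
        then have "y \<longlonglongrightarrow> x" using x W yU by (intro cone_dist_sequence[OF p]) auto
        then have "\<forall>\<^sub>F m in sequentially. y m \<in> W" by (rule topological_tendstoD) (use W x in auto)
        then show False using y(2) yU W by (auto simp: eventually_sequentially)
      qed
    qed
  qed
  have complete: "d.mcomplete"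
    unfolding d.mcomplete_def
  proof (intro allI impI)
    fix \<sigma> assume \<sigma>: "d.MCauchy \<sigma>"
    then have \<sigma>U: "\<sigma> m \<in> U" for m by (auto simp: d.MCauchy_def)
    have cauchy: "\<exists>N. \<forall>m\<ge>N. \<forall>m'\<ge>N. cone_dist p (\<sigma> m) (\<sigma> m') < e" if "0 < e" for e
      using \<sigma> that unfolding d.MCauchy_def by meson
    have le: "LT_dist (Fin n) (chol A) (chol B) \<le> cone_dist p A B" for A B
      unfolding cone_dist_def by (rule lp_norm2_lower(1)[OF p LT_dist_nonneg]) simp
    have "\<exists>M\<in>LT (Fin n) F. (\<lambda>m. LT_dist (Fin n) M (chol (\<sigma> m))) \<longlonglongrightarrow> 0"
    proof (rule LT_limit)
      show "chol (\<sigma> m) \<in> LT (Fin n) F" for m by (rule chol_LT[OF \<sigma>U])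
      fix e :: real assume "0 < e"
      then show "\<exists>N. \<forall>m\<ge>N. \<forall>m'\<ge>N. LT_dist (Fin n) (chol (\<sigma> m)) (chol (\<sigma> m')) < e"
        using cauchy[of e] le by (meson le_less_trans)
    qed
    then obtain M where M: "M \<in> LT (Fin n) F" "(\<lambda>m. LT_dist (Fin n) M (chol (\<sigma> m))) \<longlonglongrightarrow> 0" by blast
    \<comment> \<open>Beyond a Cauchy index for the threshold 1 the signs are constant; they become
      the signs of the limit.\<close>
    obtain N where N: "\<And>m m'. m \<ge> N \<Longrightarrow> m' \<ge> N \<Longrightarrow> cone_dist p (\<sigma> m) (\<sigma> m') < 1"
      using cauchy[of 1] by auto
    have sg: "sg (\<sigma> m) = sg (\<sigma> N)" if "m \<ge> N" for m
      using N[OF that order_refl] lp_norm2_lower(2)[OF p LT_dist_nonneg,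
          of "1 - (if sg (\<sigma> m) = sg (\<sigma> N) then 1 else 0)" "Fin n" "chol (\<sigma> m)" "chol (\<sigma> N)"]
      by (auto simp: cone_dist_def split: if_splits)
    define x where "x = \<Psi> M (sg (\<sigma> N))"
    have x: "x \<in> U" "chol x = M" "sg x = sg (\<sigma> N)"
      unfolding x_def using M(1) sg_signs[OF \<sigma>U] by (auto simp: chart_carrier chol_chart sg_chart)
    have "\<forall>\<^sub>F m in sequentially. cone_dist p (\<sigma> m) x = LT_dist (Fin n) M (chol (\<sigma> m))"
      unfolding eventually_sequentially
    proof (intro exI[of _ N] allI impI)
      fix m assume m: "N \<le> m"
      have "cone_dist p (\<sigma> m) x = LT_dist (Fin n) (chol (\<sigma> m)) M"
        using LT_dist_nonneg by (simp add: cone_dist_def x sg[OF m] lp_norm2_left[OF p])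
      then show "cone_dist p (\<sigma> m) x = LT_dist (Fin n) M (chol (\<sigma> m))"
        by (rule trans[OF _ LT_dist_commute])
    qed
    from iffD2[OF tendsto_cong[OF this] M(2)] have lim: "(\<lambda>m. cone_dist p (\<sigma> m) x) \<longlonglongrightarrow> 0" .
    have "limitin d.mtopology \<sigma> x sequentially"
      unfolding d.limitin_metric_dist_null by (intro conjI x(1) lim always_eventually allI \<sigma>U)
    then show "\<exists>x. limitin d.mtopology \<sigma> x sequentially" by (intro exI[of _ x])
  qed
  \<comment> \<open>Second countability passes to subspaces and implies separability, which in
    general is not inherited.\<close>
  have "second_countable (euclidean :: cmat topology)"
  proof -
    obtain B :: "cmat set set" where B: "countable B" "\<And>C. C \<in> B \<Longrightarrow> open C"
      "\<And>S. open S \<Longrightarrow> \<exists>V. V \<subseteq> B \<and> S = \<Union>V" using univ_second_countable by metis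
    show ?thesis
      unfolding second_countable_def
    proof (intro exI[of _ B] conjI ballI allI impI)
      fix S x assume Sx: "openin (euclidean :: cmat topology) S \<and> x \<in> S"
      then obtain V where "V \<subseteq> B" "S = \<Union>V" using B(3)[of S] by auto
      then show "\<exists>V\<in>B. x \<in> V \<and> V \<subseteq> S" using Sx by blast
    qed (use B in auto)
  qed
  then have "separable_space (top_of_set U)"
    by (intro second_countable_imp_separable_space second_countable_subtopology)
  then show ?thesis
    unfolding complete_separable_metric_lie_group_def
    using lie_group_G bi_invariant_cone_dist[OF p] top complete by simp
qed

end

section \<open>The real and complex cones\<close>

lemma leading_minor_sum:
  "leading_minor k A = (\<Sum>p | p permutes {0..<k}. of_int (sign p) * (\<Prod>i = 0..<k. A i (p i)))"
  unfolding leading_minor_def Determinant.det_def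
  by (auto intro!: sum.cong prod.cong simp: permutes_in_image)

lemma continuous_on_leading_minor: "continuous_on UNIV (leading_minor k)"
  unfolding leading_minor_sum
  by (intro continuous_on_sum continuous_on_mult continuous_on_const continuous_on_prod
      continuous_on_entry)

text \<open>Conjugating a Hermitian matrix transposes it, and transposition preserves the
  determinant.\<close>

lemma leading_minor_real:
  assumes "A \<in> herm n F"
  shows "leading_minor k A \<in> \<real>"
proof -
  have "cnj (leading_minor k A) = leading_minor k (\<lambda>i j. A j i)"
    unfolding leading_minor_sum using herm_entries(3)[OF assms] by simp
  also have "\<dots> = Determinant.det (transpose_mat (Matrix.mat k k (\<lambda>(i, j). A i j)))"
    unfolding leading_minor_def by (intro arg_cong[where f = Determinant.det] eq_matI) auto
  also have "\<dots> = leading_minor k A"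
    unfolding leading_minor_def by (rule Determinant.det_transpose[of _ k]) simp
  finally show ?thesis by (simp add: Reals_cnj_iff)
qed

text \<open>Replaces equations for signs by strict inequalities, which are open conditions because
  minors are continuous.\<close>

lemma LPMn_iff:
  assumes \<epsilon>: "\<epsilon> \<in> signs (Fin n)"
  shows "A \<in> LPMn n F \<epsilon> \<longleftrightarrow> A \<in> herm n F \<and> (\<forall>k\<in>{1..n}. 0 < Re (leading_minor k A) * \<epsilon> (k - 1))"
proof -
  have "sgn (leading_minor k A) = complex_of_real (\<epsilon> (k - 1)) \<longleftrightarrow> 0 < Re (leading_minor k A) * \<epsilon> (k - 1)"
    if A: "A \<in> herm n F" and k: "k \<in> {1..n}" for k
  proof -
    obtain r where r: "leading_minor k A = complex_of_real r"
      using leading_minor_real[OF A] Reals_cases by blast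
    have "\<epsilon> (k - 1) = 1 \<or> \<epsilon> (k - 1) = -1" using k by (intro signs_cases[OF \<epsilon>]) auto
    then show ?thesis unfolding r sgn_of_real of_real_eq_iff by (elim disjE) (simp_all add: sgn_if)
  qed
  then show ?thesis by (auto simp: LPMn_def)
qed

lemma open_minor_signs: "open {A::cmat. \<forall>k\<in>{1..n}. 0 < Re (leading_minor k A) * \<epsilon> (k - 1)}"
proof -
  have "{A::cmat. \<forall>k\<in>{1..n}. 0 < Re (leading_minor k A) * \<epsilon> (k - 1)} =
      (\<Inter>k\<in>{1..n}. {A. 0 < Re (leading_minor k A) * \<epsilon> (k - 1)})" by auto
  moreover have "open (\<Inter>k\<in>{1..n}. {A::cmat. 0 < Re (leading_minor k A) * \<epsilon> (k - 1)})"
    by (intro open_INT ballI open_Collect_less continuous_on_mult continuous_on_const continuous_on_Re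
        continuous_on_leading_minor) simp
  ultimately show ?thesis by simp
qed

lemma linear_reversal: "linear (reversal n)"
  by (rule linearI) (auto simp: fun_eq_iff reversal_entry scaleR_fun_def)

lemma continuous_reversal: "continuous_on UNIV (reversal n)"
proof (intro continuous_on_coordinatewise_then_product)
  fix i j
  show "continuous_on UNIV (\<lambda>A. reversal n A i j)"
    unfolding reversal_entry
    by (cases "i < n \<and> j < n")
      (simp_all only: if_True if_False simp_thms continuous_on_const continuous_on_cnj[OF
          continuous_on_entry])
qed

context real_or_complex
begin

lemma F_sub: "is_subfield F"
  and F_sq: "\<forall>x::real. 0 < x \<and> complex_of_real x \<in> F \<longrightarrow> complex_of_real (sqrt x) \<in> F"
  and F_core: "conj_core F = F"
  using F_field conj_core_eq[OF F_field] by (auto simp: conj_field_def)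

interpretation L: cone_chart "Fin n" F "ldl (Fin n)" "LPM_group (Fin n) F" "lpm_chol (Fin n) F"
    "lpm_sign (Fin n) F" for n
  using cone_chart_LPM[OF F_sub F_sq, of "Fin n"] unfolding F_core .

interpretation T: cone_chart "Fin n" F "tldl n" "TPM_group n F" "tpm_chol n F" "tpm_sign n F" for n
  using cone_chart_TPM[OF F_sub F_sq, of n] unfolding F_core .

lemma carrier_LPM: "carrier (LPM_group (Fin n) F) = LPM_all (Fin n) F"
  and carrier_TPM: "carrier (TPM_group n F) = TPM_all n F"
  by (simp_all add: LPM_group_def TPM_group_def)

lemma LPM_all_Fin: "LPM_all (Fin n) F = (\<Union>\<epsilon>\<in>signs (Fin n). LPMn n F \<epsilon>)"
  by (simp add: LPM_all_def)

lemma TPM_all_reversal: "TPM_all n F = reversal n ` LPM_all (Fin n) F"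
  unfolding TPM_all_def LPM_all_Fin TPM_reversal by blast

lemma LPM_all_herm: "A \<in> LPM_all (Fin n) F \<Longrightarrow> A \<in> herm n F"
  unfolding LPM_all_Fin by (auto simp: LPMn_def)

lemma reversal_LPM: "A \<in> LPM_all (Fin n) F \<Longrightarrow> reversal n A \<in> TPM_all n F"
  by (simp add: TPM_all_reversal)

lemma reversal_TPM: "A \<in> TPM_all n F \<Longrightarrow> reversal n A \<in> LPM_all (Fin n) F \<and> reversal n (reversal n A) = A"
  unfolding TPM_all_reversal using reversal_herm(3)[OF LPM_all_herm] by auto

lemma lpm_sign_LPMn:
  assumes "A \<in> LPMn n F \<epsilon>" "\<epsilon> \<in> signs (Fin n)"
  shows "lpm_sign (Fin n) F A = \<epsilon>"
  using assms LPM_eq[OF F_sub F_sq assms(2)] lpm_sign_ldl[OF F_sub F_sq _ assms(2)] by auto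

lemma LPM_open: "openin (top_of_set (herm n F)) (LPM_all (Fin n) F)"
proof -
  have "openin (top_of_set (herm n F)) (LPMn n F \<epsilon>)" if "\<epsilon> \<in> signs (Fin n)" for \<epsilon>
  proof -
    have "LPMn n F \<epsilon> = herm n F \<inter> {A. \<forall>k\<in>{1..n}. 0 < Re (leading_minor k A) * \<epsilon> (k - 1)}"
      using LPMn_iff[OF that] by blast
    then show ?thesis using open_minor_signs unfolding openin_open by blast
  qed
  then show ?thesis unfolding LPM_all_Fin by (intro openin_Union) blast
qed

text \<open>The same sign inequalities cut out an open set whose Hermitian members all have the sign
  sequence of \<open>A\<close>.\<close>

lemma lpm_sign_locally_const:
  assumes "A \<in> LPM_all (Fin n) F"
  shows "\<exists>W. open W \<and> A \<in> W \<and> (\<forall>B\<in>W \<inter> LPM_all (Fin n) F. lpm_sign (Fin n) F B = lpm_sign (Fin n) F A)"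
proof -
  obtain \<epsilon> where \<epsilon>: "\<epsilon> \<in> signs (Fin n)" "A \<in> LPMn n F \<epsilon>" using assms unfolding LPM_all_Fin by blast
  let ?W = "{A::cmat. \<forall>k\<in>{1..n}. 0 < Re (leading_minor k A) * \<epsilon> (k - 1)}"
  have "A \<in> ?W" using \<epsilon> LPMn_iff[OF \<epsilon>(1)] by blast
  moreover have "lpm_sign (Fin n) F B = lpm_sign (Fin n) F A" if "B \<in> ?W \<inter> LPM_all (Fin n) F" for B
  proof -
    have "B \<in> LPMn n F \<epsilon>" using that LPM_all_herm LPMn_iff[OF \<epsilon>(1)] by blast
    then show ?thesis using \<epsilon> lpm_sign_LPMn by simp
  qed
  ultimately show ?thesis using open_minor_signs by blast
qed

text \<open>Induction over the columns. Solving \<open>ldl_entry\<close> for column \<open>j\<close>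
  expresses its diagonal entry as a square root and its other entries as quotients, formed from
  entries of \<open>A\<close>, earlier columns and locally constant signs.\<close>

lemma lpm_chol_elementary: "elementary (LPM_all (Fin n) F) (\<lambda>A. lpm_chol (Fin n) F A i j)"
proof (induction j arbitrary: i rule: less_induct)
  case (less j)
  let ?U = "LPM_all (Fin n) F"
  let ?L = "lpm_chol (Fin n) F"
  let ?\<delta> = "\<lambda>A k. sign_diag (Fin n) (lpm_sign (Fin n) F A) k k"
  let ?S = "\<lambda>A i. \<Sum>k<j. ?L A i k * ?\<delta> A k * cnj (?L A j k)"
  have LT: "?L A \<in> LT (Fin n) F" and sg: "lpm_sign (Fin n) F A \<in> signs (Fin n)"
    and A: "ldl (Fin n) (?L A) (lpm_sign (Fin n) F A) = A" if "A \<in> ?U" for A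
    using L.chol_LT L.sg_signs L.chart_chol that unfolding carrier_LPM by auto
  have \<delta>: "elementary ?U (\<lambda>A. ?\<delta> A k)" for k
  proof (rule elementary.locally_const)
    fix A assume "A \<in> ?U"
    from lpm_sign_locally_const[OF this] obtain W where "open W" "A \<in> W"
      "\<forall>B\<in>W \<inter> ?U. lpm_sign (Fin n) F B = lpm_sign (Fin n) F A" by blast
    then show "\<exists>W. open W \<and> A \<in> W \<and> (\<forall>B\<in>W \<inter> ?U. ?\<delta> B k = ?\<delta> A k)"
      by (intro exI[of _ W]) auto
  qed
  have S: "elementary ?U (\<lambda>A. A i j - ?S A i)" for i
    by (intro elementary_diff elementary_entry elementary_sum elementary.mult elementary.cnj \<delta> less)
        auto
  have eq: "A i j - ?S A i = ?L A i j * ?\<delta> A j * cnj (?L A j j)" if "A \<in> ?U" for A i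
  proof -
    have "A i j = ldl (Fin n) (?L A) (lpm_sign (Fin n) F A) i j" using A[OF that] by simp
    also have "\<dots> = ?S A i + ?L A i j * ?\<delta> A j * cnj (?L A j j)"
      by (subst ldl_entry[OF LT_lower[OF LT[OF that]] lessI]) simp
    finally show ?thesis by simp
  qed
  consider "i < j \<or> i \<ge> n \<or> j \<ge> n" | "j \<le> i" "i < n" "j < n" by linarith
  then show ?case
  proof cases
    case 1
    have "?L A i j = 0" if "A \<in> ?U" for A
      using 1 LT_upper[OF LT[OF that], of i j] LT_outside[OF LT[OF that], of i j] by auto
    then show ?thesis by (rule elementary.cong[OF elementary_const])
  next
    case 2
    have diag: "\<exists>a d. ?L A j j = complex_of_real a \<and> 0 < a \<and> ?\<delta> A j = complex_of_real d \<and> (d = 1 \<or>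
        d = -1)"
      if "A \<in> ?U" for A
      using LT_diag[OF LT[OF that], of j] pivot_sign_cases[OF sg[OF that],
          of j] 2 sign_diag_diag[of j "Fin n"]
      by auto
    have q: "?\<delta> A j * (A j j - ?S A j) = complex_of_real ((Re (?L A j j))\<^sup>2)" if "A \<in> ?U" for A
      using diag[OF that] unfolding eq[OF that] by (auto simp: power2_eq_square)
    have pos: "0 < Re (?L A j j)" "complex_of_real (Re (?L A j j)) = ?L A j j" if "A \<in> ?U" for A
      using diag[OF that] by auto
    have "elementary ?U (\<lambda>A. complex_of_real (sqrt (Re (?\<delta> A j * (A j j - ?S A j)))))"
      by (rule elementary.sqrt[OF elementary.mult[OF \<delta> S]]) (use q pos(1)
          in \<open>simp add: less_imp_neq[symmetric]\<close>)
    then have Ljj: "elementary ?U (\<lambda>A. ?L A j j)"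
    proof (rule elementary.cong)
      fix A assume A: "A \<in> ?U"
      show "?L A j j = complex_of_real (sqrt (Re (?\<delta> A j * (A j j - ?S A j))))"
        unfolding q[OF A] using pos[OF A] by (simp only: Re_complex_of_real real_sqrt_abs abs_of_pos)
    qed
    have ne: "?\<delta> A j * cnj (?L A j j) \<noteq> 0" if "A \<in> ?U" for A
      using diag[OF that] by auto
    have "elementary ?U (\<lambda>A. (A i j - ?S A i) * inverse (?\<delta> A j * cnj (?L A j j)))"
      by (intro elementary.mult elementary.inverse elementary.cnj S \<delta> Ljj) (use ne in auto)
    then show ?thesis
    proof (rule elementary.cong)
      fix A assume A: "A \<in> ?U"
      show "?L A i j = (A i j - ?S A i) * inverse (?\<delta> A j * cnj (?L A j j))"
        unfolding eq[OF A] mult.assoc[of "?L A i j"] right_inverse[OF ne[OF A]] by simp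
    qed
  qed
qed

lemma LPM_chart:
  "manifold_chart n F (ldl (Fin n)) (LPM_group (Fin n) F) (lpm_chol (Fin n) F) (lpm_sign (Fin n) F)
    (\<lambda>L. L) (\<lambda>\<epsilon> k. sign_diag (Fin n) \<epsilon> k k)"
proof (unfold_locales)
  fix L \<epsilon> i j assume L: "L \<in> LT (Fin n) F"
  show "ldl (Fin n) L \<epsilon> i j = (\<Sum>k<n. sign_diag (Fin n) \<epsilon> k k * (L i k * cnj (L j k)))"
  proof (cases "j < n")
    case True
    then show ?thesis by (simp add: ldl_entry[OF LT_lower[OF L] True] mult_ac)
  next
    case False
    then show ?thesis using LT_outside[OF L, of j] by (simp add: ldl_support[OF L])
  qed
qed (auto simp: carrier_LPM intro: LPM_open lpm_chol_elementary lpm_sign_locally_const)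

section \<open>Transport by reversal\<close>

lemma reversal_ldl:
  "L \<in> LT (Fin n) F \<Longrightarrow> reversal n (ldl (Fin n) L \<epsilon>) = tldl n (reversal n L) \<epsilon>"
  using tldl_reversal[OF reversal_LT[OF F_field], of L n \<epsilon>] reversal_reversal_LT[of L n F] by simp

lemma
  assumes "A \<in> LPM_all (Fin n) F"
  shows tpm_chol_reversal: "tpm_chol n F (reversal n A) = reversal n (lpm_chol (Fin n) F A)"
    and tpm_sign_reversal: "tpm_sign n F (reversal n A) = lpm_sign (Fin n) F A"
proof -
  have A: "lpm_chol (Fin n) F A \<in> LT (Fin n) F" "lpm_sign (Fin n) F A \<in> signs (Fin n)"
    "ldl (Fin n) (lpm_chol (Fin n) F A) (lpm_sign (Fin n) F A) = A"
    using L.chol_LT L.sg_signs L.chart_chol assms unfolding carrier_LPM by auto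
  have "reversal n A = tldl n (reversal n (lpm_chol (Fin n) F A)) (lpm_sign (Fin n) F A)"
    using reversal_ldl[OF A(1)] A(3) by metis
  then show "tpm_chol n F (reversal n A) = reversal n (lpm_chol (Fin n) F A)"
    "tpm_sign n F (reversal n A) = lpm_sign (Fin n) F A"
    using T.chol_chart T.sg_chart reversal_LT[OF F_field A(1)] A(2) by auto
qed

text \<open>Reversal permutes the diagonal positions and the positions below the diagonal, up to
  conjugation, so it respects both the addition and the multiplication from which
  \<open>LT_mult\<close> is built.\<close>

lemma reversal_mult:
  assumes "A \<in> LPM_all (Fin n) F" "B \<in> LPM_all (Fin n) F"
  shows "reversal n (A \<otimes>\<^bsub>LPM_group (Fin n) F\<^esub> B) = reversal n A \<otimes>\<^bsub>TPM_group n F\<^esub> reversal n B"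
proof (rule T.chart_eqI)
  have AB: "A \<otimes>\<^bsub>LPM_group (Fin n) F\<^esub> B \<in> LPM_all (Fin n) F"
    using L.mult_closed assms unfolding carrier_LPM .
  show "reversal n (A \<otimes>\<^bsub>LPM_group (Fin n) F\<^esub> B) \<in> carrier (TPM_group n F)"
    unfolding carrier_TPM by (rule reversal_LPM[OF AB])
  have T: "reversal n A \<in> carrier (TPM_group n F)" "reversal n B \<in> carrier (TPM_group n F)"
    using assms by (auto simp: carrier_TPM reversal_LPM)
  then show "reversal n A \<otimes>\<^bsub>TPM_group n F\<^esub> reversal n B \<in> carrier (TPM_group n F)"
    by (rule T.mult_closed)
  have "reversal n (LT_mult L L') = LT_mult (reversal n L) (reversal n L')" for L L' :: cmat
    by (auto simp: fun_eq_iff reversal_entry LT_mult_def)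
  then show "tpm_chol n F (reversal n (A \<otimes>\<^bsub>LPM_group (Fin n) F\<^esub> B)) =
      tpm_chol n F (reversal n A \<otimes>\<^bsub>TPM_group n F\<^esub> reversal n B)"
    using assms by (simp add: T.chol_mult[OF T] tpm_chol_reversal AB L.chol_mult carrier_LPM)
  show "tpm_sign n F (reversal n (A \<otimes>\<^bsub>LPM_group (Fin n) F\<^esub> B)) =
      tpm_sign n F (reversal n A \<otimes>\<^bsub>TPM_group n F\<^esub> reversal n B)"
    using assms by (simp add: T.sg_mult[OF T] tpm_sign_reversal AB L.sg_mult carrier_LPM)
qed

lemma TPM_open: "openin (top_of_set (herm n F)) (TPM_all n F)"
proof -
  obtain W where W: "open W" "LPM_all (Fin n) F = herm n F \<inter> W"
    using LPM_open unfolding openin_open by blast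
  have "TPM_all n F = herm n F \<inter> reversal n -` W"
  proof (intro subset_antisym subsetI)
    fix A assume "A \<in> TPM_all n F"
    then have "reversal n A \<in> herm n F \<inter> W" "reversal n (reversal n A) = A"
      using reversal_TPM W(2) by auto
    then show "A \<in> herm n F \<inter> reversal n -` W" using reversal_herm(1)[of "reversal n A" n F] by auto
  next
    fix A assume "A \<in> herm n F \<inter> reversal n -` W"
    then have "reversal n A \<in> LPM_all (Fin n) F" "reversal n (reversal n A) = A"
      using reversal_herm[of A n F] W(2) by auto
    then show "A \<in> TPM_all n F" using reversal_LPM by metis
  qed
  moreover have "open (reversal n -` W)" by (rule open_vimage[OF W(1) continuous_reversal])
  ultimately show ?thesis unfolding openin_open by blast
qed

text \<open>Openness, local constancy of the signs and elementarity of the factor are transported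
  from the leading cone, since reversal is linear, continuous and its own inverse on the
  cones.\<close>

lemma TPM_chart:
  "manifold_chart n F (tldl n) (TPM_group n F) (tpm_chol n F) (tpm_sign n F)
    ctrans (\<lambda>\<epsilon> k. sign_diag (Fin n) \<epsilon> (n - 1 - k) (n - 1 - k))"
proof (unfold_locales)
  fix L \<epsilon> i j assume L: "L \<in> LT (Fin n) F"
  show "tldl n L \<epsilon> i j = (\<Sum>k<n. sign_diag (Fin n) \<epsilon> (n - 1 - k) (n - 1 - k) * (ctrans L i k * cnj
      (ctrans L j k)))"
    unfolding tldl_entry[OF L] by (simp add: ctrans_def mult_ac)
next
  fix A assume "A \<in> carrier (TPM_group n F)"
  then have A: "reversal n A \<in> LPM_all (Fin n) F" "reversal n (reversal n A) = A"
    using reversal_TPM unfolding carrier_TPM by auto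
  obtain W where W: "open W" "reversal n A \<in> W"
    "\<forall>B\<in>W \<inter> LPM_all (Fin n) F. lpm_sign (Fin n) F B = lpm_sign (Fin n) F (reversal n A)"
    using lpm_sign_locally_const[OF A(1)] by blast
  show "\<exists>W. open W \<and> A \<in> W \<and> (\<forall>B\<in>W \<inter> carrier (TPM_group n F). tpm_sign n F B = tpm_sign n F A)"
  proof (intro exI[of _ "reversal n -` W"] conjI ballI)
    show "open (reversal n -` W)" by (rule open_vimage[OF W(1) continuous_reversal])
    show "A \<in> reversal n -` W" using W(2) by simp
    fix B assume "B \<in> reversal n -` W \<inter> carrier (TPM_group n F)"
    then have B: "reversal n B \<in> W \<inter> LPM_all (Fin n) F" "reversal n (reversal n B) = B"
      using reversal_TPM unfolding carrier_TPM by auto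
    then show "tpm_sign n F B = tpm_sign n F A"
      using tpm_sign_reversal[of "reversal n B" n] tpm_sign_reversal[OF A(1)] A(2) W(3) by auto
  qed
next
  fix i j
  have "elementary (TPM_all n F) (\<lambda>A. lpm_chol (Fin n) F (reversal n A) i j)" for i j
    by (rule elementary_linear_comp[OF lpm_chol_elementary linear_reversal continuous_reversal])
      (use reversal_TPM in auto)
  then have "elementary (TPM_all n F) (\<lambda>A. reversal n (lpm_chol (Fin n) F (reversal n A)) i j)"
    unfolding reversal_entry by (cases "i < n \<and> j < n") (auto intro: elementary.cnj elementary_const)
  then show "elementary (carrier (TPM_group n F)) (\<lambda>A. tpm_chol n F A i j)"
    unfolding carrier_TPM
  proof (rule elementary.cong)
    fix A assume "A \<in> TPM_all n F"
    then show "tpm_chol n F A i j = reversal n (lpm_chol (Fin n) F (reversal n A)) i j"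
      using reversal_TPM tpm_chol_reversal[of "reversal n A" n] by metis
  qed
qed (auto simp: carrier_TPM intro: TPM_open)

interpretation LM: manifold_chart n F "ldl (Fin n)" "LPM_group (Fin n) F" "lpm_chol (Fin n) F"
    "lpm_sign (Fin n) F" "\<lambda>L. L" "\<lambda>\<epsilon> k. sign_diag (Fin n) \<epsilon> k k" for n
  by (rule LPM_chart)

interpretation TM: manifold_chart n F "tldl n" "TPM_group n F" "tpm_chol n F"
    "tpm_sign n F" ctrans "\<lambda>\<epsilon> k. sign_diag (Fin n) \<epsilon> (n - 1 - k) (n - 1 - k)" for n
  by (rule TPM_chart)

lemma reversal_dist:
  assumes "A \<in> LPM_all (Fin n) F" "B \<in> LPM_all (Fin n) F"
  shows "tpm_dist n F p (reversal n A) (reversal n B) = lpm_dist (Fin n) F p A B"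
proof -
  have "LT_dist (Fin n) (reversal n L) (reversal n K) = LT_dist (Fin n) L K" for L K :: cmat
  proof -
    let ?I = "{(i, j). i < n \<and> j < i}"
    have "(\<Sum>(i, j)\<in>?I. (cmod (reversal n L i j - reversal n K i j))\<^sup>2) = (\<Sum>(i,
        j)\<in>?I. (cmod (L i j - K i j))\<^sup>2)"
      \<comment> \<open>Reflection in the antidiagonal is an involution of the index pairs strictly
        below the diagonal.\<close>
      by (rule sum.reindex_bij_witness[where i = "\<lambda>(i, j). (n - 1 - j, n - 1 - i)" and j = "\<lambda>(i,
          j). (n - 1 - j, n - 1 - i)"])
        (auto simp: reversal_entry simp flip: complex_cnj_diff)
    moreover have "(\<Sum>j<n. (ln (Re (reversal n L j j)) - ln (Re (reversal n K j j)))\<^sup>2) =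
        (\<Sum>j<n. (ln (Re (L (n - Suc j) (n - Suc j))) - ln (Re (K (n - Suc j) (n - Suc j))))\<^sup>2)"
      by (simp add: reversal_entry)
    ultimately show ?thesis
      unfolding LM.LT_dist_Fin
      by (simp add: sum.nat_diff_reindex[where g = "\<lambda>j. (ln (Re (L j j)) - ln (Re (K j j)))\<^sup>2"])
  qed
  then show ?thesis using assms
    by (simp add: tpm_dist_def lpm_dist_def tpm_chol_reversal tpm_sign_reversal)
qed

lemma reversal_elementary: "elementary U (\<lambda>A. reversal n A i j)"
  unfolding reversal_entry
  by (cases "i < n \<and> j < n") (auto intro: elementary.cnj elementary_entry elementary_const)

lemma reversal_iso: "lie_group_iso (herm n F) (LPM_group (Fin n) F) (herm n F) (TPM_group n F)
    (reversal n)"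
  unfolding lie_group_iso_def
proof (intro conjI)
  have bij: "bij_betw (reversal n) (carrier (LPM_group (Fin n) F)) (carrier (TPM_group n F))"
    unfolding carrier_LPM carrier_TPM
    by (rule bij_betwI[where g = "reversal n"])
      (use reversal_LPM reversal_TPM reversal_herm(3)[OF LPM_all_herm] in auto)
  show "reversal n \<in> iso (LPM_group (Fin n) F) (TPM_group n F)"
    unfolding iso_def using bij reversal_LPM reversal_mult
        by (auto simp: hom_def carrier_LPM carrier_TPM)
  show "smooth_on (herm n F) (carrier (LPM_group (Fin n) F)) (reversal n)"
    by (rule smooth_on_matrix[OF LM.line_U reversal_elementary])
  show "smooth_on (herm n F) (carrier (TPM_group n F)) (inv_into (carrier (LPM_group (Fin n) F))
      (reversal n))"
  proof (rule smooth_on_matrix[OF TM.line_U elementary.cong[OF reversal_elementary]])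
    fix i j A assume A: "A \<in> carrier (TPM_group n F)"
    have "inv_into (carrier (LPM_group (Fin n) F)) (reversal n) A = reversal n A"
      by (rule inv_into_f_eq[OF bij_betw_imp_inj_on[OF bij]])
        (use A reversal_TPM in \<open>auto simp: carrier_LPM carrier_TPM\<close>)
    then show "inv_into (carrier (LPM_group (Fin n) F)) (reversal n) A i j = reversal n A i j" by simp
  qed
qed

text \<open>Taking factors intertwines reversal on the two cones, and reversal is linear, so the
  derivative of the trailing factor is the reversed derivative of the leading one. The metric on
  factors is invariant under reversal by reindexing.\<close>

lemma reversal_riem:
  "riemannian_isometry_on (herm n F) (LPM_all (Fin n) F) (lpm_riem n F) (tpm_riem n F) (reversal n)"
  unfolding riemannian_isometry_on_def
proof (intro ballI)
  let ?L = "lpm_chol (Fin n) F"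
  fix x v w assume x: "x \<in> LPM_all (Fin n) F" and v: "v \<in> herm n F" and w: "w \<in> herm n F"
  \<comment> \<open>A linear map is its own derivative: its difference quotients are constant for
    nonzero \<open>t\<close>.\<close>
  have rev: "dirderiv (reversal n) v x = reversal n v" if "v \<in> herm n F" for v
  proof (rule dirderiv_eqI)
    have "\<forall>\<^sub>F t in at (0::real). inverse t *\<^sub>R (reversal n (x + t *\<^sub>R v) - reversal n x) = reversal n v"
      unfolding eventually_at_topological
      by (intro exI[of _ UNIV]) (auto simp: linear_add[OF linear_reversal] linear_cmul[OF
          linear_reversal])
    then show "has_dirderiv (reversal n) v x (reversal n v)"
      unfolding has_dirderiv_def by (rule tendsto_eventually)
  qed
  have chol: "dirderiv (tpm_chol n F) (reversal n v) (reversal n x) = reversal n (dirderiv ?L v x)"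
    if v: "v \<in> herm n F" for v
  proof (rule dirderiv_eqI)
    have x': "x \<in> carrier (LPM_group (Fin n) F)" using x by (simp add: carrier_LPM)
    have "has_dirderiv ?L v x (dirderiv ?L v x)"
      using has_dirderiv_matrix[OF LM.line_U x' v, of ?L] lpm_chol_elementary
      by (simp add: carrier_LPM dirderiv_eqI)
    then have "((\<lambda>t. reversal n (inverse t *\<^sub>R (?L (x + t *\<^sub>R v) - ?L x))) \<longlongrightarrow> reversal n (dirderiv ?L v
        x)) (at 0)"
      unfolding has_dirderiv_def by (rule continuous_on_tendsto_compose[OF continuous_reversal]) auto
    moreover have "\<forall>\<^sub>F t in at (0::real). x + t *\<^sub>R v \<in> LPM_all (Fin n) F"
      using LM.line_U[of n] x v by (auto simp: line_open_def carrier_LPM)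
    then have "\<forall>\<^sub>F t in at (0::real). reversal n (inverse t *\<^sub>R (?L (x + t *\<^sub>R v) - ?L x)) =
        inverse t *\<^sub>R (tpm_chol n F (reversal n x + t *\<^sub>R reversal n v) - tpm_chol n F (reversal n x))"
    proof eventually_elim
      case (elim t)
      have "reversal n x + t *\<^sub>R reversal n v = reversal n (x + t *\<^sub>R v)"
        by (simp add: linear_add[OF linear_reversal] linear_cmul[OF linear_reversal])
      then show ?case
        by (simp only: tpm_chol_reversal[OF elim] tpm_chol_reversal[OF x] linear_cmul[OF
            linear_reversal]
            linear_diff[OF linear_reversal])
    qed
    ultimately show "has_dirderiv (tpm_chol n F) (reversal n v) (reversal n x) (reversal n (dirderiv
        ?L v x))"
      unfolding has_dirderiv_def using tendsto_cong by fast
  qed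
  have "LT_riem n (reversal n L) (reversal n X) (reversal n Y) = LT_riem n L X Y" for L X Y :: cmat
  proof -
    let ?I = "SIGMA i:{..<n}. {..<i}"
    have "Re (\<Sum>i<n. \<Sum>j<i. cnj (reversal n X i j) * reversal n Y i j) = (\<Sum>(i,
        j)\<in>?I. Re (cnj (reversal n X i j) * reversal n Y i j))"
      by (simp add: sum.Sigma[symmetric])
    also have "\<dots> = (\<Sum>(i, j)\<in>?I. Re (cnj (X i j) * Y i j))"
      by (rule sum.reindex_bij_witness[where i = "\<lambda>(i, j). (n - 1 - j, n - 1 - i)" and j = "\<lambda>(i,
          j). (n - 1 - j, n - 1 - i)"])
        (auto simp: reversal_entry)
    also have "\<dots> = Re (\<Sum>i<n. \<Sum>j<i. cnj (X i j) * Y i j)"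
      by (simp add: sum.Sigma[symmetric])
    finally have 1: "Re (\<Sum>i<n. \<Sum>j<i. cnj (reversal n X i j) * reversal n Y i j) = \<dots>" .
    have "(\<Sum>j<n. Re (reversal n X j j) * Re (reversal n Y j j) / (Re (reversal n L j j))\<^sup>2) =
        (\<Sum>j<n. Re (X (n - Suc j) (n - Suc j)) * Re (Y (n - Suc j) (n - Suc j)) / (Re (L (n - Suc j)
            (n - Suc j)))\<^sup>2)"
      by (simp add: reversal_entry)
    also have "\<dots> = (\<Sum>j<n. Re (X j j) * Re (Y j j) / (Re (L j j))\<^sup>2)"
      by (rule sum.nat_diff_reindex)
    finally show ?thesis unfolding LT_riem_def 1 by simp
  qed
  then show "tpm_riem n F (reversal n x) (dirderiv (reversal n) v x) (dirderiv (reversal n) w x) =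
      lpm_riem n F x v w"
    by (simp add: rev[OF v] rev[OF w] tpm_riem_def lpm_riem_def chol[OF v] chol[OF w]
        tpm_chol_reversal[OF x])
qed

section \<open>Collecting the results\<close>

lemma LPM_manifold:
  shows "1 \<le> p \<Longrightarrow> complete_separable_metric_lie_group (herm n F) (LPM_group (Fin n) F) (lpm_dist (Fin
      n) F p)"
    and "riemannian_manifold (herm n F) (LPM_all (Fin n) F) (lpm_riem n F)"
    and "bi_invariant_riemannian (herm n F) (LPM_group (Fin n) F) (lpm_riem n F)"
    and "sectional_curvature_zero (herm n F) (LPM_all (Fin n) F) (lpm_riem n F)"
proof -
  have d: "cone_chart.cone_dist (Fin n) (lpm_chol (Fin n) F) (lpm_sign (Fin n) F) = lpm_dist (Fin n) F"
    by (intro ext) (simp add: L.cone_dist_def lpm_dist_def)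
  have r: "manifold_chart.riem n (lpm_chol (Fin n) F) = lpm_riem n F"
      by (intro ext) (simp add: LM.riem_def lpm_riem_def)
  show "1 \<le> p \<Longrightarrow> complete_separable_metric_lie_group (herm n F) (LPM_group (Fin n) F) (lpm_dist (Fin
      n) F p)"
    using LM.complete_separable[of p n] unfolding d .
  show "riemannian_manifold (herm n F) (LPM_all (Fin n) F) (lpm_riem n F)"
    using LM.riemannian_U[of n] unfolding r carrier_LPM .
  show "bi_invariant_riemannian (herm n F) (LPM_group (Fin n) F) (lpm_riem n F)"
    using LM.bi_invariant_riem[of n] unfolding r .
  show "sectional_curvature_zero (herm n F) (LPM_all (Fin n) F) (lpm_riem n F)"
    using LM.sectional_curvature_zero_U[of n] unfolding r carrier_LPM .
qed

lemma TPM_manifold: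
  shows "1 \<le> p \<Longrightarrow> complete_separable_metric_lie_group (herm n F) (TPM_group n F) (tpm_dist n F p)"
    and "riemannian_manifold (herm n F) (TPM_all n F) (tpm_riem n F)"
    and "bi_invariant_riemannian (herm n F) (TPM_group n F) (tpm_riem n F)"
    and "sectional_curvature_zero (herm n F) (TPM_all n F) (tpm_riem n F)"
proof -
  have d: "cone_chart.cone_dist (Fin n) (tpm_chol n F) (tpm_sign n F) = tpm_dist n F"
    by (intro ext) (simp add: T.cone_dist_def tpm_dist_def)
  have r: "manifold_chart.riem n (tpm_chol n F) = tpm_riem n F"
      by (intro ext) (simp add: TM.riem_def tpm_riem_def)
  show "1 \<le> p \<Longrightarrow> complete_separable_metric_lie_group (herm n F) (TPM_group n F) (tpm_dist n F p)"
    using TM.complete_separable[of p n] unfolding d .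
  show "riemannian_manifold (herm n F) (TPM_all n F) (tpm_riem n F)"
    using TM.riemannian_U[of n] unfolding r carrier_TPM .
  show "bi_invariant_riemannian (herm n F) (TPM_group n F) (tpm_riem n F)"
    using TM.bi_invariant_riem[of n] unfolding r .
  show "sectional_curvature_zero (herm n F) (TPM_all n F) (tpm_riem n F)"
    using TM.sectional_curvature_zero_U[of n] unfolding r carrier_TPM .
qed

end

text \<open>Membership of the products in the cone is a premise because \<open>F\<close> may fail to
  be closed under conjugation; then \<open>ldl s L \<epsilon>\<close> with \<open>L\<close> over
  \<open>F\<close> can have entries outside \<open>F\<close>.\<close>

lemma LPM_group_facts:
  fixes F :: "complex set" and s :: shape
  assumes F: "is_subfield F"
    and sq: "\<forall>x::real. 0 < x \<and> complex_of_real x \<in> F \<longrightarrow> complex_of_real (sqrt x) \<in> F"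
  shows "\<forall>\<epsilon>\<in>signs s. \<forall>\<epsilon>'\<in>signs s. \<forall>L\<in>LT s F. \<forall>L'\<in>LT s F.
        ldl s L \<epsilon> \<in> LPM_all s F \<and> ldl s L' \<epsilon>' \<in> LPM_all s F \<longrightarrow>
        ldl s L \<epsilon> \<otimes>\<^bsub>LPM_group s F\<^esub> ldl s L' \<epsilon>' =
          LT_mult L L' \<star> (sign_diag s \<epsilon> \<star> sign_diag s \<epsilon>') \<star> ctrans (LT_mult L L') \<and>
        ldl s L \<epsilon> \<otimes>\<^bsub>LPM_group s F\<^esub> ldl s L' \<epsilon>' \<in> LPM s F (\<epsilon> \<otimes>\<^bsub>sign_group s\<^esub> \<epsilon>') \<and>
        inv\<^bsub>LPM_group s F\<^esub> (ldl s L \<epsilon>) = ldl s (LT_inv L) \<epsilon>" (is ?product)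
    and "comm_group (LPM_group s F)" (is ?comm)
    and "LPM_group s F \<cong> PD_group s F \<times>\<times> sign_group s" (is ?iso)
    and "subgroup (PD s F) (LPM_group s F)" (is ?subgroup)
    and "\<forall>A\<in>PD s F. \<forall>B\<in>PD s F.
        A \<otimes>\<^bsub>LPM_group s F\<^esub> B = lpm_cast s F \<one>\<^bsub>sign_group s\<^esub> A B" (is ?cast)
    and "\<forall>p::ereal. 1 \<le> p \<longrightarrow>
        bi_invariant_metric (LPM_group s F) (lpm_dist s F p) \<and>
        (\<forall>\<epsilon>\<in>signs s. \<forall>\<epsilon>'\<in>signs s. \<forall>L\<in>LT s F. \<forall>K\<in>LT s F.
           ldl s L \<epsilon> \<in> LPM_all s F \<and> ldl s K \<epsilon>' \<in> LPM_all s F \<longrightarrow>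
           lpm_dist s F p (ldl s L \<epsilon>) (ldl s K \<epsilon>') =
             lp_norm2 p (LT_dist s L K) (1 - (if \<epsilon> = \<epsilon>' then 1 else 0))) \<and>
        (\<forall>A\<in>PD s F. \<forall>B\<in>PD s F. lpm_dist s F p A B = pd_dist s F A B) \<and>
        (\<forall>\<epsilon>\<in>signs s. \<forall>\<epsilon>'\<in>signs s.
           lpm_dist s F p (sign_diag s \<epsilon>) (sign_diag s \<epsilon>') = (if \<epsilon> = \<epsilon>' then 0 else 1))" (is ?metric)
    and "torsion_elements (LPM_group s F) - {\<one>\<^bsub>LPM_group s F\<^esub>} =
       {sign_diag s \<epsilon> |\<epsilon>. \<epsilon> \<in> signs s \<and> \<epsilon> \<noteq> \<one>\<^bsub>sign_group s\<^esub>}" (is ?torsion)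
proof -
  interpret C: cone_chart s "conj_core F" "ldl s" "LPM_group s F" "lpm_chol s F" "lpm_sign s F"
    by (rule cone_chart_LPM[OF F sq])
  note one = sign_one_signs[of s]
  note core = LT_core_of_ldl[OF F sq] and sgn = lpm_sign_ldl[OF F sq] and chol = lpm_chol_ldl[OF F sq]
  have PD: "PD s F = {ldl s L \<one>\<^bsub>sign_group s\<^esub> |L. L \<in> LT s (conj_core F)}"
    by (rule LPM_eq[OF F sq one])
  show ?product
  proof (intro ballI impI)
    fix \<epsilon> \<epsilon>' L L' assume \<epsilon>: "\<epsilon> \<in> signs s" "\<epsilon>' \<in> signs s" and "L \<in> LT s F" "L' \<in> LT s F"
      and "ldl s L \<epsilon> \<in> LPM_all s F \<and> ldl s L' \<epsilon>' \<in> LPM_all s F"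
    then have L: "L \<in> LT s (conj_core F)" "L' \<in> LT s (conj_core F)" using core by blast+
    have p: "ldl s L \<epsilon> \<otimes>\<^bsub>LPM_group s F\<^esub> ldl s L' \<epsilon>' = ldl s (LT_mult L L') (\<epsilon> \<otimes>\<^bsub>sign_group s\<^esub> \<epsilon>')"
      by (rule C.mult_chart[OF L(1) \<epsilon>(1) L(2) \<epsilon>(2)])
    moreover have "ldl s (LT_mult L L') (\<epsilon> \<otimes>\<^bsub>sign_group s\<^esub> \<epsilon>') \<in> LPM s F (\<epsilon> \<otimes>\<^bsub>sign_group s\<^esub> \<epsilon>')"
      unfolding LPM_eq[OF F sq C.S.m_closed[OF \<epsilon>]] using LT_mult_closed[OF C.K L] by blast
    ultimately show "ldl s L \<epsilon> \<otimes>\<^bsub>LPM_group s F\<^esub> ldl s L' \<epsilon>' =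
          LT_mult L L' \<star> (sign_diag s \<epsilon> \<star> sign_diag s \<epsilon>') \<star> ctrans (LT_mult L L') \<and>
        ldl s L \<epsilon> \<otimes>\<^bsub>LPM_group s F\<^esub> ldl s L' \<epsilon>' \<in> LPM s F (\<epsilon> \<otimes>\<^bsub>sign_group s\<^esub> \<epsilon>') \<and>
        inv\<^bsub>LPM_group s F\<^esub> (ldl s L \<epsilon>) = ldl s (LT_inv L) \<epsilon>"
      unfolding sign_diag_mult[OF \<epsilon>] using C.inv_chart[OF L(1) \<epsilon>(1)] by (simp add: ldl_def)
  qed
  show ?comm by (rule C.comm_group_G)
  show ?subgroup unfolding PD by (rule C.subgroup_positive)
  show cast: ?cast
  proof (intro ballI)
    fix A B assume "A \<in> PD s F" "B \<in> PD s F"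
    then obtain L K where L: "L \<in> LT s (conj_core F)" "A = ldl s L \<one>\<^bsub>sign_group s\<^esub>"
        "K \<in> LT s (conj_core F)" "B = ldl s K \<one>\<^bsub>sign_group s\<^esub>" unfolding PD by blast
    show "A \<otimes>\<^bsub>LPM_group s F\<^esub> B = lpm_cast s F \<one>\<^bsub>sign_group s\<^esub> A B"
      unfolding lpm_cast_def L(2,4) C.mult_chart[OF L(1) one L(3) one] sign_square[OF one]
        ldl_factor_ldl[OF F sq L(1) one] ldl_factor_ldl[OF F sq L(3) one] ..
  qed
  show ?iso
  proof (rule C.iso_positive)
    show "carrier (PD_group s F) = {ldl s L \<one>\<^bsub>sign_group s\<^esub> |L. L \<in> LT s (conj_core F)}"
      unfolding PD_group_def using PD by simp
    fix A B assume "A \<in> {ldl s L \<one>\<^bsub>sign_group s\<^esub> |L. L \<in> LT s (conj_core F)}"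
      "B \<in> {ldl s L \<one>\<^bsub>sign_group s\<^esub> |L. L \<in> LT s (conj_core F)}"
    then have "A \<otimes>\<^bsub>LPM_group s F\<^esub> B = lpm_cast s F \<one>\<^bsub>sign_group s\<^esub> A B"
      using cast unfolding PD[symmetric] by blast
    then show "A \<otimes>\<^bsub>PD_group s F\<^esub> B = A \<otimes>\<^bsub>LPM_group s F\<^esub> B" by (simp add: PD_group_def)
  qed
  have dist: "lpm_dist s F p (ldl s L \<epsilon>) (ldl s K \<epsilon>') =
      lp_norm2 p (LT_dist s L K) (1 - (if \<epsilon> = \<epsilon>' then 1 else 0))"
    if "L \<in> LT s (conj_core F)" "\<epsilon> \<in> signs s" "K \<in> LT s (conj_core F)" "\<epsilon>' \<in> signs s" for p L \<epsilon> K \<epsilon>'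
    unfolding lpm_dist_def sgn[OF that(1,2)] sgn[OF that(3,4)] chol[OF that(1,2)] chol[OF that(3,4)] ..
  show ?metric
  proof (intro allI impI conjI ballI)
    fix p :: ereal assume p: "1 \<le> p"
    have "C.cone_dist p = lpm_dist s F p" by (intro ext) (simp add: C.cone_dist_def lpm_dist_def)
    then show "bi_invariant_metric (LPM_group s F) (lpm_dist s F p)"
        using C.bi_invariant_cone_dist[OF p] by simp
    show "lpm_dist s F p (ldl s L \<epsilon>) (ldl s K \<epsilon>') = lp_norm2 p (LT_dist s L K) (1 - (if \<epsilon> =
        \<epsilon>' then 1 else 0))"
      if "\<epsilon> \<in> signs s" "\<epsilon>' \<in> signs s" "L \<in> LT s F" "K \<in> LT s F"
        "ldl s L \<epsilon> \<in> LPM_all s F \<and> ldl s K \<epsilon>' \<in> LPM_all s F" for \<epsilon> \<epsilon>' L K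
      using that core by (intro dist) blast+
    show "lpm_dist s F p A B = pd_dist s F A B" if AB: "A \<in> PD s F" "B \<in> PD s F" for A B
    proof -
      obtain L K where L: "L \<in> LT s (conj_core F)" "A = ldl s L \<one>\<^bsub>sign_group s\<^esub>"
          "K \<in> LT s (conj_core F)" "B = ldl s K \<one>\<^bsub>sign_group s\<^esub>" using AB unfolding PD by blast
      show ?thesis
        unfolding pd_dist_def L(2,4) dist[OF L(1) one L(3) one] pd_chol_ldl[OF F sq L(1)]
            pd_chol_ldl[OF F sq L(3)]
        using LT_dist_nonneg[of s L K] by (simp add: lp_norm2_left[OF p])
    qed
    show "lpm_dist s F p (sign_diag s \<epsilon>) (sign_diag s \<epsilon>') = (if \<epsilon> = \<epsilon>' then 0 else 1)"
      if \<epsilon>: "\<epsilon> \<in> signs s" "\<epsilon>' \<in> signs s" for \<epsilon> \<epsilon>'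
    proof -
      note I = idmat_closed[OF C.K, of s]
      have "LT_dist s (idmat s) (idmat s) = 0" using LT_dist_zero[OF I I] by simp
      then show ?thesis
        using dist[OF I \<epsilon>(1) I \<epsilon>(2), of p] ldl_idmat[of s \<epsilon>] ldl_idmat[of s \<epsilon>']
        by (simp add: lp_norm2_right[OF p])
    qed
  qed
  show ?torsion
    unfolding C.torsion_eq ldl_idmat ..
qed

lemma TPM_group_facts:
  fixes F :: "complex set" and n :: nat
  assumes F: "is_subfield F"
    and sq: "\<forall>x::real. 0 < x \<and> complex_of_real x \<in> F \<longrightarrow> complex_of_real (sqrt x) \<in> F"
  shows "\<forall>\<epsilon>\<in>signs (Fin n). \<forall>\<epsilon>'\<in>signs (Fin n). \<forall>L\<in>LT (Fin n) F. \<forall>L'\<in>LT (Fin n) F.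
           tldl n L \<epsilon> \<in> TPM_all n F \<and> tldl n L' \<epsilon>' \<in> TPM_all n F \<longrightarrow>
           tldl n L \<epsilon> \<otimes>\<^bsub>TPM_group n F\<^esub> tldl n L' \<epsilon>' =
             ctrans (LT_mult L L') \<star> antidiag n \<star> (sign_diag (Fin n) \<epsilon> \<star> sign_diag (Fin n) \<epsilon>') \<star>
             antidiag n \<star> LT_mult L L' \<and>
           tldl n L \<epsilon> \<otimes>\<^bsub>TPM_group n F\<^esub> tldl n L' \<epsilon>' \<in> TPM n F (\<epsilon> \<otimes>\<^bsub>sign_group (Fin n)\<^esub> \<epsilon>') \<and>
           inv\<^bsub>TPM_group n F\<^esub> (tldl n L \<epsilon>) = tldl n (LT_inv L) \<epsilon>" (is ?product)
    and "comm_group (TPM_group n F)" (is ?comm)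
    and "subgroup (TPM n F \<one>\<^bsub>sign_group (Fin n)\<^esub>) (TPM_group n F)" (is ?subgroup)
    and "TPM_group n F \<cong>
          (TPM_group n F)\<lparr>carrier := TPM n F \<one>\<^bsub>sign_group (Fin n)\<^esub>\<rparr> \<times>\<times> sign_group (Fin n)" (is ?iso)
    and "\<forall>p::ereal. 1 \<le> p \<longrightarrow>
           bi_invariant_metric (TPM_group n F) (tpm_dist n F p) \<and>
           (\<forall>\<epsilon>\<in>signs (Fin n). \<forall>\<epsilon>'\<in>signs (Fin n). \<forall>L\<in>LT (Fin n) F. \<forall>K\<in>LT (Fin n) F.
              tldl n L \<epsilon> \<in> TPM_all n F \<and> tldl n K \<epsilon>' \<in> TPM_all n F \<longrightarrow>
              tpm_dist n F p (tldl n L \<epsilon>) (tldl n K \<epsilon>') =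
                lp_norm2 p (LT_dist (Fin n) L K) (1 - (if \<epsilon> = \<epsilon>' then 1 else 0)))" (is ?metric)
proof -
  interpret C: cone_chart "Fin n" "conj_core F" "tldl n" "TPM_group n F" "tpm_chol n F" "tpm_sign n F"
    by (rule cone_chart_TPM[OF F sq])
  note one = sign_one_signs[of "Fin n"]
  note core = LT_core_of_tldl[OF F sq] and sgn = tpm_sign_tldl[OF F sq] and chol =
      tpm_chol_tldl[OF F sq]
  have PD: "TPM n F \<one>\<^bsub>sign_group (Fin n)\<^esub> = {tldl n L \<one>\<^bsub>sign_group (Fin n)\<^esub> |L. L \<in> LT (Fin n)
      (conj_core F)}"
    by (rule TPM_eq[OF F sq one])
  show ?product
  proof (intro ballI impI)
    fix \<epsilon> \<epsilon>' L L' assume \<epsilon>: "\<epsilon> \<in> signs (Fin n)" "\<epsilon>' \<in> signs (Fin n)" and "L \<in> LT (Fin n) F" "L' \<in> LT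
        (Fin n) F"
      and "tldl n L \<epsilon> \<in> TPM_all n F \<and> tldl n L' \<epsilon>' \<in> TPM_all n F"
    then have L: "L \<in> LT (Fin n) (conj_core F)" "L' \<in> LT (Fin n) (conj_core F)" using core by blast+
    have p: "tldl n L \<epsilon> \<otimes>\<^bsub>TPM_group n F\<^esub> tldl n L' \<epsilon>' = tldl n (LT_mult L L') (\<epsilon> \<otimes>\<^bsub>sign_group (Fin n)\<^esub> \<epsilon>')"
      by (rule C.mult_chart[OF L(1) \<epsilon>(1) L(2) \<epsilon>(2)])
    moreover have "tldl n (LT_mult L L') (\<epsilon> \<otimes>\<^bsub>sign_group (Fin n)\<^esub> \<epsilon>') \<in> TPM n F (\<epsilon> \<otimes>\<^bsub>sign_group (Fin n)\<^esub>
        \<epsilon>')"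
      unfolding TPM_eq[OF F sq C.S.m_closed[OF \<epsilon>]] using LT_mult_closed[OF C.K L] by blast
    ultimately show "tldl n L \<epsilon> \<otimes>\<^bsub>TPM_group n F\<^esub> tldl n L' \<epsilon>' =
             ctrans (LT_mult L L') \<star> antidiag n \<star> (sign_diag (Fin n) \<epsilon> \<star> sign_diag (Fin n) \<epsilon>') \<star>
             antidiag n \<star> LT_mult L L' \<and>
           tldl n L \<epsilon> \<otimes>\<^bsub>TPM_group n F\<^esub> tldl n L' \<epsilon>' \<in> TPM n F (\<epsilon> \<otimes>\<^bsub>sign_group (Fin n)\<^esub> \<epsilon>') \<and>
           inv\<^bsub>TPM_group n F\<^esub> (tldl n L \<epsilon>) = tldl n (LT_inv L) \<epsilon>"
      unfolding sign_diag_mult[OF \<epsilon>] using C.inv_chart[OF L(1) \<epsilon>(1)] by (simp add: tldl_def)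
  qed
  show ?comm by (rule C.comm_group_G)
  show ?subgroup unfolding PD by (rule C.subgroup_positive)
  show ?iso by (rule C.iso_positive) (simp_all add: PD)
  show ?metric
  proof (intro allI impI conjI ballI)
    fix p :: ereal assume p: "1 \<le> p"
    have "C.cone_dist p = tpm_dist n F p" by (intro ext) (simp add: C.cone_dist_def tpm_dist_def)
    then show "bi_invariant_metric (TPM_group n F) (tpm_dist n F p)"
        using C.bi_invariant_cone_dist[OF p] by simp
    fix \<epsilon> \<epsilon>' L K assume \<epsilon>: "\<epsilon> \<in> signs (Fin n)" "\<epsilon>' \<in> signs (Fin n)" and "L \<in> LT (Fin n) F" "K \<in> LT
        (Fin n) F"
      and "tldl n L \<epsilon> \<in> TPM_all n F \<and> tldl n K \<epsilon>' \<in> TPM_all n F"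
    then have L: "L \<in> LT (Fin n) (conj_core F)" "K \<in> LT (Fin n) (conj_core F)" using core by blast+
    show "tpm_dist n F p (tldl n L \<epsilon>) (tldl n K \<epsilon>') = lp_norm2 p (LT_dist (Fin n) L K) (1 - (if \<epsilon> =
        \<epsilon>' then 1 else 0))"
      unfolding tpm_dist_def sgn[OF L(1) \<epsilon>(1)] sgn[OF L(2) \<epsilon>(2)] chol[OF L(1) \<epsilon>(1)] chol[OF L(2)
          \<epsilon>(2)] ..
  qed
qed

theorem theorem6p2:
  fixes F :: "complex set" and s :: shape
  assumes "is_subfield F"
    and "\<forall>x::real. 0 < x \<and> complex_of_real x \<in> F \<longrightarrow> complex_of_real (sqrt x) \<in> F"
    and "\<forall>n. s = Fin n \<longrightarrow> 1 \<le> n"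
  shows
    "(\<forall>\<epsilon>\<in>signs s. \<forall>\<epsilon>'\<in>signs s. \<forall>L\<in>LT s F. \<forall>L'\<in>LT s F.
        ldl s L \<epsilon> \<in> LPM_all s F \<and> ldl s L' \<epsilon>' \<in> LPM_all s F \<longrightarrow>
        ldl s L \<epsilon> \<otimes>\<^bsub>LPM_group s F\<^esub> ldl s L' \<epsilon>' =
          LT_mult L L' \<star> (sign_diag s \<epsilon> \<star> sign_diag s \<epsilon>') \<star> ctrans (LT_mult L L') \<and>
        ldl s L \<epsilon> \<otimes>\<^bsub>LPM_group s F\<^esub> ldl s L' \<epsilon>' \<in> LPM s F (\<epsilon> \<otimes>\<^bsub>sign_group s\<^esub> \<epsilon>') \<and>
        inv\<^bsub>LPM_group s F\<^esub> (ldl s L \<epsilon>) = ldl s (LT_inv L) \<epsilon>) \<and>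

     \<comment> \<open>(1)\<close>
     comm_group (LPM_group s F) \<and>
     LPM_group s F \<cong> PD_group s F \<times>\<times> sign_group s \<and>
     subgroup (PD s F) (LPM_group s F) \<and>
     (\<forall>A\<in>PD s F. \<forall>B\<in>PD s F.
        A \<otimes>\<^bsub>LPM_group s F\<^esub> B = lpm_cast s F \<one>\<^bsub>sign_group s\<^esub> A B) \<and>

     \<comment> \<open>(2)\<close>
     (\<forall>p::ereal. 1 \<le> p \<longrightarrow>
        bi_invariant_metric (LPM_group s F) (lpm_dist s F p) \<and>
        (\<forall>\<epsilon>\<in>signs s. \<forall>\<epsilon>'\<in>signs s. \<forall>L\<in>LT s F. \<forall>K\<in>LT s F.
           ldl s L \<epsilon> \<in> LPM_all s F \<and> ldl s K \<epsilon>' \<in> LPM_all s F \<longrightarrow>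
           lpm_dist s F p (ldl s L \<epsilon>) (ldl s K \<epsilon>') =
             lp_norm2 p (LT_dist s L K) (1 - (if \<epsilon> = \<epsilon>' then 1 else 0))) \<and>
        (\<forall>A\<in>PD s F. \<forall>B\<in>PD s F. lpm_dist s F p A B = pd_dist s F A B) \<and>
        (\<forall>\<epsilon>\<in>signs s. \<forall>\<epsilon>'\<in>signs s.
           lpm_dist s F p (sign_diag s \<epsilon>) (sign_diag s \<epsilon>') = (if \<epsilon> = \<epsilon>' then 0 else 1))) \<and>

     \<comment> \<open>(3)\<close>
     (\<forall>n. s = Fin n \<longrightarrow>
        (\<forall>\<epsilon>\<in>signs s. \<forall>\<epsilon>'\<in>signs s. \<forall>L\<in>LT s F. \<forall>L'\<in>LT s F.
           tldl n L \<epsilon> \<in> TPM_all n F \<and> tldl n L' \<epsilon>' \<in> TPM_all n F \<longrightarrow>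
           tldl n L \<epsilon> \<otimes>\<^bsub>TPM_group n F\<^esub> tldl n L' \<epsilon>' =
             ctrans (LT_mult L L') \<star> antidiag n \<star> (sign_diag s \<epsilon> \<star> sign_diag s \<epsilon>') \<star>
             antidiag n \<star> LT_mult L L' \<and>
           tldl n L \<epsilon> \<otimes>\<^bsub>TPM_group n F\<^esub> tldl n L' \<epsilon>' \<in> TPM n F (\<epsilon> \<otimes>\<^bsub>sign_group s\<^esub> \<epsilon>') \<and>
           inv\<^bsub>TPM_group n F\<^esub> (tldl n L \<epsilon>) = tldl n (LT_inv L) \<epsilon>) \<and>
        comm_group (TPM_group n F) \<and>
        subgroup (TPM n F \<one>\<^bsub>sign_group s\<^esub>) (TPM_group n F) \<and>
        TPM_group n F \<cong>
          (TPM_group n F)\<lparr>carrier := TPM n F \<one>\<^bsub>sign_group s\<^esub>\<rparr> \<times>\<times> sign_group s \<and>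
        (\<forall>p::ereal. 1 \<le> p \<longrightarrow>
           bi_invariant_metric (TPM_group n F) (tpm_dist n F p) \<and>
           (\<forall>\<epsilon>\<in>signs s. \<forall>\<epsilon>'\<in>signs s. \<forall>L\<in>LT s F. \<forall>K\<in>LT s F.
              tldl n L \<epsilon> \<in> TPM_all n F \<and> tldl n K \<epsilon>' \<in> TPM_all n F \<longrightarrow>
              tpm_dist n F p (tldl n L \<epsilon>) (tldl n K \<epsilon>') =
                lp_norm2 p (LT_dist s L K) (1 - (if \<epsilon> = \<epsilon>' then 1 else 0)))) \<and>
        (F = \<real> \<or> F = UNIV \<longrightarrow>
           (\<forall>p::ereal. 1 \<le> p \<longrightarrow>
              complete_separable_metric_lie_group (herm n F) (LPM_group s F) (lpm_dist s F p) \<and>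
              complete_separable_metric_lie_group (herm n F) (TPM_group n F) (tpm_dist n F p)) \<and>
           riemannian_manifold (herm n F) (LPM_all s F) (lpm_riem n F) \<and>
           riemannian_manifold (herm n F) (TPM_all n F) (tpm_riem n F) \<and>
           bi_invariant_riemannian (herm n F) (LPM_group s F) (lpm_riem n F) \<and>
           bi_invariant_riemannian (herm n F) (TPM_group n F) (tpm_riem n F) \<and>
           sectional_curvature_zero (herm n F) (LPM_all s F) (lpm_riem n F) \<and>
           sectional_curvature_zero (herm n F) (TPM_all n F) (tpm_riem n F) \<and>
           lie_group_iso (herm n F) (LPM_group s F) (herm n F) (TPM_group n F) (reversal n) \<and>
           (\<forall>p::ereal. 1 \<le> p \<longrightarrow>
              (\<forall>A\<in>LPM_all s F. \<forall>B\<in>LPM_all s F.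
                 tpm_dist n F p (reversal n A) (reversal n B) = lpm_dist s F p A B)) \<and>
           riemannian_isometry_on (herm n F) (LPM_all s F)
             (lpm_riem n F) (tpm_riem n F) (reversal n))) \<and>

     \<comment> \<open>(4)\<close>
     torsion_elements (LPM_group s F) - {\<one>\<^bsub>LPM_group s F\<^esub>} =
       {sign_diag s \<epsilon> |\<epsilon>. \<epsilon> \<in> signs s \<and> \<epsilon> \<noteq> \<one>\<^bsub>sign_group s\<^esub>}"
proof (intro conjI LPM_group_facts[OF assms(1,2)], rule allI, rule impI, goal_cases)
  case (1 n)
  show ?case unfolding 1
  proof (intro conjI TPM_group_facts[OF assms(1,2)], rule impI, goal_cases)
    case 1
    then interpret real_or_complex F by unfold_locales
    show ?case
      by (intro conjI allI impI ballI LPM_manifold TPM_manifold reversal_iso reversal_riem reversal_dist)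
  qed
qed

end
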